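(* An ${\mathcal L}({\mathcal U},{\mathcal Y})$-valued function $S$ defined on ${\mathbb B}^d$ is an inner multiplier if and only if it admits a weakly coisometric realization $S(\lambda)=D+C(I-Z(\lambda)A)^{-1}Z(\lambda)B$ such that (1) the state tuple ${\mathbf A}=(A_1,\dots,A_d)$ is commutative and strongly stable, and (2) the output pair $(C,{\mathbf A})$ is isometric, i.e., $\sum_{j=1}^dA_j^*A_j+C^*C=I_{\mathcal X}$.
   Context: Let ${\mathbb B}^d=\{\lambda\in{\mathbb C}^d:\langle\lambda,\lambda\rangle<1\}$. ${\mathcal H}_{\mathcal Y}(k_d)$ is the reproducing kernel Hilbert space of ${\mathcal Y}$-valued functions on ${\mathbb B}^d$ with kernel $k_d(\lambda,\zeta)I_{\mathcal Y}$, $k_d(\lambda,\zeta)=1/(1-\langle\lambda,\zeta\rangle)$. ${\mathcal S}_d({\mathcal U},{\mathcal Y})$ is the set of ${\mathcal L}({\mathcal U},{\mathcal Y})$-valued holomorphic $S$ on ${\mathbb B}^d$ such that $M_S:f\mapsto Sf$ is a contraction from ${\mathcal H}_{\mathcal U}(k_d)$ into ${\mathcal H}_{\mathcal Y}(k_d)$; $S$ is an inner multiplier if it is in ${\mathcal S}_d({\mathcal U},{\mathcal Y})$ and $M_S$ is a partial isometry. A realization: Hilbert space ${\mathcal X}$, $A_j\in{\mathcal L}({\mathcal X})$, $B_j\in{\mathcal L}({\mathcal U},{\mathcal X})$, $C\in{\mathcal L}({\mathcal X},{\mathcal Y})$, $D\in{\mathcal L}({\mathcal U},{\mathcal Y})$,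 $A=\mathrm{col}(A_j)$, $B=\mathrm{col}(B_j)$, $Z(\lambda)=[\lambda_1I_{\mathcal X}\ \cdots\ \lambda_dI_{\mathcal X}]$, connecting operator ${\mathbf U}=\begin{bmatrix}A&B\\C&D\end{bmatrix}:{\mathcal X}\oplus{\mathcal U}\to{\mathcal X}^d\oplus{\mathcal Y}$. Weakly coisometric: ${\mathbf U}$ is a contraction and ${\mathbf U}^*$ is isometric on ${\mathcal D}\oplus{\mathcal Y}$, ${\mathcal D}=\overline{\mathrm{span}}\{Z(\zeta)^*(I-A^*Z(\zeta)^* )^{-1}C^*y:\zeta\in{\mathbb B}^d,y\in{\mathcal Y}\}$. Commutative: $A_iA_j=A_jA_i$. For commuting ${\mathbf A}$ and $n\in{\mathbb Z}_+^d$, ${\mathbf A}^n=A_1^{n_1}\cdots A_d^{n_d}$; ${\mathbf A}$ is strongly stable if $\lim_{N\to\infty}\sum_{n\in{\mathbb Z}_+^d,|n|=N}\frac{N!}{n!}\|{\mathbf A}^nx\|^2=0$ for all $x\in{\mathcal X}$ ($n!=n_1!\cdots n_d!$, $|n|=\sum n_j$). *)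

theory Defs
  imports "HOL-Analysis.Analysis" "HOL-Library.Function_Algebras"
begin

class cvector = ab_group_add +
  fixes scaleC :: "complex \<Rightarrow> 'a \<Rightarrow> 'a" (infixr "*\<^sub>C" 75)
  assumes scaleC_add_right: "a *\<^sub>C (x + y) = a *\<^sub>C x + a *\<^sub>C y"
    and scaleC_add_left: "(a + b) *\<^sub>C x = a *\<^sub>C x + b *\<^sub>C x"
    and scaleC_scaleC: "a *\<^sub>C (b *\<^sub>C x) = (a * b) *\<^sub>C x"
    and scaleC_one: "1 *\<^sub>C x = x"

instantiation "fun" :: (type, cvector) cvector
begin
definition scaleC_fun :: "complex \<Rightarrow> ('a \<Rightarrow> 'b) \<Rightarrow> 'a \<Rightarrow> 'b" where
  "scaleC_fun c f = (\<lambda>x. c *\<^sub>C f x)"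
instance
  by standard (auto simp: scaleC_fun_def fun_eq_iff scaleC_add_right scaleC_add_left scaleC_scaleC scaleC_one)
end

definition hnorm :: "('a \<Rightarrow> 'a \<Rightarrow> complex) \<Rightarrow> 'a \<Rightarrow> real" where
  "hnorm ip x = sqrt (Re (ip x x))"

definition hilbert_space :: "'a::cvector set \<Rightarrow> ('a \<Rightarrow> 'a \<Rightarrow> complex) \<Rightarrow> bool" where
  "hilbert_space V ip \<longleftrightarrow>
     0 \<in> V \<and> (\<forall>x\<in>V. \<forall>y\<in>V. x + y \<in> V) \<and> (\<forall>c. \<forall>x\<in>V. c *\<^sub>C x \<in> V) \<and>
     (\<forall>x\<in>V. \<forall>y\<in>V. \<forall>z\<in>V. ip (x + y) z = ip x z + ip y z) \<and>
     (\<forall>c. \<forall>x\<in>V. \<forall>y\<in>V. ip (c *\<^sub>C x) y = c * ip x y) \<and>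
     (\<forall>x\<in>V. \<forall>y\<in>V. ip y x = cnj (ip x y)) \<and>
     (\<forall>x\<in>V. x \<noteq> 0 \<longrightarrow> 0 < Re (ip x x)) \<and>
     (\<forall>s. (\<forall>n. s n \<in> V) \<and> (\<forall>e>0. \<exists>N. \<forall>m\<ge>N. \<forall>n\<ge>N. hnorm ip (s m - s n) < e) \<longrightarrow>
          (\<exists>l\<in>V. (\<lambda>n. hnorm ip (s n - l)) \<longlonglongrightarrow> 0))"

definition bounded_op :: "'a::cvector set \<Rightarrow> ('a \<Rightarrow> 'a \<Rightarrow> complex) \<Rightarrow>
    'b::cvector set \<Rightarrow> ('b \<Rightarrow> 'b \<Rightarrow> complex) \<Rightarrow> ('a \<Rightarrow> 'b) \<Rightarrow> bool" where
  "bounded_op V ipV W ipW T \<longleftrightarrow>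
     (\<forall>x\<in>V. T x \<in> W) \<and> (\<forall>x\<in>V. \<forall>y\<in>V. T (x + y) = T x + T y) \<and>
     (\<forall>c. \<forall>x\<in>V. T (c *\<^sub>C x) = c *\<^sub>C T x) \<and>
     (\<exists>K. \<forall>x\<in>V. hnorm ipW (T x) \<le> K * hnorm ipV x)"

definition hadj :: "'a::cvector set \<Rightarrow> ('a \<Rightarrow> 'a \<Rightarrow> complex) \<Rightarrow>
    'b::cvector set \<Rightarrow> ('b \<Rightarrow> 'b \<Rightarrow> complex) \<Rightarrow> ('a \<Rightarrow> 'b) \<Rightarrow> ('b \<Rightarrow> 'a)" where
  "hadj V ipV W ipW T = (SOME T'. (\<forall>y\<in>W. T' y \<in> V) \<and>
       (\<forall>x\<in>V. \<forall>y\<in>W. ipW (T x) y = ipV x (T' y)))"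

definition inv_I_minus :: "'a::cvector set \<Rightarrow> ('a \<Rightarrow> 'a) \<Rightarrow> ('a \<Rightarrow> 'a)" where
  "inv_I_minus V T = (SOME R. \<forall>x\<in>V. R x \<in> V \<and> R x - T (R x) = x \<and> R (x - T x) = x)"

definition cinner_d :: "complex^'d \<Rightarrow> complex^'d \<Rightarrow> complex" where
  "cinner_d l z = (\<Sum>j\<in>UNIV. l$j * cnj (z$j))"

definition ball_d :: "(complex^'d) set" where
  "ball_d = {l. Re (cinner_d l l) < 1}"

definition kd :: "complex^'d \<Rightarrow> complex^'d \<Rightarrow> complex" where
  "kd l z = 1 / (1 - cinner_d l z)"

text \<open>For a Y-valued function f on the ball, the pairing of f with the kernel element
  g = \<Sum>i k_d(\<cdot>,\<zeta>_i) y_i is \<Sum>i <f(\<zeta>_i), y_i>, and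
  ||g||^2 = \<Sum>i,j k_d(\<zeta>_j,\<zeta>_i) <y_i,y_j>.  f belongs to H_Y(k_d) iff this functional is
  bounded on the (dense) span of the kernel functions, and ||f||^2 is the least bound
  (Aronszajn's construction of the RKHS).\<close>

definition rk_bound :: "'y::cvector set \<Rightarrow> ('y \<Rightarrow> 'y \<Rightarrow> complex) \<Rightarrow>
    (complex^'d \<Rightarrow> 'y) \<Rightarrow> real \<Rightarrow> bool" where
  "rk_bound Y ipY f M \<longleftrightarrow>
     (\<forall>(n::nat) (\<zeta>::nat \<Rightarrow> complex^'d) (y::nat \<Rightarrow> 'y).
        (\<forall>i<n. \<zeta> i \<in> ball_d \<and> y i \<in> Y) \<longrightarrow>
        (cmod (\<Sum>i<n. ipY (f (\<zeta> i)) (y i)))\<^sup>2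
          \<le> M * Re (\<Sum>i<n. \<Sum>j<n. kd (\<zeta> j) (\<zeta> i) * ipY (y i) (y j)))"

definition in_Hkd :: "'y::cvector set \<Rightarrow> ('y \<Rightarrow> 'y \<Rightarrow> complex) \<Rightarrow>
    (complex^'d \<Rightarrow> 'y) \<Rightarrow> bool" where
  "in_Hkd Y ipY f \<longleftrightarrow> (\<forall>l\<in>ball_d. f l \<in> Y) \<and> (\<exists>M. rk_bound Y ipY f M)"

definition Hkd_norm :: "'y::cvector set \<Rightarrow> ('y \<Rightarrow> 'y \<Rightarrow> complex) \<Rightarrow>
    (complex^'d \<Rightarrow> 'y) \<Rightarrow> real" where
  "Hkd_norm Y ipY f = sqrt (Inf {M. 0 \<le> M \<and> rk_bound Y ipY f M})"

text \<open>Inner product of H_Y(k_d) via the polarization identity.\<close>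

definition Hkd_inner :: "'y::cvector set \<Rightarrow> ('y \<Rightarrow> 'y \<Rightarrow> complex) \<Rightarrow>
    (complex^'d \<Rightarrow> 'y) \<Rightarrow> (complex^'d \<Rightarrow> 'y) \<Rightarrow> complex" where
  "Hkd_inner Y ipY f g = (1/4) * (\<Sum>k<(4::nat).
      \<i>^k * complex_of_real ((Hkd_norm Y ipY (\<lambda>z. f z + (\<i>^k) *\<^sub>C g z))\<^sup>2))"

definition holomorphic_d :: "(complex^'d \<Rightarrow> complex) \<Rightarrow> (complex^'d) set \<Rightarrow> bool" where
  "holomorphic_d f A \<longleftrightarrow> (\<forall>l\<in>A. \<exists>L. (f has_derivative L) (at l) \<and>
       (\<forall>c v. L (\<chi> j. c * v$j) = c * L v))"

definition op_holomorphic :: "'u::cvector set \<Rightarrow> ('u \<Rightarrow> 'u \<Rightarrow> complex) \<Rightarrow>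
    'y::cvector set \<Rightarrow> ('y \<Rightarrow> 'y \<Rightarrow> complex) \<Rightarrow> (complex^'d \<Rightarrow> 'u \<Rightarrow> 'y) \<Rightarrow> bool" where
  "op_holomorphic U ipU Y ipY S \<longleftrightarrow>
     (\<forall>l\<in>ball_d. bounded_op U ipU Y ipY (S l)) \<and>
     (\<forall>u\<in>U. \<forall>y\<in>Y. holomorphic_d (\<lambda>l. ipY (S l u) y) ball_d)"

definition mult_op :: "(complex^'d \<Rightarrow> 'u \<Rightarrow> 'y) \<Rightarrow> (complex^'d \<Rightarrow> 'u) \<Rightarrow> (complex^'d \<Rightarrow> 'y)" where
  "mult_op S f = (\<lambda>l. S l (f l))"

definition schur_class :: "'u::cvector set \<Rightarrow> ('u \<Rightarrow> 'u \<Rightarrow> complex) \<Rightarrow>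
    'y::cvector set \<Rightarrow> ('y \<Rightarrow> 'y \<Rightarrow> complex) \<Rightarrow> (complex^'d \<Rightarrow> 'u \<Rightarrow> 'y) \<Rightarrow> bool" where
  "schur_class U ipU Y ipY S \<longleftrightarrow>
     op_holomorphic U ipU Y ipY S \<and>
     (\<forall>f. in_Hkd U ipU f \<longrightarrow>
        in_Hkd Y ipY (mult_op S f) \<and> Hkd_norm Y ipY (mult_op S f) \<le> Hkd_norm U ipU f)"

text \<open>Inner multiplier: additionally M_S is a partial isometry, i.e. isometric on the
  orthogonal complement of its kernel.\<close>

definition inner_multiplier :: "'u::cvector set \<Rightarrow> ('u \<Rightarrow> 'u \<Rightarrow> complex) \<Rightarrow>
    'y::cvector set \<Rightarrow> ('y \<Rightarrow> 'y \<Rightarrow> complex) \<Rightarrow> (complex^'d \<Rightarrow> 'u \<Rightarrow> 'y) \<Rightarrow> bool" where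
  "inner_multiplier U ipU Y ipY S \<longleftrightarrow>
     schur_class U ipU Y ipY S \<and>
     (\<forall>f. in_Hkd U ipU f \<and>
          (\<forall>g. in_Hkd U ipU g \<and> (\<forall>l\<in>ball_d. S l (g l) = 0) \<longrightarrow> Hkd_inner U ipU f g = 0)
        \<longrightarrow> Hkd_norm Y ipY (mult_op S f) = Hkd_norm U ipU f)"

definition hnorm_d :: "('x \<Rightarrow> 'x \<Rightarrow> complex) \<Rightarrow> ('d::finite \<Rightarrow> 'x) \<Rightarrow> real" where
  "hnorm_d ip w = sqrt (\<Sum>j\<in>UNIV. (hnorm ip (w j))\<^sup>2)"

text \<open>The subspace D = closed span { Z(\<zeta>)^* (I - A^* Z(\<zeta>)^* )^{-1} C^* y } of X^d.\<close>

definition D_gen :: "'x::cvector set \<Rightarrow> ('x \<Rightarrow> 'x \<Rightarrow> complex) \<Rightarrow>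
    'y::cvector set \<Rightarrow> ('y \<Rightarrow> 'y \<Rightarrow> complex) \<Rightarrow>
    ('d::finite \<Rightarrow> 'x \<Rightarrow> 'x) \<Rightarrow> ('x \<Rightarrow> 'y) \<Rightarrow> complex^'d \<Rightarrow> 'y \<Rightarrow> ('d \<Rightarrow> 'x)" where
  "D_gen X ipX Y ipY A C z y =
     (let Cs = hadj X ipX Y ipY C;
          AsZs = (\<lambda>x. \<Sum>j\<in>UNIV. cnj (z$j) *\<^sub>C hadj X ipX X ipX (A j) x)
      in (\<lambda>j. cnj (z$j) *\<^sub>C inv_I_minus X AsZs (Cs y)))"

definition D_space :: "'x::cvector set \<Rightarrow> ('x \<Rightarrow> 'x \<Rightarrow> complex) \<Rightarrow>
    'y::cvector set \<Rightarrow> ('y \<Rightarrow> 'y \<Rightarrow> complex) \<Rightarrow>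
    ('d::finite \<Rightarrow> 'x \<Rightarrow> 'x) \<Rightarrow> ('x \<Rightarrow> 'y) \<Rightarrow> ('d \<Rightarrow> 'x) set" where
  "D_space X ipX Y ipY A C =
     {w. (\<forall>j. w j \<in> X) \<and>
         (\<forall>e>0. \<exists>(n::nat) (c::nat \<Rightarrow> complex) (\<zeta>::nat \<Rightarrow> complex^'d) (y::nat \<Rightarrow> 'y).
            (\<forall>i<n. \<zeta> i \<in> ball_d \<and> y i \<in> Y) \<and>
            hnorm_d ipX (w - (\<Sum>i<n. c i *\<^sub>C D_gen X ipX Y ipY A C (\<zeta> i) (y i))) < e)}"

text \<open>The connecting operator U = [A B; C D] : X \<oplus> U \<rightarrow> X^d \<oplus> Y is a contraction, and
  U^* (w, y) = (\<Sum>j A_j^* w_j + C^* y, \<Sum>j B_j^* w_j + D^* y) is isometric on D \<oplus> Y.\<close>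

definition weakly_coisometric :: "'x::cvector set \<Rightarrow> ('x \<Rightarrow> 'x \<Rightarrow> complex) \<Rightarrow>
    'u::cvector set \<Rightarrow> ('u \<Rightarrow> 'u \<Rightarrow> complex) \<Rightarrow>
    'y::cvector set \<Rightarrow> ('y \<Rightarrow> 'y \<Rightarrow> complex) \<Rightarrow>
    ('d::finite \<Rightarrow> 'x \<Rightarrow> 'x) \<Rightarrow> ('d \<Rightarrow> 'u \<Rightarrow> 'x) \<Rightarrow> ('x \<Rightarrow> 'y) \<Rightarrow> ('u \<Rightarrow> 'y) \<Rightarrow> bool" where
  "weakly_coisometric X ipX U ipU Y ipY A B C D \<longleftrightarrow>
     (\<forall>x\<in>X. \<forall>u\<in>U.
        (\<Sum>j\<in>UNIV. (hnorm ipX (A j x + B j u))\<^sup>2) + (hnorm ipY (C x + D u))\<^sup>2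
          \<le> (hnorm ipX x)\<^sup>2 + (hnorm ipU u)\<^sup>2) \<and>
     (\<forall>w\<in>D_space X ipX Y ipY A C. \<forall>y\<in>Y.
        (hnorm ipX ((\<Sum>j\<in>UNIV. hadj X ipX X ipX (A j) (w j)) + hadj X ipX Y ipY C y))\<^sup>2
        + (hnorm ipU ((\<Sum>j\<in>UNIV. hadj U ipU X ipX (B j) (w j)) + hadj U ipU Y ipY D y))\<^sup>2
        = (hnorm_d ipX w)\<^sup>2 + (hnorm ipY y)\<^sup>2)"

definition realizes :: "'x::cvector set \<Rightarrow> 'u set \<Rightarrow>
    ('d::finite \<Rightarrow> 'x \<Rightarrow> 'x) \<Rightarrow> ('d \<Rightarrow> 'u \<Rightarrow> 'x) \<Rightarrow> ('x \<Rightarrow> 'y::cvector) \<Rightarrow> ('u \<Rightarrow> 'y) \<Rightarrow>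
    (complex^'d \<Rightarrow> 'u \<Rightarrow> 'y) \<Rightarrow> bool" where
  "realizes X U A B C D S \<longleftrightarrow>
     (\<forall>l\<in>ball_d. \<forall>u\<in>U.
        S l u = D u + C (inv_I_minus X (\<lambda>x. \<Sum>j\<in>UNIV. (l$j) *\<^sub>C A j x)
                                         (\<Sum>j\<in>UNIV. (l$j) *\<^sub>C B j u)))"

definition mpow :: "('d::{finite,enum} \<Rightarrow> 'x \<Rightarrow> 'x) \<Rightarrow> ('d \<Rightarrow> nat) \<Rightarrow> 'x \<Rightarrow> 'x" where
  "mpow A n = foldr (\<lambda>j acc. (A j ^^ n j) \<circ> acc) enum_class.enum id"

definition commutative_tuple :: "'x set \<Rightarrow> ('d \<Rightarrow> 'x \<Rightarrow> 'x) \<Rightarrow> bool" where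
  "commutative_tuple X A \<longleftrightarrow> (\<forall>i j. \<forall>x\<in>X. A i (A j x) = A j (A i x))"

definition strongly_stable :: "'x set \<Rightarrow> ('x \<Rightarrow> 'x \<Rightarrow> complex) \<Rightarrow>
    ('d::{finite,enum} \<Rightarrow> 'x \<Rightarrow> 'x) \<Rightarrow> bool" where
  "strongly_stable X ipX A \<longleftrightarrow>
     (\<forall>x\<in>X. (\<lambda>N. \<Sum>n\<in>{n::'d \<Rightarrow> nat. (\<Sum>j\<in>UNIV. n j) = N}.
                real (fact N) / real (\<Prod>j\<in>UNIV. fact (n j)) * (hnorm ipX (mpow A n x))\<^sup>2)
             \<longlonglongrightarrow> 0)"

definition isometric_output_pair :: "'x::cvector set \<Rightarrow> ('x \<Rightarrow> 'x \<Rightarrow> complex) \<Rightarrow>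
    'y::cvector set \<Rightarrow> ('y \<Rightarrow> 'y \<Rightarrow> complex) \<Rightarrow> ('d::finite \<Rightarrow> 'x \<Rightarrow> 'x) \<Rightarrow> ('x \<Rightarrow> 'y) \<Rightarrow> bool" where
  "isometric_output_pair X ipX Y ipY A C \<longleftrightarrow>
     (\<forall>x\<in>X. (\<Sum>j\<in>UNIV. hadj X ipX X ipX (A j) (A j x)) + hadj X ipX Y ipY C (C x) = x)"

definition good_realization :: "'x::cvector set \<Rightarrow> ('x \<Rightarrow> 'x \<Rightarrow> complex) \<Rightarrow>
    'u::cvector set \<Rightarrow> ('u \<Rightarrow> 'u \<Rightarrow> complex) \<Rightarrow>
    'y::cvector set \<Rightarrow> ('y \<Rightarrow> 'y \<Rightarrow> complex) \<Rightarrow>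
    ('d::{finite,enum} \<Rightarrow> 'x \<Rightarrow> 'x) \<Rightarrow> ('d \<Rightarrow> 'u \<Rightarrow> 'x) \<Rightarrow> ('x \<Rightarrow> 'y) \<Rightarrow> ('u \<Rightarrow> 'y) \<Rightarrow>
    (complex^'d::_ \<Rightarrow> 'u \<Rightarrow> 'y) \<Rightarrow> bool" where
  "good_realization X ipX U ipU Y ipY A B C D S \<longleftrightarrow>
     hilbert_space X ipX \<and>
     (\<forall>j. bounded_op X ipX X ipX (A j)) \<and> (\<forall>j. bounded_op U ipU X ipX (B j)) \<and>
     bounded_op X ipX Y ipY C \<and> bounded_op U ipU Y ipY D \<and>
     weakly_coisometric X ipX U ipU Y ipY A B C D \<and>
     realizes X U A B C D S \<and>
     commutative_tuple X A \<and> strongly_stable X ipX A \<and>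
     isometric_output_pair X ipX Y ipY A C"

end

theory Submission
  imports Defs "HOL-Combinatorics.Multiset_Permutations"
begin

text \<open>
  \<open>H\<^sub>Y(k\<^sub>d)\<close> is realised as the space of \<open>\<ell>\<^sup>2\<close> families \<open>g\<close> indexed by words over the \<open>d\<close> letters
  that are invariant under permuting letters; the kernel function at \<open>z\<close> is
  \<open>w \<mapsto> cnj (z\<^sup>w) y\<close> and the backward shift \<open>g \<mapsto> g (j # _)\<close> is the adjoint of multiplication by \<open>\<lambda>\<^sub>j\<close>.
  A contractive multiplier with multiplication operator \<open>M\<close> is inner iff \<open>M\<^sup>* M M\<^sup>* = M\<^sup>*\<close>.

  Given a realization, \<open>J x = (C A\<^sup>w x)\<^sub>w\<close> maps into that space because \<open>A\<close> commutes, and it is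
  isometric because \<open>(C, A)\<close> is isometric and \<open>A\<close> is strongly stable. Weak coisometry is the kernel
  identity \<open>M M\<^sup>* + J J\<^sup>* = I\<close>. Since \<open>J J\<^sup>*\<close> is a projection, \<open>M\<^sup>* J = 0\<close>, so \<open>M\<close> is a partial isometry.

  Conversely, if \<open>M\<close> is a partial isometry, take \<open>X = ker M\<^sup>*\<close>, which is invariant under the backward
  shifts \<open>A\<^sub>j\<close>, with \<open>C\<close> evaluation at the origin and \<open>D = S(0)\<close>. With \<open>q\<close> the
  projections of the kernel functions to \<open>X\<close>, the lurking isometry sends
  \<open>((cnj z\<^sub>j q(z, y))\<^sub>j, y)\<close> to \<open>(q(z, y), S(z)\<^sup>* y)\<close>; its first component is
  \<open>A\<^sup>* + C\<^sup>*\<close>, and its second component determines \<open>B\<close>, chosen with range in the space \<open>D\<close> of the definition.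
\<close>

section \<open>Hilbert spaces on carrier sets\<close>

text \<open>Pairing with kernel functions sees a family only through one homogeneous polynomial per
  degree, and such a polynomial determines its word coefficients only among symmetric families.
  Commutativity of the state tuple is what makes the outputs of a realization symmetric. In the
  converse, the lurking isometry fixes the adjoint of the connecting operator only on D + Y, while
  contractivity concerns all of X + U. The range settles this. The columns \<open>(A j x)\<close>
  already lie in D, because a tuple w orthogonal to D satisfies sum_j z_j w_j(z) = 0 on the ball,
  and B takes values in D. So the connecting operator maps into D + Y, where its adjoint is
  isometric, and this makes it a contraction. The lurking isometry also ties the vector y to the
  point z. Entries at the point 0, where Z(z)^* vanishes, untie them.\<close>

lemma scaleC_zero_left [simp]: "0 *\<^sub>C (x::'a::cvector) = 0"
  using scaleC_add_left[of 0 0 x] by simp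

lemma scaleC_zero_right [simp]: "c *\<^sub>C (0::'a::cvector) = 0"
  using scaleC_add_right[of c 0 "0::'a"] by simp

lemma scaleC_minus_left: "(- c) *\<^sub>C (x::'a::cvector) = - (c *\<^sub>C x)"
  using scaleC_add_left[of "-c" c x] by (simp add: eq_neg_iff_add_eq_0)

lemma scaleC_minus_right: "c *\<^sub>C (- (x::'a::cvector)) = - (c *\<^sub>C x)"
  using scaleC_add_right[of c "-x" x] by (simp add: eq_neg_iff_add_eq_0)

lemma scaleC_minus_one: "(- 1) *\<^sub>C (x::'a::cvector) = - x"
  by (simp add: scaleC_minus_left scaleC_one)

lemma scaleC_diff_right: "c *\<^sub>C ((x::'a::cvector) - y) = c *\<^sub>C x - c *\<^sub>C y"
  using scaleC_add_right[of c x "-y"] by (simp add: scaleC_minus_right)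

lemma scaleC_sum_right: "c *\<^sub>C (\<Sum>i\<in>I. f i) = (\<Sum>i\<in>I. c *\<^sub>C (f i :: 'a::cvector))"
  by (induction I rule: infinite_finite_induct) (auto simp: scaleC_add_right)

locale hilb =
  fixes V :: "'a::cvector set" and ip :: "'a \<Rightarrow> 'a \<Rightarrow> complex"
  assumes hilbert: "hilbert_space V ip"
begin

abbreviation nrm :: "'a \<Rightarrow> real" where "nrm \<equiv> hnorm ip"

lemma zero_mem [simp]: "0 \<in> V"
  using hilbert[unfolded hilbert_space_def, THEN conjunct1] .

lemma add_mem [simp]: "x \<in> V \<Longrightarrow> y \<in> V \<Longrightarrow> x + y \<in> V"
  using hilbert[unfolded hilbert_space_def, THEN conjunct2, THEN conjunct1, rule_format] .

lemma scale_mem [simp]: "x \<in> V \<Longrightarrow> c *\<^sub>C x \<in> V"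
  using hilbert[unfolded hilbert_space_def, THEN conjunct2, THEN conjunct2, THEN conjunct1, rule_format] .

lemma ip_add_left: "x \<in> V \<Longrightarrow> y \<in> V \<Longrightarrow> z \<in> V \<Longrightarrow> ip (x + y) z = ip x z + ip y z"
  using hilbert[unfolded hilbert_space_def, THEN conjunct2, THEN conjunct2, THEN conjunct2, THEN conjunct1, rule_format] .

lemma ip_scale_left: "x \<in> V \<Longrightarrow> y \<in> V \<Longrightarrow> ip (c *\<^sub>C x) y = c * ip x y"
  using hilbert[unfolded hilbert_space_def, THEN conjunct2, THEN conjunct2, THEN conjunct2, THEN conjunct2, THEN conjunct1, rule_format] .

lemma ip_sym: "x \<in> V \<Longrightarrow> y \<in> V \<Longrightarrow> ip y x = cnj (ip x y)"
  using hilbert[unfolded hilbert_space_def, THEN conjunct2, THEN conjunct2, THEN conjunct2, THEN conjunct2, THEN conjunct2, THEN conjunct1, rule_format] .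

lemma ip_pos: "x \<in> V \<Longrightarrow> x \<noteq> 0 \<Longrightarrow> 0 < Re (ip x x)"
  using hilbert[unfolded hilbert_space_def, THEN conjunct2, THEN conjunct2, THEN conjunct2, THEN conjunct2, THEN conjunct2, THEN conjunct2, THEN conjunct1, rule_format] .

lemma complete:
  assumes "\<And>n. s n \<in> V"
    and "\<And>e. e > 0 \<Longrightarrow> \<exists>N. \<forall>m\<ge>N. \<forall>n\<ge>N. nrm (s m - s n) < e"
  obtains l where "l \<in> V" "(\<lambda>n. nrm (s n - l)) \<longlonglongrightarrow> 0"
  using hilbert[unfolded hilbert_space_def, THEN conjunct2, THEN conjunct2, THEN conjunct2, THEN conjunct2, THEN conjunct2, THEN conjunct2, THEN conjunct2, rule_format, of s] assms by blast

lemma uminus_mem [simp]: "x \<in> V \<Longrightarrow> - x \<in> V"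
  using scale_mem[of x "-1"] by (simp add: scaleC_minus_one)

lemma diff_mem [simp]: "x \<in> V \<Longrightarrow> y \<in> V \<Longrightarrow> x - y \<in> V"
  using add_mem[of x "-y"] by simp

lemma sum_mem: "(\<And>i. i \<in> I \<Longrightarrow> f i \<in> V) \<Longrightarrow> sum f I \<in> V"
  by (induction I rule: infinite_finite_induct) auto

lemma ip_add_right: "x \<in> V \<Longrightarrow> y \<in> V \<Longrightarrow> z \<in> V \<Longrightarrow> ip x (y + z) = ip x y + ip x z"
  by (subst ip_sym) (auto simp: ip_add_left ip_sym[of _ x])

lemma ip_scale_right: "x \<in> V \<Longrightarrow> y \<in> V \<Longrightarrow> ip x (c *\<^sub>C y) = cnj c * ip x y"
  by (subst ip_sym) (auto simp: ip_scale_left ip_sym[of _ x])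

lemma ip_minus_left: "x \<in> V \<Longrightarrow> y \<in> V \<Longrightarrow> ip (- x) y = - ip x y"
  using ip_scale_left[of x y "-1"] by (simp add: scaleC_minus_one)

lemma ip_minus_right: "x \<in> V \<Longrightarrow> y \<in> V \<Longrightarrow> ip x (- y) = - ip x y"
  using ip_scale_right[of x y "-1"] by (simp add: scaleC_minus_one)

lemma ip_diff_left: "x \<in> V \<Longrightarrow> y \<in> V \<Longrightarrow> z \<in> V \<Longrightarrow> ip (x - y) z = ip x z - ip y z"
  using ip_add_left[of x "-y" z] by (simp add: ip_minus_left)

lemma ip_diff_right: "x \<in> V \<Longrightarrow> y \<in> V \<Longrightarrow> z \<in> V \<Longrightarrow> ip x (y - z) = ip x y - ip x z"
  using ip_add_right[of x y "-z"] by (simp add: ip_minus_right)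

lemma ip_zero_left [simp]: "y \<in> V \<Longrightarrow> ip 0 y = 0"
  using ip_scale_left[of 0 y 0] by simp

lemma ip_zero_right [simp]: "y \<in> V \<Longrightarrow> ip y 0 = 0"
  using ip_scale_right[of y 0 0] by simp

lemma ip_sum_left:
  "(\<And>i. i \<in> I \<Longrightarrow> f i \<in> V) \<Longrightarrow> y \<in> V \<Longrightarrow> ip (\<Sum>i\<in>I. f i) y = (\<Sum>i\<in>I. ip (f i) y)"
  by (induction I rule: infinite_finite_induct) (auto simp: ip_add_left sum_mem)

lemma ip_sum_right:
  "(\<And>i. i \<in> I \<Longrightarrow> f i \<in> V) \<Longrightarrow> y \<in> V \<Longrightarrow> ip y (\<Sum>i\<in>I. f i) = (\<Sum>i\<in>I. ip y (f i))"
  by (induction I rule: infinite_finite_induct) (auto simp: ip_add_right sum_mem)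

lemma ip_self_nonneg: "x \<in> V \<Longrightarrow> 0 \<le> Re (ip x x)"
  using ip_pos[of x] by (cases "x = 0") auto

lemma ip_self: "x \<in> V \<Longrightarrow> ip x x = of_real ((nrm x)\<^sup>2)"
  using ip_sym[of x x] ip_self_nonneg[of x]
  by (auto simp: hnorm_def complex_eq_iff)

lemma nrm_sq: "x \<in> V \<Longrightarrow> (nrm x)\<^sup>2 = Re (ip x x)"
  using ip_self_nonneg[of x] by (simp add: hnorm_def)

lemma nrm_nonneg [simp]: "x \<in> V \<Longrightarrow> 0 \<le> nrm x"
  using ip_self_nonneg[of x] by (simp add: hnorm_def)

lemma nrm_zero [simp]: "nrm 0 = 0"
  by (simp add: hnorm_def)

lemma nrm_eq_0: "x \<in> V \<Longrightarrow> nrm x = 0 \<longleftrightarrow> x = 0"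
  using ip_pos[of x] nrm_sq[of x] by (cases "x = 0") auto

lemma nrm_scale:
  assumes x: "x \<in> V"
  shows "nrm (c *\<^sub>C x) = cmod c * nrm x"
proof (rule power2_eq_imp_eq)
  show "(nrm (c *\<^sub>C x))\<^sup>2 = (cmod c * nrm x)\<^sup>2"
  proof -
    have "(nrm (c *\<^sub>C x))\<^sup>2 = Re (c * cnj c * ip x x)"
      using x by (simp add: nrm_sq ip_scale_left ip_scale_right algebra_simps)
    also have "c * cnj c = of_real ((cmod c)\<^sup>2)"
      by (simp only: complex_norm_square)
    finally show ?thesis using x by (simp add: nrm_sq power_mult_distrib)
  qed
qed (use x in auto)

lemma nrm_minus: "x \<in> V \<Longrightarrow> nrm (- x) = nrm x"
  using nrm_scale[of x "-1"] by (simp add: scaleC_minus_one)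

lemma nrm_minus_commute: "x \<in> V \<Longrightarrow> y \<in> V \<Longrightarrow> nrm (x - y) = nrm (y - x)"
  using nrm_minus[of "x - y"] by simp

lemma nrm_add_sq:
  assumes "x \<in> V" "y \<in> V"
  shows "(nrm (x + y))\<^sup>2 = (nrm x)\<^sup>2 + 2 * Re (ip x y) + (nrm y)\<^sup>2"
  using assms ip_sym[of x y] by (simp add: nrm_sq ip_add_left ip_add_right)

lemma nrm_diff_sq:
  assumes "x \<in> V" "y \<in> V"
  shows "(nrm (x - y))\<^sup>2 = (nrm x)\<^sup>2 - 2 * Re (ip x y) + (nrm y)\<^sup>2"
  using assms ip_sym[of x y] by (simp add: nrm_sq ip_diff_left ip_diff_right)

lemma parallelogram:
  assumes "x \<in> V" "y \<in> V"
  shows "(nrm (x + y))\<^sup>2 + (nrm (x - y))\<^sup>2 = 2 * (nrm x)\<^sup>2 + 2 * (nrm y)\<^sup>2"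
  using assms by (simp add: nrm_add_sq nrm_diff_sq)

lemma cauchy_schwarz:
  assumes x: "x \<in> V" and y: "y \<in> V"
  shows "cmod (ip x y) \<le> nrm x * nrm y"
proof (cases "y = 0")
  case True then show ?thesis using x by simp
next
  case False
  then have ny: "nrm y > 0" using y nrm_eq_0 nrm_nonneg by (metis less_eq_real_def)
  define c where "c = ip x y / of_real ((nrm y)\<^sup>2)"
  have "0 \<le> (nrm (x - c *\<^sub>C y))\<^sup>2" by simp
  also have "\<dots> = (nrm x)\<^sup>2 - 2 * Re (cnj c * ip x y) + (cmod c * nrm y)\<^sup>2"
    using x y by (simp add: nrm_diff_sq ip_scale_right nrm_scale)
  also have "cnj c * ip x y = of_real ((cmod (ip x y))\<^sup>2 / (nrm y)\<^sup>2)"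
    by (simp add: c_def complex_norm_square mult.commute del: of_real_power)
  also have "(cmod c * nrm y)\<^sup>2 = (cmod (ip x y))\<^sup>2 / (nrm y)\<^sup>2"
    using ny by (simp add: c_def norm_divide power_mult_distrib power_divide norm_power
        field_simps flip: power_add)
  finally have "(cmod (ip x y))\<^sup>2 / (nrm y)\<^sup>2 \<le> (nrm x)\<^sup>2" by simp
  then have "(cmod (ip x y))\<^sup>2 \<le> (nrm x * nrm y)\<^sup>2"
    using ny by (simp add: divide_le_eq power_mult_distrib)
  then show ?thesis using x y by (rule_tac power2_le_imp_le) auto
qed

lemma re_cauchy_schwarz: "x \<in> V \<Longrightarrow> y \<in> V \<Longrightarrow> Re (ip x y) \<le> nrm x * nrm y"
  using cauchy_schwarz[of x y] complex_Re_le_cmod[of "ip x y"] by linarith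

lemma nrm_triangle:
  assumes "x \<in> V" "y \<in> V"
  shows "nrm (x + y) \<le> nrm x + nrm y"
proof (rule power2_le_imp_le)
  show "(nrm (x + y))\<^sup>2 \<le> (nrm x + nrm y)\<^sup>2"
    using assms re_cauchy_schwarz[of x y] by (simp add: nrm_add_sq power2_sum)
qed (use assms in auto)

lemma nrm_diff_triangle:
  assumes "x \<in> V" "y \<in> V" "z \<in> V"
  shows "nrm (x - z) \<le> nrm (x - y) + nrm (y - z)"
  using nrm_triangle[of "x - y" "y - z"] assms by simp

lemma nrm_diff_le: "x \<in> V \<Longrightarrow> y \<in> V \<Longrightarrow> \<bar>nrm x - nrm y\<bar> \<le> nrm (x - y)"
  using nrm_triangle[of "x - y" y] nrm_triangle[of "y - x" x] nrm_minus_commute[of x y] by auto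

lemma nrm_sum_le:
  "(\<And>i. i \<in> I \<Longrightarrow> f i \<in> V) \<Longrightarrow> nrm (\<Sum>i\<in>I. f i) \<le> (\<Sum>i\<in>I. nrm (f i))"
proof (induction I rule: infinite_finite_induct)
  case (insert a I)
  then have "nrm (f a + sum f I) \<le> nrm (f a) + nrm (sum f I)"
    by (intro nrm_triangle sum_mem) auto
  also have "\<dots> \<le> nrm (f a) + (\<Sum>i\<in>I. nrm (f i))" using insert by simp
  finally show ?case using insert by simp
qed auto

lemma eq_if_ip_eq:
  assumes "x \<in> V" "y \<in> V" "\<And>z. z \<in> V \<Longrightarrow> ip x z = ip y z"
  shows "x = y"
proof -
  have "ip (x - y) (x - y) = 0"
    using assms by (simp add: ip_diff_left)
  then show ?thesis using assms ip_pos[of "x - y"] by fastforce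
qed

lemma eq_if_ip_eq_left:
  assumes "x \<in> V" "y \<in> V" "\<And>z. z \<in> V \<Longrightarrow> ip z x = ip z y"
  shows "x = y"
  using eq_if_ip_eq[OF assms(1,2)] assms by (metis ip_sym)

lemma tendsto_ip_left:
  assumes "\<And>n. s n \<in> V" "l \<in> V" "(\<lambda>n. nrm (s n - l)) \<longlonglongrightarrow> 0" "y \<in> V"
  shows "(\<lambda>n. ip (s n) y) \<longlonglongrightarrow> ip l y"
proof -
  have "(\<lambda>n. ip (s n) y - ip l y) \<longlonglongrightarrow> 0"
  proof (rule Lim_null_comparison)
    show "\<forall>\<^sub>F n in sequentially. norm (ip (s n) y - ip l y) \<le> nrm (s n - l) * nrm y"
      using assms cauchy_schwarz by (auto simp: ip_diff_left[symmetric])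
    show "(\<lambda>n. nrm (s n - l) * nrm y) \<longlonglongrightarrow> 0"
      using tendsto_mult_left_zero[OF assms(3)] by simp
  qed
  then show ?thesis by (simp add: LIM_zero_iff)
qed

lemma tendsto_nrm:
  assumes "\<And>n. s n \<in> V" "l \<in> V" "(\<lambda>n. nrm (s n - l)) \<longlonglongrightarrow> 0"
  shows "(\<lambda>n. nrm (s n)) \<longlonglongrightarrow> nrm l"
proof -
  have "(\<lambda>n. nrm (s n) - nrm l) \<longlonglongrightarrow> 0"
  proof (rule Lim_null_comparison)
    show "\<forall>\<^sub>F n in sequentially. norm (nrm (s n) - nrm l) \<le> nrm (s n - l)"
      using assms nrm_diff_le by auto
  qed (use assms in auto)
  then show ?thesis by (simp add: LIM_zero_iff)
qed

lemma limit_unique: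
  assumes "\<And>n. s n \<in> V" "l \<in> V" "l' \<in> V"
    "(\<lambda>n. nrm (s n - l)) \<longlonglongrightarrow> 0" "(\<lambda>n. nrm (s n - l')) \<longlonglongrightarrow> 0"
  shows "l = l'"
proof (rule eq_if_ip_eq)
  show "ip l z = ip l' z" if "z \<in> V" for z
    using tendsto_ip_left[of s l z] tendsto_ip_left[of s l' z] assms that LIMSEQ_unique by blast
qed (use assms in auto)

lemma closed_subspace_hilbert:
  assumes "W \<subseteq> V" "0 \<in> W" "\<And>x y. x \<in> W \<Longrightarrow> y \<in> W \<Longrightarrow> x + y \<in> W"
    and "\<And>c x. x \<in> W \<Longrightarrow> c *\<^sub>C x \<in> W"
    and closed: "\<And>s l. (\<And>n. s n \<in> W) \<Longrightarrow> l \<in> V \<Longrightarrow> (\<lambda>n. nrm (s n - l)) \<longlonglongrightarrow> 0 \<Longrightarrow> l \<in> W"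
  shows "hilbert_space W ip"
proof -
  have "\<exists>l\<in>W. (\<lambda>n. nrm (s n - l)) \<longlonglongrightarrow> 0"
    if s: "\<forall>n. s n \<in> W" "\<forall>e>0. \<exists>N. \<forall>m\<ge>N. \<forall>n\<ge>N. nrm (s m - s n) < e" for s
  proof -
    obtain l where "l \<in> V" "(\<lambda>n. nrm (s n - l)) \<longlonglongrightarrow> 0"
      using complete[of s] s assms(1) by blast
    then show ?thesis using closed[of s l] s by blast
  qed
  moreover have "x \<in> V" if "x \<in> W" for x using assms(1) that by blast
  ultimately show ?thesis
    unfolding hilbert_space_def using assms(2-4)
    by (intro conjI ballI allI impI) (auto intro: ip_add_left ip_scale_left ip_pos ip_sym)
qed

lemma polarization:
  assumes "x \<in> V" "y \<in> V"
  shows "ip x y = (1/4) * (\<Sum>k<(4::nat). \<i>^k * complex_of_real ((nrm (x + (\<i>^k) *\<^sub>C y))\<^sup>2))"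
proof -
  have *: "complex_of_real ((nrm (x + c *\<^sub>C y))\<^sup>2) =
     ip x x + cnj c * ip x y + c * ip y x + c * cnj c * ip y y" for c
    using assms by (subst ip_self[symmetric])
      (simp_all add: ip_add_left ip_add_right ip_scale_left ip_scale_right algebra_simps)
  have i3: "\<i> ^ 3 = - \<i>" by (simp add: power3_eq_cube)
  have "{..<4::nat} = {0, 1, 2, 3}" by auto
  then show ?thesis
    unfolding * using i3 by (simp add: algebra_simps)
qed

end

section \<open>Riesz representation and moment problems\<close>

lemma quadratic_nonneg_imp_linear_zero:
  fixes b c :: real
  assumes "\<And>t. 0 \<le> 2 * t * b + t\<^sup>2 * c" "0 \<le> c"
  shows "b = 0"
proof (rule ccontr)
  assume "b \<noteq> 0"
  \<comment> \<open>The vertex of the parabola is at -b/c; the added 1 keeps the denominator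
    positive when c = 0 and still gives a negative value.\<close>
  define t where "t = - b / (c + 1)"
  have t: "t * (c + 1) = - b" using assms(2) by (simp add: t_def)
  have "(2 * t * b + t\<^sup>2 * c) * (c + 1)\<^sup>2 = 2 * (t * (c + 1)) * b * (c + 1) + (t * (c + 1))\<^sup>2 * c"
    by (simp add: power2_eq_square algebra_simps)
  also have "\<dots> = - (b\<^sup>2 * (c + 2))"
    unfolding t by (simp add: power2_eq_square algebra_simps)
  finally have "(2 * t * b + t\<^sup>2 * c) * (c + 1)\<^sup>2 < 0"
    using assms(2) \<open>b \<noteq> 0\<close> by (simp add: mult_pos_pos)
  then show False
    using assms(1)[of t] by (metis linorder_not_less mult_nonneg_nonneg zero_le_power2)
qed

text \<open>A formal combination is a list, so repetitions are allowed and concatenation is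
  addition. The same list can be evaluated at several families, which is how a linear map is
  prescribed on generators that may be linearly dependent.\<close>

definition lcomb :: "('i \<Rightarrow> 'a::cvector) \<Rightarrow> (complex \<times> 'i) list \<Rightarrow> 'a" where
  "lcomb a xs = (\<Sum>(c, i)\<leftarrow>xs. c *\<^sub>C a i)"

text \<open>Approximation within every \<open>e\<close>, as in \<open>D_space\<close>, so that the
  two can be matched directly in \<open>D_space_eq\<close>.\<close>

definition clspan :: "'a::cvector set \<Rightarrow> ('a \<Rightarrow> 'a \<Rightarrow> complex) \<Rightarrow> ('i \<Rightarrow> 'a) \<Rightarrow> 'i set \<Rightarrow> 'a set" where
  "clspan V ip a I =
     {z \<in> V. \<forall>e>0. \<exists>xs. set xs \<subseteq> UNIV \<times> I \<and> hnorm ip (z - lcomb a xs) < e}"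

lemma lcomb_Nil [simp]: "lcomb a [] = 0"
  by (simp add: lcomb_def)

lemma lcomb_Cons [simp]: "lcomb a ((c, i) # xs) = c *\<^sub>C a i + lcomb a xs"
  by (simp add: lcomb_def)

lemma lcomb_append: "lcomb a (xs @ ys) = lcomb a xs + lcomb a ys"
  by (simp add: lcomb_def)

lemma lcomb_scale: "lcomb a (map (\<lambda>(b, i). (c * b, i)) xs) = c *\<^sub>C lcomb a xs"
  by (induction xs) (auto simp: scaleC_add_right scaleC_scaleC)

lemma lcomb_diff: "lcomb a (xs @ map (\<lambda>(b, i). ((-1) * b, i)) ys) = lcomb a xs - lcomb a ys"
  unfolding lcomb_append lcomb_scale by (simp add: scaleC_minus_one)

lemma set_scaled_pairs:
  "set xs \<subseteq> UNIV \<times> I \<Longrightarrow> set (map (\<lambda>(b, i). (c * b, i)) xs) \<subseteq> UNIV \<times> I"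
  by auto

text \<open>Lets \<open>lcomb\<close> be applied to scalar families, so that a functional on a span
  can be given by its values on the generators.\<close>

instantiation complex :: cvector
begin
definition scaleC_complex :: "complex \<Rightarrow> complex \<Rightarrow> complex" where "scaleC_complex = (*)"
instance by standard (auto simp: scaleC_complex_def algebra_simps)
end

context hilb
begin

text \<open>\<open>P\<close> is not assumed closed, so it may be a bare span. The sequence
  \<open>s\<close> in the conclusion records that the representing vector lies in the closure of
  \<open>P\<close>.\<close>

lemma riesz_subspace:
  assumes P: "P \<subseteq> V" "0 \<in> P" "\<And>x y. x \<in> P \<Longrightarrow> y \<in> P \<Longrightarrow> x + y \<in> P"
      "\<And>c x. x \<in> P \<Longrightarrow> c *\<^sub>C x \<in> P"
    and \<phi>: "\<And>x y. x \<in> P \<Longrightarrow> y \<in> P \<Longrightarrow> \<phi> (x + y) = \<phi> x + \<phi> y"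
      "\<And>c x. x \<in> P \<Longrightarrow> \<phi> (c *\<^sub>C x) = c * \<phi> x"
    and K: "0 \<le> K" "\<And>x. x \<in> P \<Longrightarrow> cmod (\<phi> x) \<le> K * nrm x"
  obtains z s where "z \<in> V" "\<And>x. x \<in> P \<Longrightarrow> ip x z = \<phi> x" "nrm z \<le> K"
    "\<And>n::nat. s n \<in> P" "(\<lambda>n. nrm (s n - z)) \<longlonglongrightarrow> 0"
proof -
  \<comment> \<open>The representing vector minimises \<open>q\<close>; the parallelogram law makes every minimising
    sequence in \<open>P\<close> Cauchy in \<open>V\<close>.\<close>
  define q where "q x = (nrm x)\<^sup>2 - 2 * Re (\<phi> x)" for x
  have PV: "x \<in> V" if "x \<in> P" for x using P(1) that by blast
  have q_lb: "- K\<^sup>2 \<le> q x" if "x \<in> P" for x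
  proof -
    have "Re (\<phi> x) \<le> K * nrm x"
      using K(2)[OF that] complex_Re_le_cmod[of "\<phi> x"] by linarith
    moreover have "0 \<le> (nrm x - K)\<^sup>2" by simp
    ultimately show ?thesis by (simp add: q_def power2_diff algebra_simps)
  qed
  define m where "m = Inf (q ` P)"
  have bdd: "bdd_below (q ` P)" using q_lb by (auto intro!: bdd_belowI2)
  have m_le: "m \<le> q x" if "x \<in> P" for x
    unfolding m_def using bdd that by (intro cInf_lower) auto
  have "\<exists>x\<in>P. q x < m + 1 / Suc n" for n
  proof -
    have "Inf (q ` P) < m + 1 / Suc n" by (simp add: m_def)
    then show ?thesis using P(2) by (subst (asm) cInf_less_iff) (auto intro: bdd)
  qed
  then obtain s where s: "\<And>n. s n \<in> P" "\<And>n. q (s n) < m + 1 / Suc n" by metis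
  have half: "(nrm (x - y))\<^sup>2 \<le> 2 * (q x + q y - 2 * m)" if "x \<in> P" "y \<in> P" for x y
  proof -
    define h where "h = (1/2) *\<^sub>C (x + y)"
    have h: "h \<in> P" using P that by (simp add: h_def)
    have "q h = (nrm (x + y))\<^sup>2 / 4 - Re (\<phi> (x + y))"
      using that P PV by (simp add: q_def h_def nrm_scale \<phi> power_mult_distrib power_divide
          field_simps)
    then show ?thesis
      using parallelogram[of x y] m_le[OF h] that PV by (simp add: q_def \<phi>)
  qed
  have cauchy: "\<exists>N. \<forall>m\<ge>N. \<forall>n\<ge>N. nrm (s m - s n) < e" if e: "e > 0" for e
  proof -
    obtain N where N: "4 / e\<^sup>2 < real (Suc N)"
      using reals_Archimedean2 by (metis less_Suc_eq of_nat_less_iff order_less_trans)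
    have "nrm (s i - s j) < e" if "i \<ge> N" "j \<ge> N" for i j
    proof (rule power2_less_imp_less)
      have "(nrm (s i - s j))\<^sup>2 \<le> 2 * (q (s i) + q (s j) - 2 * m)" using half s by blast
      also have "\<dots> < 2 * (1 / Suc i + 1 / Suc j)" using s(2)[of i] s(2)[of j] by simp
      also have "\<dots> \<le> 2 * (1 / Suc N + 1 / Suc N)"
        using that by (intro mult_left_mono add_mono divide_left_mono) auto
      also have "\<dots> = 4 / Suc N" by simp
      also have "\<dots> < e\<^sup>2" using N e by (simp add: field_simps)
      finally show "(nrm (s i - s j))\<^sup>2 < e\<^sup>2" .
    qed (use e in simp)
    then show ?thesis by blast
  qed
  obtain z where z: "z \<in> V" and lim: "(\<lambda>n. nrm (s n - z)) \<longlonglongrightarrow> 0"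
    using complete[of s] s(1) PV cauchy by metis
  have qlim: "(\<lambda>n. q (s n)) \<longlonglongrightarrow> m"
  proof (rule real_tendsto_sandwich)
    show "\<forall>\<^sub>F n in sequentially. m \<le> q (s n)" using m_le s by auto
    show "\<forall>\<^sub>F n in sequentially. q (s n) \<le> m + 1 / Suc n" 
      using s(2) by (intro always_eventually allI less_imp_le)
    show "(\<lambda>n. m + 1 / Suc n) \<longlonglongrightarrow> m"
      using tendsto_add[OF tendsto_const[of m] LIMSEQ_inverse_real_of_nat]
      by (simp add: inverse_eq_divide)
  qed auto
  \<comment> \<open>In the limit \<open>z\<close> minimises \<open>q\<close>, so the first variation
    in each direction \<open>a\<close> of \<open>P\<close> vanishes.\<close>
  have re: "Re (ip z a) = Re (\<phi> a)" if a: "a \<in> P" for a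
  proof -
    have "0 \<le> 2 * t * (Re (ip z a) - Re (\<phi> a)) + t\<^sup>2 * (nrm a)\<^sup>2" for t
    proof -
      have "m \<le> q (s n) + (2 * t * (Re (ip (s n) a) - Re (\<phi> a)) + t\<^sup>2 * (nrm a)\<^sup>2)" for n
      proof -
        have ta: "of_real t *\<^sub>C a \<in> P" using a P by simp
        have "m \<le> q (s n + of_real t *\<^sub>C a)" using m_le s P ta by simp
        also have "\<dots> = q (s n) + (2 * t * (Re (ip (s n) a) - Re (\<phi> a)) + t\<^sup>2 * (nrm a)\<^sup>2)"
          using s(1) a PV ta by (simp add: q_def nrm_add_sq \<phi> ip_scale_right nrm_scale
              power_mult_distrib algebra_simps)
        finally show ?thesis .
      qed
      moreover have "(\<lambda>n. q (s n) + (2 * t * (Re (ip (s n) a) - Re (\<phi> a)) + t\<^sup>2 * (nrm a)\<^sup>2))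
          \<longlonglongrightarrow> m + (2 * t * (Re (ip z a) - Re (\<phi> a)) + t\<^sup>2 * (nrm a)\<^sup>2)"
        using s(1) a PV z lim by (intro tendsto_intros qlim tendsto_ip_left) auto
      ultimately have "m \<le> m + (2 * t * (Re (ip z a) - Re (\<phi> a)) + t\<^sup>2 * (nrm a)\<^sup>2)"
        by (intro LIMSEQ_le_const) auto
      then show ?thesis by simp
    qed
    then have "Re (ip z a) - Re (\<phi> a) = 0"
      by (rule quadratic_nonneg_imp_linear_zero) simp
    then show ?thesis by simp
  qed
  have rep: "ip a z = \<phi> a" if a: "a \<in> P" for a
  proof (rule complex_eqI)
    have "ip a z = cnj (ip z a)" by (rule ip_sym[OF z PV[OF a]])
    then show "Re (ip a z) = Re (\<phi> a)" using re[OF a] by simp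
    \<comment> \<open>The imaginary part is the real part tested on
      \<open>\<i> *\<^sub>C a\<close>.\<close>
    have "Re (ip z (\<i> *\<^sub>C a)) = Re (\<phi> (\<i> *\<^sub>C a))" using re a P by simp
    then show "Im (ip a z) = Im (\<phi> a)"
      unfolding \<open>ip a z = cnj (ip z a)\<close> ip_scale_right[OF z PV[OF a]] \<phi>(2)[OF a] by simp
  qed
  have "(nrm z)\<^sup>2 \<le> K * nrm z"
  proof (rule LIMSEQ_le)
    show "(\<lambda>n. Re (ip (s n) z)) \<longlonglongrightarrow> (nrm z)\<^sup>2"
      unfolding nrm_sq[OF z] using s(1) PV z lim by (intro tendsto_intros tendsto_ip_left) auto
    show "(\<lambda>n. K * nrm (s n)) \<longlonglongrightarrow> K * nrm z"
      using s(1) PV z lim by (intro tendsto_intros tendsto_nrm) auto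
    have "Re (ip (s n) z) \<le> K * nrm (s n)" for n
      using rep[OF s(1)] K(2)[OF s(1)] complex_Re_le_cmod order_trans by metis
    then show "\<exists>N. \<forall>n\<ge>N. Re (ip (s n) z) \<le> K * nrm (s n)" by blast
  qed
  then have "nrm z \<le> K"
    using z K(1) nrm_nonneg[OF z] by (cases "nrm z = 0") (auto simp: power2_eq_square)
  then show thesis using that z rep s(1) lim by blast
qed

lemma lcomb_mem:
  "\<forall>i\<in>I. a i \<in> V \<Longrightarrow> set xs \<subseteq> UNIV \<times> I \<Longrightarrow> lcomb a xs \<in> V"
  by (induction xs) auto

lemma clspanI_seq:
  assumes a: "\<forall>i\<in>I. a i \<in> V" and "z \<in> V" "\<And>n::nat. set (xs n) \<subseteq> UNIV \<times> I"
    "(\<lambda>n. nrm (lcomb a (xs n) - z)) \<longlonglongrightarrow> 0"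
  shows "z \<in> clspan V ip a I"
  unfolding clspan_def
proof (intro CollectI conjI allI impI)
  fix e :: real assume "e > 0"
  then obtain n where "nrm (lcomb a (xs n) - z) < e"
    using order_tendstoD(2)[OF assms(4), of e] by (auto simp: eventually_sequentially)
  moreover have "lcomb a (xs n) \<in> V" using lcomb_mem[OF a assms(3)] .
  ultimately show "\<exists>xs. set xs \<subseteq> UNIV \<times> I \<and> nrm (z - lcomb a xs) < e"
    using nrm_minus_commute assms by metis
qed fact

text \<open>The bound makes the prescribed values a well-defined bounded functional on the span of
  the \<open>a i\<close>, and Riesz represents it by a vector of the closed span. Used three times:
  to attach a family to a function, to construct B, and to project the columns of A onto D.\<close>

lemma moment_problem:
  fixes \<phi> :: "'i \<Rightarrow> complex"
  assumes a: "\<forall>i\<in>I. a i \<in> V" and K: "0 \<le> K"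
    and bound: "\<And>xs. set xs \<subseteq> UNIV \<times> I \<Longrightarrow> cmod (lcomb \<phi> xs) \<le> K * nrm (lcomb a xs)"
  obtains z where "z \<in> clspan V ip a I" "\<And>i. i \<in> I \<Longrightarrow> ip (a i) z = \<phi> i" "nrm z \<le> K"
proof -
  define P where "P = {lcomb a xs | xs. set xs \<subseteq> UNIV \<times> I}"
  define r where "r p = (SOME xs. set xs \<subseteq> UNIV \<times> I \<and> lcomb a xs = p)" for p
  have r: "set (r p) \<subseteq> UNIV \<times> I" "lcomb a (r p) = p" if "p \<in> P" for p
    using that someI_ex[of "\<lambda>xs. set xs \<subseteq> UNIV \<times> I \<and> lcomb a xs = p"]
    unfolding P_def r_def by auto
  \<comment> \<open>Two lists with the same value differ by a list of value 0, on which the bound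
    forces the functional to vanish.\<close>
  have wd: "lcomb \<phi> xs = lcomb \<phi> ys"
    if "lcomb a xs = lcomb a ys" "set xs \<subseteq> UNIV \<times> I" "set ys \<subseteq> UNIV \<times> I" for xs ys
    using bound[of "xs @ map (\<lambda>(b, i). ((-1) * b, i)) ys"] that set_scaled_pairs[of ys I "-1"]
    unfolding lcomb_diff by simp
  define f where "f p = lcomb \<phi> (r p)" for p
  have f: "f (lcomb a xs) = lcomb \<phi> xs" if "set xs \<subseteq> UNIV \<times> I" for xs
  proof -
    have "lcomb a xs \<in> P" using that by (auto simp: P_def)
    then show ?thesis unfolding f_def using wd[OF r(2) r(1) that] by blast
  qed
  obtain z s where z: "z \<in> V" "\<And>x. x \<in> P \<Longrightarrow> ip x z = f x" "nrm z \<le> K"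
    "\<And>n::nat. s n \<in> P" "(\<lambda>n. nrm (s n - z)) \<longlonglongrightarrow> 0"
  proof (rule riesz_subspace[of P f K])
    show "P \<subseteq> V" using lcomb_mem[OF a] by (auto simp: P_def)
    show "0 \<in> P" by (auto simp: P_def intro!: exI[of _ "[]"])
    fix x assume "x \<in> P"
    then obtain xs where xs: "x = lcomb a xs" "set xs \<subseteq> UNIV \<times> I" by (auto simp: P_def)
    show "c *\<^sub>C x \<in> P" for c
      using xs set_scaled_pairs[of xs I c] lcomb_scale[of a c xs, symmetric] unfolding P_def by blast
    show "f (c *\<^sub>C x) = c * f x" for c
      using f[OF set_scaled_pairs[of xs I c]] xs f[of xs]
      unfolding lcomb_scale by (simp add: scaleC_complex_def)
    show "cmod (f x) \<le> K * nrm x" using xs by (simp add: f bound)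
    fix y assume "y \<in> P"
    then obtain ys where ys: "y = lcomb a ys" "set ys \<subseteq> UNIV \<times> I" by (auto simp: P_def)
    have sy: "set (xs @ ys) \<subseteq> UNIV \<times> I" using xs ys by simp
    have xy: "x + y = lcomb a (xs @ ys)" using xs ys by (simp add: lcomb_append)
    show "x + y \<in> P" unfolding P_def xy using sy by blast
    show "f (x + y) = f x + f y" unfolding xy f[OF sy] using xs ys by (simp add: lcomb_append f)
  qed (use K in auto)
  from z(4) obtain xs where xs: "\<And>n. set (xs n) \<subseteq> UNIV \<times> I" "\<And>n. s n = lcomb a (xs n)"
    unfolding P_def mem_Collect_eq by metis
  then have "z \<in> clspan V ip a I"
    using clspanI_seq[OF a z(1) xs(1)] z(5) by simp
  moreover have "ip (a i) z = \<phi> i" if "i \<in> I" for i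
  proof -
    have "lcomb a [(1, i)] \<in> P" using that unfolding P_def by fastforce
    then show ?thesis
      using z(2)[of "lcomb a [(1, i)]"] f[of "[(1, i)]"] that
      by (simp add: scaleC_one)
  qed
  ultimately show thesis using that z(3) by blast
qed

lemma clspanE:
  assumes "z \<in> clspan V ip a I" "e > 0"
  obtains xs where "set xs \<subseteq> UNIV \<times> I" "nrm (z - lcomb a xs) < e"
  using assms unfolding clspan_def mem_Collect_eq by metis

lemma clspan_subset: "clspan V ip a I \<subseteq> V"
  by (auto simp: clspan_def)

lemma clspan_approx:
  assumes a: "\<forall>i\<in>I. a i \<in> V" and z: "z \<in> clspan V ip a I"
  obtains xs where "\<And>n::nat. set (xs n) \<subseteq> UNIV \<times> I" "(\<lambda>n. nrm (lcomb a (xs n) - z)) \<longlonglongrightarrow> 0"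
proof -
  have zV: "z \<in> V" using z clspan_subset by blast
  have "\<exists>xs. set xs \<subseteq> UNIV \<times> I \<and> nrm (z - lcomb a xs) < 1 / Suc n" for n
    using z by (auto simp: clspan_def)
  then obtain xs where xs: "\<And>n. set (xs n) \<subseteq> UNIV \<times> I" "\<And>n. nrm (z - lcomb a (xs n)) < 1 / Suc n"
    by metis
  have mem: "lcomb a (xs n) \<in> V" for n using xs(1) a lcomb_mem by blast
  have "(\<lambda>n. nrm (lcomb a (xs n) - z)) \<longlonglongrightarrow> 0"
  proof (rule real_tendsto_sandwich)
    show "\<forall>\<^sub>F n in sequentially. 0 \<le> nrm (lcomb a (xs n) - z)" using mem zV by auto
    show "\<forall>\<^sub>F n in sequentially. nrm (lcomb a (xs n) - z) \<le> 1 / Suc n"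
      using xs(2) nrm_minus_commute[OF mem zV] by (intro always_eventually) (metis less_imp_le)
    show "(\<lambda>n. 1 / real (Suc n)) \<longlonglongrightarrow> 0"
      using LIMSEQ_inverse_real_of_nat by (simp add: inverse_eq_divide)
  qed simp
  then show thesis using that xs(1) by blast
qed

lemma clspan_add:
  assumes a: "\<forall>i\<in>I. a i \<in> V" and x: "x \<in> clspan V ip a I" and y: "y \<in> clspan V ip a I"
  shows "x + y \<in> clspan V ip a I"
proof -
  have xV: "x \<in> V" and yV: "y \<in> V" using x y clspan_subset by auto
  show "x + y \<in> clspan V ip a I"
    unfolding clspan_def
  proof (intro CollectI conjI allI impI)
    fix e :: real assume e: "e > 0"
    obtain xs where xs: "set xs \<subseteq> UNIV \<times> I" "nrm (x - lcomb a xs) < e / 2"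
      using clspanE[OF x, of "e / 2"] e by auto
    obtain ys where ys: "set ys \<subseteq> UNIV \<times> I" "nrm (y - lcomb a ys) < e / 2"
      using clspanE[OF y, of "e / 2"] e by auto
    have eq: "x + y - lcomb a (xs @ ys) = (x - lcomb a xs) + (y - lcomb a ys)"
      by (simp add: lcomb_append)
    have "nrm ((x - lcomb a xs) + (y - lcomb a ys)) \<le> nrm (x - lcomb a xs) + nrm (y - lcomb a ys)"
      using xV yV lcomb_mem[OF a xs(1)] lcomb_mem[OF a ys(1)] by (intro nrm_triangle diff_mem)
    then have "nrm (x + y - lcomb a (xs @ ys)) < e"
      unfolding eq using xs(2) ys(2) by linarith
    then show "\<exists>xs. set xs \<subseteq> UNIV \<times> I \<and> nrm (x + y - lcomb a xs) < e"
      using xs ys by (intro exI[of _ "xs @ ys"]) auto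
  qed (use xV yV in simp)
qed

lemma clspan_scale:
  assumes a: "\<forall>i\<in>I. a i \<in> V" and x: "x \<in> clspan V ip a I"
  shows "c *\<^sub>C x \<in> clspan V ip a I"
proof -
  have xV: "x \<in> V" using x clspan_subset by auto
  show "c *\<^sub>C x \<in> clspan V ip a I"
    unfolding clspan_def
  proof (intro CollectI conjI allI impI)
    fix e :: real assume e: "e > 0"
    have "e / (cmod c + 1) > 0" using e by (simp add: add_nonneg_pos)
    then obtain xs where xs: "set xs \<subseteq> UNIV \<times> I" "nrm (x - lcomb a xs) < e / (cmod c + 1)"
      using clspanE[OF x] by metis
    have "nrm (c *\<^sub>C x - lcomb a (map (\<lambda>(b, i). (c * b, i)) xs)) = cmod c * nrm (x - lcomb a xs)"
      unfolding lcomb_scale scaleC_diff_right[symmetric]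
      using nrm_scale[of "x - lcomb a xs" c] xV lcomb_mem[OF a xs(1)] by simp
    also have "\<dots> \<le> (cmod c + 1) * nrm (x - lcomb a xs)"
      using xV lcomb_mem[OF a xs(1)] by (intro mult_right_mono) auto
    also have "\<dots> < e"
      using xs(2) by (subst (asm) pos_less_divide_eq) (auto simp: mult.commute add_nonneg_pos)
    finally show "\<exists>xs. set xs \<subseteq> UNIV \<times> I \<and> nrm (c *\<^sub>C x - lcomb a xs) < e"
      using set_scaled_pairs[OF xs(1)] by blast
  qed (use xV in simp)
qed

lemma ip_lcomb_left:
  assumes a: "\<forall>i\<in>I. a i \<in> V" and "set xs \<subseteq> UNIV \<times> I" "z \<in> V"
  shows "ip (lcomb a xs) z = lcomb (\<lambda>i. ip (a i) z) xs"
  using assms(2)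
proof (induction xs)
  case (Cons x xs)
  then show ?case
    using a lcomb_mem[OF a] assms(3)
    by (cases x) (auto simp: ip_add_left ip_scale_left scaleC_complex_def)
qed (use assms in simp)

lemma ip_clspan_eq_0:
  assumes a: "\<forall>i\<in>I. a i \<in> V" and x: "x \<in> clspan V ip a I" and z: "z \<in> V"
    and "\<And>i. i \<in> I \<Longrightarrow> ip (a i) z = 0"
  shows "ip x z = 0"
proof -
  obtain xs where xs: "\<And>n::nat. set (xs n) \<subseteq> UNIV \<times> I" "(\<lambda>n. nrm (lcomb a (xs n) - x)) \<longlonglongrightarrow> 0"
    using clspan_approx[OF a x] by blast
  have "lcomb (\<lambda>i. ip (a i) z) ys = 0" if "set ys \<subseteq> UNIV \<times> I" for ys
    using that assms(4) by (induction ys) auto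
  then have "ip (lcomb a (xs n)) z = 0" for n
    unfolding ip_lcomb_left[OF a xs(1) z] using xs(1) by blast
  moreover have "(\<lambda>n. ip (lcomb a (xs n)) z) \<longlonglongrightarrow> ip x z"
    using xs lcomb_mem[OF a xs(1)] x z clspan_subset[of a I] by (intro tendsto_ip_left) auto
  ultimately show ?thesis by (simp add: LIMSEQ_const_iff)
qed

text \<open>The uniqueness half of \<open>moment_problem\<close>: such a \<open>z\<close> is
  orthogonal to the closed span, hence to itself.\<close>

lemma clspan_eq_0:
  assumes "\<forall>i\<in>I. a i \<in> V" "z \<in> clspan V ip a I" "\<And>i. i \<in> I \<Longrightarrow> ip (a i) z = 0"
  shows "z = 0"
  using ip_clspan_eq_0[OF assms(1,2) _ assms(3)] assms(2) clspan_subset nrm_eq_0 ip_self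
  by (metis (no_types, opaque_lifting) ip_pos less_irrefl subsetD zero_complex.sel(1))

end

section \<open>Bounded operators and adjoints\<close>

locale hop = V: hilb V ipV + W: hilb W ipW
  for V :: "'a::cvector set" and ipV and W :: "'b::cvector set" and ipW +
  fixes T :: "'a \<Rightarrow> 'b"
  assumes bounded: "bounded_op V ipV W ipW T"
begin

lemma mem [simp]: "x \<in> V \<Longrightarrow> T x \<in> W"
  and add: "x \<in> V \<Longrightarrow> y \<in> V \<Longrightarrow> T (x + y) = T x + T y"
  and scale: "x \<in> V \<Longrightarrow> T (c *\<^sub>C x) = c *\<^sub>C T x"
  using bounded by (simp_all add: bounded_op_def)

lemma bound:
  obtains K where "0 \<le> K" "\<And>x. x \<in> V \<Longrightarrow> hnorm ipW (T x) \<le> K * hnorm ipV x"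
proof -
  obtain K where K: "\<And>x. x \<in> V \<Longrightarrow> hnorm ipW (T x) \<le> K * hnorm ipV x"
    using bounded unfolding bounded_op_def by metis
  have "hnorm ipW (T x) \<le> max K 0 * hnorm ipV x" if "x \<in> V" for x
    using K[OF that] mult_right_mono[of K "max K 0" "hnorm ipV x"] that by simp
  then show thesis using that[of "max K 0"] by simp
qed

lemma zero [simp]: "T 0 = 0"
  using scale[of 0 0] by simp

lemma uminus: "x \<in> V \<Longrightarrow> T (- x) = - T x"
  using scale[of x "-1"] by (simp add: scaleC_minus_one)

lemma diff: "x \<in> V \<Longrightarrow> y \<in> V \<Longrightarrow> T (x - y) = T x - T y"
  using add[of x "-y"] by (simp add: uminus)

lemma sum: "(\<And>i. i \<in> I \<Longrightarrow> f i \<in> V) \<Longrightarrow> T (\<Sum>i\<in>I. f i) = (\<Sum>i\<in>I. T (f i))"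
  by (induction I rule: infinite_finite_induct) (auto simp: add V.sum_mem)

abbreviation adj :: "'b \<Rightarrow> 'a" where "adj \<equiv> hadj V ipV W ipW T"

text \<open>Riesz for each functional x |-> <T x, y>. Existence has to be established because
  \<open>hadj\<close> is a choice, about which nothing is known otherwise.\<close>

lemma adj_exists:
  "\<exists>T'. (\<forall>y\<in>W. T' y \<in> V) \<and> (\<forall>x\<in>V. \<forall>y\<in>W. ipW (T x) y = ipV x (T' y))"
proof -
  obtain K where K: "0 \<le> K" "\<And>x. x \<in> V \<Longrightarrow> hnorm ipW (T x) \<le> K * hnorm ipV x"
    using bound by blast
  have "\<exists>z. z \<in> V \<and> (\<forall>x\<in>V. ipW (T x) y = ipV x z)" if y: "y \<in> W" for y
  proof (rule V.riesz_subspace[of V "\<lambda>x. ipW (T x) y" "K * hnorm ipW y"])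
    fix x assume x: "x \<in> V"
    have "cmod (ipW (T x) y) \<le> hnorm ipW (T x) * hnorm ipW y"
      using x y by (intro W.cauchy_schwarz) auto
    also have "\<dots> \<le> K * hnorm ipV x * hnorm ipW y"
      using K(2)[OF x] y by (intro mult_right_mono) auto
    finally show "cmod (ipW (T x) y) \<le> K * hnorm ipW y * hnorm ipV x"
      by (simp add: mult_ac)
    show "ipW (T (c *\<^sub>C x)) y = c * ipW (T x) y" for c
      using x y by (simp add: scale W.ip_scale_left)
  next
    fix x x' assume "x \<in> V" "x' \<in> V"
    then show "ipW (T (x + x')) y = ipW (T x) y + ipW (T x') y"
      using y by (simp add: add W.ip_add_left)
  next
    fix z s assume "z \<in> V" "\<And>x. x \<in> V \<Longrightarrow> ipV x z = ipW (T x) y"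
    then show ?thesis by (intro exI[of _ z]) auto
  qed (use K y in auto)
  then show ?thesis by metis
qed

lemma adj_mem [simp]: "y \<in> W \<Longrightarrow> adj y \<in> V"
  and adj_ip: "x \<in> V \<Longrightarrow> y \<in> W \<Longrightarrow> ipV x (adj y) = ipW (T x) y"
  using someI_ex[OF adj_exists] unfolding hadj_def by auto

lemma adj_ip': "x \<in> V \<Longrightarrow> y \<in> W \<Longrightarrow> ipV (adj y) x = ipW y (T x)"
  using adj_ip[of x y] V.ip_sym[of x "adj y"] W.ip_sym[of "T x" y] by simp

lemma adj_eqI: "y \<in> W \<Longrightarrow> z \<in> V \<Longrightarrow> (\<And>x. x \<in> V \<Longrightarrow> ipW (T x) y = ipV x z) \<Longrightarrow> adj y = z"
  by (rule V.eq_if_ip_eq_left) (auto simp: adj_ip)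

lemma adj_norm_le:
  assumes "0 \<le> K" "\<And>x. x \<in> V \<Longrightarrow> hnorm ipW (T x) \<le> K * hnorm ipV x" "y \<in> W"
  shows "hnorm ipV (adj y) \<le> K * hnorm ipW y"
proof -
  have "(hnorm ipV (adj y))\<^sup>2 = Re (ipW (T (adj y)) y)"
    using assms by (simp add: V.nrm_sq adj_ip)
  also have "\<dots> \<le> hnorm ipW (T (adj y)) * hnorm ipW y"
    using assms by (intro W.re_cauchy_schwarz) auto
  also have "\<dots> \<le> K * hnorm ipV (adj y) * hnorm ipW y"
    using assms by (intro mult_right_mono) auto
  finally have "hnorm ipV (adj y) * hnorm ipV (adj y) \<le> hnorm ipV (adj y) * (K * hnorm ipW y)"
    by (simp add: power2_eq_square mult_ac)
  moreover have "0 \<le> K * hnorm ipW y" using assms by simp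
  moreover have "0 \<le> hnorm ipV (adj y)" using assms by simp
  ultimately show ?thesis by (cases "hnorm ipV (adj y) = 0") auto
qed

lemma adj_bounded: "bounded_op W ipW V ipV adj"
proof -
  obtain K where K: "0 \<le> K" "\<And>x. x \<in> V \<Longrightarrow> hnorm ipW (T x) \<le> K * hnorm ipV x"
    using bound by blast
  have "adj (x + y) = adj x + adj y" if "x \<in> W" "y \<in> W" for x y
    using that by (intro adj_eqI) (auto simp: V.ip_add_right W.ip_add_right adj_ip)
  moreover have "adj (c *\<^sub>C x) = c *\<^sub>C adj x" if "x \<in> W" for x c
    using that by (intro adj_eqI) (auto simp: V.ip_scale_right W.ip_scale_right adj_ip)
  ultimately show ?thesis
    unfolding bounded_op_def using adj_norm_le[OF K] by (auto intro!: exI[of _ K])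
qed

lemma hop_adj: "hop W ipW V ipV adj"
  by unfold_locales (rule adj_bounded)

end

lemma hopI: "hilbert_space V ipV \<Longrightarrow> hilbert_space W ipW \<Longrightarrow> bounded_op V ipV W ipW T \<Longrightarrow> hop V ipV W ipW T"
  by (simp add: hop_def hop_axioms_def hilb_def)

context hilb
begin

text \<open>Iterating x |-> y + T x sums the Neumann series, and \<open>r < 1\<close> gives
  convergence and uniqueness. Together they show that the choice behind \<open>inv_I_minus\<close>
  picks a two-sided inverse on \<open>V\<close>.\<close>

lemma inv_I_minus:
  assumes "hop V ip V ip T" and r: "0 \<le> r" "r < 1"
    and T: "\<And>x. x \<in> V \<Longrightarrow> nrm (T x) \<le> r * nrm x"
  shows "y \<in> V \<Longrightarrow> inv_I_minus V T y \<in> V"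
    and "y \<in> V \<Longrightarrow> inv_I_minus V T y - T (inv_I_minus V T y) = y"
    and "x \<in> V \<Longrightarrow> x - T x = y \<Longrightarrow> inv_I_minus V T y = x"
proof -
  interpret T: hop V ip V ip T by fact
  have ex: "\<exists>x\<in>V. x - T x = y" if y: "y \<in> V" for y
  proof -
    define s where "s n = ((\<lambda>x. y + T x) ^^ n) 0" for n
    have s0: "s 0 = 0" and sS: "s (Suc n) = y + T (s n)" for n by (auto simp: s_def)
    have sV: "s n \<in> V" for n by (induction n) (auto simp: s0 sS y)
    \<comment> \<open>The fixed point of t |-> |y| + r t, hence a bound for all iterates.\<close>
    define c where "c = nrm y / (1 - r)"
    have c0: "0 \<le> c" using y r by (simp add: c_def)
    have sc: "nrm (s n) \<le> c" for n
    proof (induction n)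
      case (Suc n)
      have "nrm (s (Suc n)) \<le> nrm y + nrm (T (s n))"
        unfolding sS using y sV by (intro nrm_triangle) auto
      also have "\<dots> \<le> nrm y + r * c"
        using T[OF sV[of n]] mult_left_mono[OF Suc r(1)] by linarith
      also have "\<dots> = c" using r by (simp add: c_def field_simps)
      finally show ?case .
    qed (use c0 s0 in simp)
    have diff: "nrm (s (n + k) - s n) \<le> r ^ n * c" for n k
    proof (induction n)
      case (Suc n)
      have "s (Suc n + k) - s (Suc n) = T (s (n + k) - s n)"
        using sV by (simp add: sS T.diff)
      then have "nrm (s (Suc n + k) - s (Suc n)) \<le> r * nrm (s (n + k) - s n)"
        using T[of "s (n + k) - s n"] sV by simp
      also have "\<dots> \<le> r * (r ^ n * c)" using Suc r by (intro mult_left_mono)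
      finally show ?case by (simp add: mult.assoc)
    qed (simp add: s0 sc)
    have "\<exists>N. \<forall>m\<ge>N. \<forall>n\<ge>N. nrm (s m - s n) < e" if e: "e > 0" for e
    proof -
      have "(\<lambda>n. r ^ n * c) \<longlonglongrightarrow> 0 * c"
        using r by (intro tendsto_mult_right LIMSEQ_realpow_zero) auto
      then obtain N where N: "\<And>n. n \<ge> N \<Longrightarrow> r ^ n * c < e"
        using order_tendstoD(2)[of _ 0 sequentially e] e by (auto simp: eventually_sequentially)
      have less: "nrm (s m - s n) < e" if "n \<ge> N" "m \<ge> n" for m n
        using diff[of n "m - n"] N[OF that(1)] that by simp
      have "nrm (s m - s n) < e" if "n \<ge> N" "m \<ge> N" for m n
        using less[of m n] less[of n m] nrm_minus_commute[OF sV[of m] sV[of n]] that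
        by (cases "m \<ge> n") auto
      then show ?thesis by blast
    qed
    then obtain l where l: "l \<in> V" "(\<lambda>n. nrm (s n - l)) \<longlonglongrightarrow> 0"
      using complete[of s] sV by metis
    have "(\<lambda>n. nrm (s (Suc n) - (y + T l))) \<longlonglongrightarrow> 0"
    proof (rule Lim_null_comparison)
      show "\<forall>\<^sub>F n in sequentially. norm (nrm (s (Suc n) - (y + T l))) \<le> r * nrm (s n - l)"
        using T[of "s _ - l"] sV l y by (intro always_eventually) (simp add: sS T.diff[symmetric])
      show "(\<lambda>n. r * nrm (s n - l)) \<longlonglongrightarrow> 0"
        using l(2) by (rule tendsto_mult_right_zero)
    qed
    moreover have "(\<lambda>n. nrm (s (Suc n) - l)) \<longlonglongrightarrow> 0"
      using l(2) by (rule LIMSEQ_Suc)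
    ultimately have "l = y + T l"
      using limit_unique[of "\<lambda>n. s (Suc n)" l "y + T l"] sV l y by simp
    then show ?thesis using l(1) by (intro bexI[of _ l]) (auto simp: diff_eq_eq)
  qed
  have uniq: "x = x'" if "x \<in> V" "x' \<in> V" "x - T x = x' - T x'" for x x'
  proof -
    have "x - x' = T (x - x')" using that by (simp add: T.diff algebra_simps)
    then have "nrm (x - x') \<le> r * nrm (x - x')" using T[of "x - x'"] that by simp
    then have "(1 - r) * nrm (x - x') \<le> 0" by (simp add: algebra_simps)
    then have "nrm (x - x') = 0"
      using r that by (intro order_antisym) (auto simp: mult_le_0_iff)
    then show ?thesis using nrm_eq_0[of "x - x'"] that by simp
  qed
  obtain R where R: "\<And>y. y \<in> V \<Longrightarrow> R y \<in> V" "\<And>y. y \<in> V \<Longrightarrow> R y - T (R y) = y"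
    using ex by metis
  have "\<forall>x\<in>V. R x \<in> V \<and> R x - T (R x) = x \<and> R (x - T x) = x"
    using R uniq[OF R(1) _ R(2)] by auto
  then have "\<exists>R. \<forall>x\<in>V. R x \<in> V \<and> R x - T (R x) = x \<and> R (x - T x) = x" by blast
  from someI_ex[OF this]
  have *: "\<forall>x\<in>V. inv_I_minus V T x \<in> V \<and> inv_I_minus V T x - T (inv_I_minus V T x) = x
      \<and> inv_I_minus V T (x - T x) = x"
    unfolding inv_I_minus_def by blast
  then show "y \<in> V \<Longrightarrow> inv_I_minus V T y \<in> V"
    "y \<in> V \<Longrightarrow> inv_I_minus V T y - T (inv_I_minus V T y) = y"
    "x \<in> V \<Longrightarrow> x - T x = y \<Longrightarrow> inv_I_minus V T y = x" by auto
qed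

end

section \<open>Square-summable families\<close>

text \<open>The index type is left free: words give the ambient space of \<open>fock\<close>, and
  the finite type of coordinates gives the direct sum X^d.\<close>

definition ltwo :: "'y::cvector set \<Rightarrow> ('y \<Rightarrow> 'y \<Rightarrow> complex) \<Rightarrow> ('i \<Rightarrow> 'y) set" where
  "ltwo Y ip = {g. (\<forall>i. g i \<in> Y) \<and> (\<lambda>i. (hnorm ip (g i))\<^sup>2) summable_on UNIV}"

definition ltwo_ip :: "('y::cvector \<Rightarrow> 'y \<Rightarrow> complex) \<Rightarrow> ('i \<Rightarrow> 'y) \<Rightarrow> ('i \<Rightarrow> 'y) \<Rightarrow> complex" where
  "ltwo_ip ip g h = (\<Sum>\<^sub>\<infinity>i. ip (g i) (h i))"

lemma scaleC_fun_apply [simp]: "(c *\<^sub>C f) i = c *\<^sub>C f i"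
  by (simp add: scaleC_fun_def)

context hilb
begin

lemma ltwoD:
  assumes "g \<in> ltwo V ip"
  shows "g i \<in> V" "(\<lambda>i. (nrm (g i))\<^sup>2) summable_on UNIV"
  using assms by (auto simp: ltwo_def)

lemma ltwo_zero: "0 \<in> ltwo V ip"
  by (simp add: ltwo_def)

lemma ltwo_add:
  assumes "g \<in> ltwo V ip" "h \<in> ltwo V ip"
  shows "g + h \<in> ltwo V ip"
proof -
  have "(\<lambda>i. (nrm (g i + h i))\<^sup>2) summable_on UNIV"
  proof (rule summable_on_comparison_test)
    show "(\<lambda>i. 2 * (nrm (g i))\<^sup>2 + 2 * (nrm (h i))\<^sup>2) summable_on UNIV"
      using assms by (intro summable_on_add summable_on_cmult_right ltwoD)
    show "(nrm (g i + h i))\<^sup>2 \<le> 2 * (nrm (g i))\<^sup>2 + 2 * (nrm (h i))\<^sup>2" for i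
      using parallelogram[of "g i" "h i"] ltwoD[OF assms(1)] ltwoD[OF assms(2)]
      by (smt (verit) zero_le_power2)
  qed simp
  then show ?thesis using assms by (auto simp: ltwo_def)
qed

lemma ltwo_scale:
  assumes "g \<in> ltwo V ip"
  shows "c *\<^sub>C g \<in> ltwo V ip"
  using ltwoD[OF assms] by (auto simp: ltwo_def nrm_scale power_mult_distrib
      intro!: summable_on_cmult_right)

lemma ltwo_ip_summable:
  assumes "g \<in> ltwo V ip" "h \<in> ltwo V ip"
  shows "(\<lambda>i. ip (g i) (h i)) summable_on UNIV"
proof (rule abs_summable_summable, rule summable_on_comparison_test)
  show "(\<lambda>i. (nrm (g i))\<^sup>2 + (nrm (h i))\<^sup>2) summable_on UNIV"
    using assms by (intro summable_on_add ltwoD)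
  show "cmod (ip (g i) (h i)) \<le> (nrm (g i))\<^sup>2 + (nrm (h i))\<^sup>2" for i
  proof -
    have "cmod (ip (g i) (h i)) \<le> nrm (g i) * nrm (h i)"
      using cauchy_schwarz ltwoD[OF assms(1)] ltwoD[OF assms(2)] by blast
    moreover have "0 \<le> (nrm (g i) - nrm (h i))\<^sup>2" "0 \<le> nrm (g i) * nrm (h i)"
      using ltwoD[OF assms(1)] ltwoD[OF assms(2)] by auto
    ultimately show ?thesis by (simp add: power2_diff algebra_simps)
  qed
qed simp

lemma ltwo_ip_self:
  assumes "g \<in> ltwo V ip"
  shows "ltwo_ip ip g g = of_real (\<Sum>\<^sub>\<infinity>i. (nrm (g i))\<^sup>2)"
proof -
  have "((\<lambda>i. complex_of_real ((nrm (g i))\<^sup>2)) has_sum of_real (\<Sum>\<^sub>\<infinity>i. (nrm (g i))\<^sup>2)) UNIV"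
    by (intro has_sum_of_real has_sum_infsum ltwoD assms)
  then show ?thesis
    unfolding ltwo_ip_def using ltwoD(1)[OF assms] by (simp add: ip_self infsumI)
qed

lemma ltwo_nrm_sq:
  assumes "g \<in> ltwo V ip"
  shows "(hnorm (ltwo_ip ip) g)\<^sup>2 = (\<Sum>\<^sub>\<infinity>i. (nrm (g i))\<^sup>2)"
  unfolding hnorm_def[of "ltwo_ip ip"] ltwo_ip_self[OF assms]
  by (simp add: infsum_nonneg)

lemma ltwo_nrm_sq_le:
  assumes "\<And>i. g i \<in> V" "\<And>F. finite F \<Longrightarrow> (\<Sum>i\<in>F. (nrm (g i))\<^sup>2) \<le> b"
  shows "g \<in> ltwo V ip" "(hnorm (ltwo_ip ip) g)\<^sup>2 \<le> b"
proof -
  have "(\<lambda>i. (nrm (g i))\<^sup>2) summable_on UNIV"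
    using assms(2) by (intro nonneg_bdd_above_summable_on) (auto intro!: bdd_aboveI2)
  then show g: "g \<in> ltwo V ip" using assms(1) by (simp add: ltwo_def)
  show "(hnorm (ltwo_ip ip) g)\<^sup>2 \<le> b"
    unfolding ltwo_nrm_sq[OF g] using assms(2) by (intro infsum_le_finite_sums ltwoD g)
qed

lemma ltwo_finite_sum_le:
  assumes "g \<in> ltwo V ip" "finite F"
  shows "(\<Sum>i\<in>F. (nrm (g i))\<^sup>2) \<le> (hnorm (ltwo_ip ip) g)\<^sup>2"
  unfolding ltwo_nrm_sq[OF assms(1)] using assms by (intro finite_sum_le_infsum ltwoD) auto

lemma ltwo_nrm_nonneg: "g \<in> ltwo V ip \<Longrightarrow> 0 \<le> hnorm (ltwo_ip ip) g"
  unfolding hnorm_def[of "ltwo_ip ip"] by (simp add: ltwo_ip_self infsum_nonneg)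

lemma ltwo_coord_le:
  assumes "g \<in> ltwo V ip"
  shows "nrm (g i) \<le> hnorm (ltwo_ip ip) g"
  using ltwo_finite_sum_le[OF assms, of "{i}"] ltwo_nrm_nonneg[OF assms]
  by (auto intro: power2_le_imp_le)

lemma ltwo_diff: "g \<in> ltwo V ip \<Longrightarrow> h \<in> ltwo V ip \<Longrightarrow> g - h \<in> ltwo V ip"
  using ltwo_add[of g "(-1) *\<^sub>C h"] ltwo_scale[of h "-1"] by (simp add: scaleC_minus_one)

lemma ltwo_hilbert: "hilbert_space (ltwo V ip :: ('i \<Rightarrow> 'a) set) (ltwo_ip ip)"
  unfolding hilbert_space_def
proof (intro conjI ballI allI impI)
  show "(0 :: 'i \<Rightarrow> 'a) \<in> ltwo V ip" by (rule ltwo_zero)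
next
  fix g h :: "'i \<Rightarrow> 'a" assume g: "g \<in> ltwo V ip" and h: "h \<in> ltwo V ip"
  show "g + h \<in> ltwo V ip" using g h by (rule ltwo_add)
  show "ltwo_ip ip h g = cnj (ltwo_ip ip g h)"
    unfolding ltwo_ip_def infsum_cnj[symmetric]
    using ltwoD(1)[OF g] ltwoD(1)[OF h] by (intro infsum_cong ip_sym)
  show "ltwo_ip ip (c *\<^sub>C g) h = c * ltwo_ip ip g h" for c
    unfolding ltwo_ip_def infsum_cmult_right[OF ltwo_ip_summable[OF g h], symmetric]
    using ltwoD(1)[OF g] ltwoD(1)[OF h] by (intro infsum_cong) (simp add: ip_scale_left)
  fix k :: "'i \<Rightarrow> 'a" assume k: "k \<in> ltwo V ip"
  show "ltwo_ip ip (g + h) k = ltwo_ip ip g k + ltwo_ip ip h k"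
    unfolding ltwo_ip_def infsum_add[OF ltwo_ip_summable[OF g k] ltwo_ip_summable[OF h k], symmetric]
    using ltwoD(1)[OF g] ltwoD(1)[OF h] ltwoD(1)[OF k]
    by (intro infsum_cong) (simp add: ip_add_left)
next
  fix g :: "'i \<Rightarrow> 'a" and c assume g: "g \<in> ltwo V ip"
  show "c *\<^sub>C g \<in> ltwo V ip" using g by (rule ltwo_scale)
  assume "g \<noteq> 0"
  then obtain i where "g i \<noteq> 0" by (auto simp: fun_eq_iff)
  then have "0 < nrm (g i)" using ltwoD(1)[OF g, of i] nrm_eq_0 nrm_nonneg by (metis less_eq_real_def)
  then have "0 < hnorm (ltwo_ip ip) g" using ltwo_coord_le[OF g, of i] by linarith
  then show "0 < Re (ltwo_ip ip g g)" by (simp add: hnorm_def[of "ltwo_ip ip"])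
next
  fix s :: "nat \<Rightarrow> 'i \<Rightarrow> 'a"
  assume *: "(\<forall>n. s n \<in> ltwo V ip) \<and>
    (\<forall>e>0. \<exists>N. \<forall>m\<ge>N. \<forall>n\<ge>N. hnorm (ltwo_ip ip) (s m - s n) < e)"
  have s: "s n \<in> ltwo V ip" for n using * by blast
  have sV: "s n i \<in> V" for n i using ltwoD(1)[OF s] .
  have "\<exists>l. l \<in> V \<and> (\<lambda>n. nrm (s n i - l)) \<longlonglongrightarrow> 0" for i
  proof -
    have "\<exists>N. \<forall>m\<ge>N. \<forall>n\<ge>N. nrm (s m i - s n i) < e" if "e > 0" for e
    proof -
      obtain N where N: "\<And>m n. m \<ge> N \<Longrightarrow> n \<ge> N \<Longrightarrow> hnorm (ltwo_ip ip) (s m - s n) < e"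
        using *[THEN conjunct2, rule_format, OF \<open>e > 0\<close>] by auto
      have "nrm (s m i - s n i) < e" if "m \<ge> N" "n \<ge> N" for m n
        using ltwo_coord_le[OF ltwo_diff[OF s s], of m n i] N[OF that] by simp
      then show ?thesis by blast
    qed
    then show ?thesis using complete[of "\<lambda>n. s n i"] sV by metis
  qed
  then obtain l where l: "\<And>i. l i \<in> V" "\<And>i. (\<lambda>n. nrm (s n i - l i)) \<longlonglongrightarrow> 0" by metis
  \<comment> \<open>The Cauchy estimate is passed to the limit on finite partial sums, where only
    coordinatewise convergence is needed. Starting from \<open>e / 2\<close> restores a strict
    inequality after the limit.\<close>
  have key: "\<exists>N. \<forall>n\<ge>N. s n - l \<in> ltwo V ip \<and> hnorm (ltwo_ip ip) (s n - l) < e" if e: "e > 0" for e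
  proof -
    obtain N where N: "\<And>m n. m \<ge> N \<Longrightarrow> n \<ge> N \<Longrightarrow> hnorm (ltwo_ip ip) (s m - s n) < e / 2"
      using *[THEN conjunct2, rule_format, of "e / 2"] e by auto
    have "s n - l \<in> ltwo V ip \<and> (hnorm (ltwo_ip ip) (s n - l))\<^sup>2 \<le> (e / 2)\<^sup>2" if n: "n \<ge> N" for n
    proof -
      have "(\<Sum>i\<in>F. (nrm (s n i - l i))\<^sup>2) \<le> (e / 2)\<^sup>2" if F: "finite F" for F
      proof (rule LIMSEQ_le_const2)
        have "(\<lambda>m. nrm (s m i - s n i)) \<longlonglongrightarrow> nrm (s n i - l i)" for i
          unfolding nrm_minus_commute[OF sV[of n i] l(1)[of i]]
          using l(2)[of i] sV l(1) by (intro tendsto_nrm) (auto simp: algebra_simps)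
        then show "(\<lambda>m. \<Sum>i\<in>F. (nrm (s m i - s n i))\<^sup>2) \<longlonglongrightarrow> (\<Sum>i\<in>F. (nrm (s n i - l i))\<^sup>2)"
          by (intro tendsto_intros)
        have "(\<Sum>i\<in>F. (nrm (s m i - s n i))\<^sup>2) \<le> (e / 2)\<^sup>2" if "m \<ge> N" for m
        proof -
          have "(\<Sum>i\<in>F. (nrm ((s m - s n) i))\<^sup>2) \<le> (hnorm (ltwo_ip ip) (s m - s n))\<^sup>2"
            using ltwo_finite_sum_le[OF ltwo_diff[OF s s] F] .
          also have "\<dots> \<le> (e / 2)\<^sup>2"
            using N[OF that n] ltwo_nrm_nonneg[OF ltwo_diff[OF s s]]
            by (intro power_mono) (auto intro: less_imp_le)
          finally show ?thesis by simp
        qed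
        then show "\<exists>N. \<forall>m\<ge>N. (\<Sum>i\<in>F. (nrm (s m i - s n i))\<^sup>2) \<le> (e / 2)\<^sup>2" by blast
      qed
      then show ?thesis using ltwo_nrm_sq_le[of "s n - l" "(e / 2)\<^sup>2"] sV l(1) by simp
    qed
    then have "s n - l \<in> ltwo V ip \<and> hnorm (ltwo_ip ip) (s n - l) \<le> e / 2" if "n \<ge> N" for n
      using that e power2_le_imp_le[of "hnorm (ltwo_ip ip) (s n - l)" "e / 2"] by simp
    then show ?thesis using e by (intro exI[of _ N]) force
  qed
  obtain n where "s n - l \<in> ltwo V ip" using key[of 1] by auto
  then have "l \<in> ltwo V ip" using ltwo_diff[OF s[of n], of "s n - l"] by simp
  moreover have "(\<lambda>n. hnorm (ltwo_ip ip) (s n - l)) \<longlonglongrightarrow> 0"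
  proof (rule LIMSEQ_I)
    fix r :: real assume "0 < r"
    then obtain N where "\<forall>n\<ge>N. s n - l \<in> ltwo V ip \<and> hnorm (ltwo_ip ip) (s n - l) < r"
      using key by blast
    then have "norm (hnorm (ltwo_ip ip) (s n - l) - 0) < r" if "n \<ge> N" for n
      using that ltwo_nrm_nonneg[of "s n - l"] by auto
    then show "\<exists>N. \<forall>n\<ge>N. norm (hnorm (ltwo_ip ip) (s n - l) - 0) < r" by blast
  qed
  ultimately show "\<exists>l\<in>ltwo V ip. (\<lambda>n. hnorm (ltwo_ip ip) (s n - l)) \<longlonglongrightarrow> 0" by blast
qed

end

section \<open>Sums over words and homogeneous polynomials\<close>

lemma finite_words_eq [simp]: "finite {w::'d::finite list. length w = N}"
  using finite_lists_length_eq[of "UNIV::'d set" N] by simp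

lemma finite_words_less [simp]: "finite {w::'d::finite list. length w < N}"
proof -
  have "{w::'d list. length w < N} = (\<Union>n<N. {w. length w = n})" by auto
  then show ?thesis by simp
qed

lemma sum_words_Suc:
  "(\<Sum>w | length (w::'d::finite list) = Suc N. f w) = (\<Sum>j\<in>UNIV. \<Sum>w | length w = N. f (j # w))"
proof -
  have "(\<Sum>j\<in>UNIV. \<Sum>w | length w = N. f (j # w)) =
      (\<Sum>(j, w)\<in>UNIV \<times> {w. length w = N}. f (j # w))"
    by (simp add: sum.cartesian_product)
  also have "\<dots> = (\<Sum>w | length (w::'d list) = Suc N. f w)"
    by (rule sum.reindex_bij_witness[of _ "\<lambda>w. (hd w, tl w)" "\<lambda>(j, w). j # w"])
      (auto simp: length_Suc_conv)
  finally show ?thesis by simp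
qed

lemma sum_words_less_Suc:
  "(\<Sum>w | length (w::'d::finite list) < Suc N. f w) =
    (\<Sum>w | length w < N. f w) + (\<Sum>w | length w = N. f w)"
proof -
  have "{w::'d list. length w < Suc N} = {w. length w < N} \<union> {w. length w = N}" by auto
  then show ?thesis by (simp add: sum.union_disjoint disjoint_iff)
qed

text \<open>Splitting by the first letter rather than by length. This is the form in which the
  backward shift, or one application of the state tuple, appears in the sums over words.\<close>

lemma sum_words_less_Cons:
  "(\<Sum>w | length (w::'d::finite list) < Suc N. f w) =
    f [] + (\<Sum>j\<in>UNIV. \<Sum>w | length w < N. f (j # w))"
proof (induction N)
  case (Suc N)
  show ?case
    by (subst sum_words_less_Suc, subst Suc, subst sum_words_Suc)
      (simp add: sum_words_less_Suc sum.distrib add.assoc)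
qed (simp add: sum_words_less_Suc)

lemma sum_words_less_eq_sum_eq:
  "(\<Sum>w | length (w::'d::finite list) < N. f w) = (\<Sum>n<N. \<Sum>w | length w = n. f w)"
  by (induction N) (auto simp: sum_words_less_Suc)

text \<open>Words of length below N exhaust all finite sets of words, so unordered sums become
  limits of sums graded by length.\<close>

lemma filterlim_words: "filterlim (\<lambda>N. {w::'d::finite list. length w < N}) (finite_subsets_at_top UNIV) sequentially"
  unfolding filterlim_finite_subsets_at_top
proof (intro allI impI)
  fix X :: "'d list set" assume "finite X \<and> X \<subseteq> UNIV"
  then obtain M where M: "\<And>w. w \<in> X \<Longrightarrow> length w < M"
    using finite_nat_set_iff_bounded[of "length ` X"] by auto
  show "\<forall>\<^sub>F N in sequentially. finite {w::'d list. length w < N} \<and> X \<subseteq> {w. length w < N} \<and> {w::'d list. length w < N} \<subseteq> UNIV"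
    using eventually_ge_at_top[of M] by eventually_elim (use M in force)
qed

lemma infsum_words_lim:
  assumes "f summable_on UNIV"
  shows "(\<lambda>N. \<Sum>w | length (w::'d::finite list) < N. f w) \<longlonglongrightarrow> infsum f UNIV"
  using filterlim_compose[OF _ filterlim_words] has_sum_infsum[OF assms]
  unfolding has_sum_def by blast

lemma finite_sum_le_words:
  fixes f :: "'d::finite list \<Rightarrow> real"
  assumes "\<And>w. 0 \<le> f w" "\<And>N. (\<Sum>w | length w < N. f w) \<le> b" "finite F"
  shows "sum f F \<le> b"
proof -
  obtain M where M: "\<And>w. w \<in> F \<Longrightarrow> length w < M"
    using assms(3) finite_nat_set_iff_bounded[of "length ` F"] by auto
  have "sum f F \<le> (\<Sum>w | length w < M. f w)"
    using M assms(1) by (intro sum_mono2) auto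
  then show ?thesis using assms(2)[of M] by linarith
qed

section \<open>Monomials of words and uniqueness of symmetric coefficients\<close>

definition mon :: "complex^'d \<Rightarrow> 'd list \<Rightarrow> complex" where
  "mon z w = (\<Prod>j\<leftarrow>w. z $ j)"

lemma mon_Nil [simp]: "mon z [] = 1"
  and mon_Cons [simp]: "mon z (j # w) = z $ j * mon z w"
  by (simp_all add: mon_def)

lemma mon_mset: "mset v = mset w \<Longrightarrow> mon z v = mon z w"
  unfolding mon_def by (metis mset_map prod_mset_prod_list)

text \<open>Expanding the N-th power of the inner product yields one term per word of length N.
  Summed over N, this becomes the geometric series of \<open>kd\<close>.\<close>

lemma sum_mon: "(\<Sum>w | length w = N. mon l w * cnj (mon z w)) = cinner_d l z ^ N"
proof (induction N)
  case (Suc N)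
  have "(\<Sum>w | length w = Suc N. mon l w * cnj (mon z w)) =
      (\<Sum>j\<in>UNIV. l $ j * cnj (z $ j) * (\<Sum>w | length w = N. mon l w * cnj (mon z w)))"
    by (simp add: sum_words_Suc sum_distrib_left mult_ac)
  also have "\<dots> = cinner_d l z * cinner_d l z ^ N"
    unfolding Suc cinner_d_def by (simp add: sum_distrib_right)
  finally show ?case by simp
qed simp

lemma cinner_d_self: "cinner_d l l = of_real ((norm l)\<^sup>2)"
  by (simp add: cinner_d_def norm_vec_def L2_set_def sum_nonneg complex_norm_square del: of_real_power)

lemma ball_d_iff: "l \<in> ball_d \<longleftrightarrow> norm l < 1"
  by (simp add: ball_d_def cinner_d_self abs_square_less_1 del: of_real_power)

lemma open_ball_d: "open (ball_d :: (complex^'d) set)"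
proof -
  have "(ball_d :: (complex^'d) set) = ball 0 1" by (auto simp: ball_d_iff)
  then show ?thesis by (metis open_ball)
qed

lemma cinner_d_le: "cmod (cinner_d l z) \<le> norm l * norm z"
proof -
  have "cmod (cinner_d l z) \<le> (\<Sum>j\<in>UNIV. \<bar>cmod (l $ j)\<bar> * \<bar>cmod (z $ j)\<bar>)"
    unfolding cinner_d_def by (rule order.trans[OF norm_sum]) (simp add: norm_mult)
  also have "\<dots> \<le> norm l * norm z"
    unfolding norm_vec_def by (rule L2_set_mult_ineq)
  finally show ?thesis .
qed

lemma cinner_d_less_1: "l \<in> ball_d \<Longrightarrow> z \<in> ball_d \<Longrightarrow> cmod (cinner_d l z) < 1"
  using cinner_d_le[of l z] mult_strict_mono[of "norm l" 1 "norm z" 1]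
  by (cases "norm z = 0") (auto simp: ball_d_iff)

lemma sum_norm_mon: "(\<Sum>w | length w = N. (cmod (mon z w))\<^sup>2) = ((norm z)\<^sup>2) ^ N"
proof -
  have "complex_of_real (\<Sum>w | length w = N. (cmod (mon z w))\<^sup>2) =
      (\<Sum>w | length w = N. mon z w * cnj (mon z w))"
    by (simp only: of_real_sum complex_norm_square)
  also have "\<dots> = of_real (((norm z)\<^sup>2) ^ N)"
    by (simp add: sum_mon cinner_d_self)
  finally have "complex_of_real (\<Sum>w | length w = N. (cmod (mon z w))\<^sup>2) = of_real (((norm z)\<^sup>2) ^ N)" .
  then show ?thesis by (simp only: of_real_eq_iff)
qed

text \<open>Once the lower coefficients vanish, dividing by \<open>t ^ n\<close> leaves a power
  series that is 0 near, but not at, the origin; its limit there is \<open>a n\<close>.\<close>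

lemma powser_zero_coeff:
  fixes a :: "nat \<Rightarrow> complex"
  assumes "\<And>t. cmod t < 1 \<Longrightarrow> (\<lambda>n. a n * t ^ n) sums 0"
  shows "a n = 0"
proof (induction n rule: less_induct)
  case (less n)
  have "(\<lambda>k. a (k + n) * t ^ k) sums 0" if t: "t \<noteq> 0" "norm t < 1" for t
  proof -
    have "(\<lambda>k. a (k + n) * t ^ (k + n)) sums 0"
      using assms[OF t(2)] less by (subst sums_iff_shift) simp
    then have "(\<lambda>k. inverse (t ^ n) * (a (k + n) * t ^ (k + n))) sums (inverse (t ^ n) * 0)"
      by (rule sums_mult)
    then show ?thesis using t by (simp add: power_add field_simps)
  qed
  then have "((\<lambda>_. 0) \<longlongrightarrow> a (0 + n)) (at (0::complex))"
    by (intro powser_limit_0_strong[of 1 "\<lambda>k. a (k + n)"]) auto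
  then show ?case by (metis LIM_const_eq add_0)
qed

definition symmetric :: "('d list \<Rightarrow> 'a) \<Rightarrow> bool" where
  "symmetric c \<longleftrightarrow> (\<forall>v w. mset v = mset w \<longrightarrow> c v = c w)"

lemma symmetric_Cons: "symmetric c \<Longrightarrow> symmetric (\<lambda>w. c (j # w))"
  by (auto simp: symmetric_def)

text \<open>Differentiating in direction \<open>k\<close> removes one letter \<open>k\<close> from a
  word, at any of its N positions. Symmetry moves that letter to the front, so the N contributions
  agree. For \<open>N = 0\<close> the truncated \<open>N - 1\<close> is harmless because of the
  factor N.\<close>

lemma homogeneous_deriv:
  fixes c :: "'d::finite list \<Rightarrow> complex" and z :: "complex^'d" and k :: 'd
  assumes "symmetric c"
  defines "\<zeta> \<equiv> \<lambda>t. \<chi> j. z $ j + t * (if j = k then 1 else 0)"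
  shows "((\<lambda>t. \<Sum>w | length w = N. mon (\<zeta> t) w * c w) has_field_derivative
      of_nat N * (\<Sum>w | length w = N - 1. mon (\<zeta> t) w * c (k # w))) (at t)"
  using assms(1)
proof (induction N arbitrary: c)
  case (Suc N)
  let ?P = "\<lambda>N c t. \<Sum>w | length w = N. mon (\<zeta> t) w * c w"
  have step: "?P (Suc N) c t = (\<Sum>j\<in>UNIV. (z $ j + t * (if j = k then 1 else 0)) * ?P N (\<lambda>w. c (j # w)) t)"
    for c t N by (simp add: sum_words_Suc sum_distrib_left mult_ac \<zeta>_def)
  have swap: "c (j # k # w) = c (k # j # w)" for j w
    using Suc.prems by (auto simp: symmetric_def add_mset_commute)
  have IH: "((\<lambda>t. ?P N (\<lambda>w. c (j # w)) t) has_field_derivative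
      of_nat N * ?P (N - 1) (\<lambda>w. c (j # k # w)) t) (at t)" for j
    using Suc.IH[OF symmetric_Cons[OF Suc.prems]] .
  have "((\<lambda>t. ?P (Suc N) c t) has_field_derivative
      (\<Sum>j\<in>UNIV. (if j = k then 1 else 0) * ?P N (\<lambda>w. c (j # w)) t +
        (of_nat N * ?P (N - 1) (\<lambda>w. c (j # k # w)) t) * (z $ j + t * (if j = k then 1 else 0)))) (at t)"
    unfolding step
    by (intro DERIV_sum DERIV_mult IH) (auto intro!: derivative_eq_intros)
  also have "(\<Sum>j\<in>UNIV. (if j = k then 1 else 0) * ?P N (\<lambda>w. c (j # w)) t +
        (of_nat N * ?P (N - 1) (\<lambda>w. c (j # k # w)) t) * (z $ j + t * (if j = k then 1 else 0)))
      = ?P N (\<lambda>w. c (k # w)) t + of_nat N *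
         (\<Sum>j\<in>UNIV. (z $ j + t * (if j = k then 1 else 0)) * ?P (N - 1) (\<lambda>w. c (k # j # w)) t)"
    unfolding swap sum.distrib sum_distrib_left[of "of_nat N" _ "UNIV::'d set"]
    by (simp add: if_distrib[of "\<lambda>x. x * _"] mult_ac cong: if_cong)
  also have "\<dots> = of_nat (Suc N) * ?P N (\<lambda>w. c (k # w)) t"
  proof (cases N)
    case (Suc M)
    then have "(\<Sum>j\<in>UNIV. (z $ j + t * (if j = k then 1 else 0)) * ?P (N - 1) (\<lambda>w. c (k # j # w)) t)
        = ?P N (\<lambda>w. c (k # w)) t"
      using step[where N = M and c = "\<lambda>w. c (k # w)" and t = t] by simp
    then show ?thesis by (simp add: algebra_simps)
  qed simp
  finally show ?case by simp
qed simp

text \<open>Induction on the degree: the ball is open, so a vanishing polynomial has vanishing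
  derivatives, and these are the polynomials of the families with a prefixed letter. Without
  symmetry it fails: opposite values on \<open>[j, k]\<close> and \<open>[k, j]\<close>
  cancel.\<close>

lemma homogeneous_zero:
  fixes c :: "'d::finite list \<Rightarrow> complex"
  assumes "symmetric c" "\<And>z. z \<in> ball_d \<Longrightarrow> (\<Sum>w | length w = N. mon z w * c w) = 0"
    and "length w = N"
  shows "c w = 0"
  using assms
proof (induction N arbitrary: c w)
  case 0
  have "(0::complex^'d) \<in> ball_d" by (simp add: ball_d_iff)
  then show ?case using "0.prems"(2)[of 0] "0.prems"(3) by simp
next
  case (Suc N)
  then obtain k v where w: "w = k # v" "length v = N" by (auto simp: length_Suc_conv)
  have "(\<Sum>w | length w = N. mon z w * c (k # w)) = 0" if z: "z \<in> ball_d" for z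
  proof -
    define \<zeta> where "\<zeta> t = (\<chi> j. z $ j + t * (if j = k then 1 else 0))" for t
    have cont: "(\<zeta> \<longlongrightarrow> \<zeta> 0) (nhds 0)"
      unfolding \<zeta>_def by (intro tendsto_vec_lambda tendsto_intros) (auto intro: tendsto_eq_intros filterlim_ident)
    have z0: "\<zeta> 0 = z" by (simp add: \<zeta>_def vec_eq_iff)
    have "\<forall>\<^sub>F t in nhds 0. \<zeta> t \<in> ball_d"
      using topological_tendstoD[OF cont open_ball_d] z0 z by simp
    then have ev: "\<forall>\<^sub>F t in nhds 0. (\<Sum>w | length w = Suc N. mon (\<zeta> t) w * c w) = 0"
      by eventually_elim (use Suc.prems in simp)
    have "((\<lambda>t. \<Sum>w | length w = Suc N. mon (\<zeta> t) w * c w) has_field_derivative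
      of_nat (Suc N) * (\<Sum>w | length w = Suc N - 1. mon (\<zeta> 0) w * c (k # w))) (at 0)"
      unfolding \<zeta>_def by (rule homogeneous_deriv[OF Suc.prems(1)])
    then have "((\<lambda>t. 0) has_field_derivative
      of_nat (Suc N) * (\<Sum>w | length w = Suc N - 1. mon (\<zeta> 0) w * c (k # w))) (at 0)"
      by (rule DERIV_cong_ev[OF refl ev refl, THEN iffD1])
    then have "of_nat (Suc N) * (\<Sum>w | length w = Suc N - 1. mon (\<zeta> 0) w * c (k # w)) = 0"
      using DERIV_unique[OF _ DERIV_const] by blast
    then show ?thesis by (simp add: z0 del: of_nat_Suc)
  qed
  from Suc.IH[OF symmetric_Cons[OF Suc.prems(1)] this w(2)] w(1) show ?case by simp
qed

section \<open>The Drury--Arveson space as a symmetric Fock space\<close>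

definition fock :: "'y::cvector set \<Rightarrow> ('y \<Rightarrow> 'y \<Rightarrow> complex) \<Rightarrow> ('d list \<Rightarrow> 'y) set" where
  "fock Y ip = {g \<in> ltwo Y ip. symmetric g}"

definition Kf :: "complex^'d \<Rightarrow> 'y::cvector \<Rightarrow> 'd list \<Rightarrow> 'y" where
  "Kf z y = (\<lambda>w. cnj (mon z w) *\<^sub>C y)"

definition shift :: "'d \<Rightarrow> ('d list \<Rightarrow> 'y) \<Rightarrow> 'd list \<Rightarrow> 'y" where
  "shift j g = (\<lambda>w. g (j # w))"

lemma symmetric_Kf: "symmetric (Kf z y)"
  unfolding symmetric_def Kf_def by (metis mon_mset)

lemma symmetric_add: "symmetric f \<Longrightarrow> symmetric g \<Longrightarrow> symmetric (f + g)"
  unfolding symmetric_def plus_fun_def by metis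

lemma symmetric_scale: "symmetric f \<Longrightarrow> symmetric (c *\<^sub>C f)"
  unfolding symmetric_def scaleC_fun_def by metis

lemma lcomb_nth: "lcomb a xs = (\<Sum>i<length xs. fst (xs ! i) *\<^sub>C a (snd (xs ! i)))"
  unfolding lcomb_def by (simp add: sum_list_sum_nth case_prod_beta atLeast0LessThan)

lemma Kf_add: "Kf z (x + y) = Kf z x + Kf z y"
  by (simp add: Kf_def fun_eq_iff scaleC_add_right)

lemma Kf_scale: "Kf z (c *\<^sub>C y) = c *\<^sub>C Kf z y"
  by (simp add: Kf_def fun_eq_iff scaleC_scaleC mult.commute)

lemma (in hilb) fock_hilbert: "hilbert_space (fock V ip :: ('d list \<Rightarrow> 'a) set) (ltwo_ip ip)"
proof -
  interpret L: hilb "ltwo V ip :: ('d list \<Rightarrow> 'a) set" "ltwo_ip ip"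
    by unfold_locales (rule ltwo_hilbert)
  show ?thesis
  proof (rule L.closed_subspace_hilbert)
    show "0 \<in> fock V ip" by (simp add: fock_def symmetric_def ltwo_zero)
    show "x + y \<in> fock V ip" if "x \<in> fock V ip" "y \<in> fock V ip" for x y :: "'d list \<Rightarrow> 'a"
      using that L.add_mem symmetric_add unfolding fock_def by blast
    show "c *\<^sub>C x \<in> fock V ip" if "x \<in> fock V ip" for x :: "'d list \<Rightarrow> 'a" and c
      using that L.scale_mem symmetric_scale unfolding fock_def by blast
  next
    fix s and l :: "'d list \<Rightarrow> 'a"
    assume s: "\<And>n::nat. s n \<in> fock V ip" and l: "l \<in> ltwo V ip" and lim: "(\<lambda>n. L.nrm (s n - l)) \<longlonglongrightarrow> 0"
    have sL: "s n \<in> ltwo V ip" for n using s by (simp add: fock_def)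
    have coord: "(\<lambda>n. nrm (s n w - l w)) \<longlonglongrightarrow> 0" for w
    proof (rule Lim_null_comparison[OF _ lim])
      have "norm (nrm (s n w - l w)) \<le> L.nrm (s n - l)" for n
        using ltwo_coord_le[OF ltwo_diff[OF sL l], of n w] ltwoD(1)[OF sL] ltwoD(1)[OF l] by simp
      then show "\<forall>\<^sub>F n in sequentially. norm (nrm (s n w - l w)) \<le> L.nrm (s n - l)" by simp
    qed
    have "l v = l w" if "mset v = mset w" for v w
    proof -
      have "s n v = s n w" for n using s[of n] that unfolding fock_def symmetric_def by blast
      then show ?thesis
        using limit_unique[of "\<lambda>n. s n v" "l v" "l w"] coord[of v] coord[of w]
          ltwoD(1)[OF sL] ltwoD(1)[OF l] by simp
    qed
    then show "l \<in> fock V ip" using l unfolding fock_def symmetric_def by blast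
  qed (auto simp: fock_def)
qed

text \<open>The coefficient space does not mention the number of variables; \<open>dim\<close> fixes
  the index type \<open>'d\<close> of the words and of the ball.\<close>

locale rkhs = hilb V ip for V :: "'a::cvector set" and ip +
  fixes dim :: "'d::finite itself"

sublocale rkhs \<subseteq> F: hilb "fock V ip :: ('d list \<Rightarrow> 'a) set" "ltwo_ip ip"
  by unfold_locales (rule fock_hilbert)

context rkhs
begin

lemma fock_ltwo: "g \<in> fock V ip \<Longrightarrow> g \<in> ltwo V ip"
  by (simp add: fock_def)

lemma fock_coord [simp]: "g \<in> fock V ip \<Longrightarrow> g w \<in> V"
  by (rule ltwoD(1)[OF fock_ltwo])

lemma fock_symmetric: "g \<in> fock V ip \<Longrightarrow> mset v = mset w \<Longrightarrow> g v = g w"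
  unfolding fock_def symmetric_def by blast

lemma Kf_mem [simp]:
  fixes z :: "complex^'d"
  assumes z: "z \<in> ball_d" and y: "y \<in> V"
  shows "Kf z y \<in> fock V ip"
proof -
  define r where "r = (norm z)\<^sup>2"
  have r: "0 \<le> r" "r < 1" using z by (auto simp: r_def ball_d_iff abs_square_less_1)
  have "(\<Sum>w\<in>F. (nrm (Kf z y w))\<^sup>2) \<le> (nrm y)\<^sup>2 / (1 - r)" if "finite F" for F
  proof (rule finite_sum_le_words)
    fix N
    have "(\<Sum>w | length w < N. (nrm (Kf z y w))\<^sup>2) = (\<Sum>w | length w < N. (cmod (mon z w))\<^sup>2) * (nrm y)\<^sup>2"
      unfolding sum_distrib_right using y by (simp add: Kf_def nrm_scale power_mult_distrib)
    also have "(\<Sum>w | length w < N. (cmod (mon z w))\<^sup>2) = (\<Sum>n<N. r ^ n)"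
      unfolding sum_words_less_eq_sum_eq by (simp only: sum_norm_mon r_def)
    also have "\<dots> \<le> 1 / (1 - r)"
      using r by (simp add: sum_gp_strict divide_right_mono)
    finally show "(\<Sum>w | length w < N. (nrm (Kf z y w))\<^sup>2) \<le> (nrm y)\<^sup>2 / (1 - r)"
      by (simp add: mult_right_mono)
  qed (use that in auto)
  then have "Kf z y \<in> ltwo V ip"
    using y by (intro ltwo_nrm_sq_le) (auto simp: Kf_def)
  then show ?thesis by (simp add: fock_def symmetric_Kf)
qed

lemma fock_ip_lim:
  assumes "g \<in> fock V ip" "h \<in> fock V ip"
  shows "(\<lambda>N. \<Sum>w | length (w::'d list) < N. ip (g w) (h w)) \<longlonglongrightarrow> ltwo_ip ip g h"
  unfolding ltwo_ip_def using assms by (intro infsum_words_lim ltwo_ip_summable fock_ltwo)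

lemma ip_Kf_lim:
  fixes z :: "complex^'d"
  assumes g: "g \<in> fock V ip" and z: "z \<in> ball_d" and y: "y \<in> V"
  shows "(\<lambda>N. \<Sum>w | length w < N. mon z w * ip (g w) y) \<longlonglongrightarrow> ltwo_ip ip g (Kf z y)"
  using fock_ip_lim[OF g Kf_mem[OF z y]] g y by (simp add: Kf_def ip_scale_right)

text \<open>Grouping words by length gives a geometric series in \<open>cinner_d l z\<close>. So the
  kernel functions of the word model have exactly the Gram matrix that defines H(k_d).\<close>

lemma gram:
  fixes z l :: "complex^'d"
  assumes "z \<in> ball_d" "l \<in> ball_d" "y \<in> V" "x \<in> V"
  shows "ltwo_ip ip (Kf z y) (Kf l x) = kd l z * ip y x"
proof -
  have "(\<Sum>w | length w < N. mon l w * ip (Kf z y w) x) = (\<Sum>n<N. cinner_d l z ^ n) * ip y x" for N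
  proof -
    have "(\<Sum>w | length w < N. mon l w * ip (Kf z y w) x) =
        (\<Sum>w | length w < N. mon l w * cnj (mon z w)) * ip y x"
      unfolding sum_distrib_right using assms by (simp add: Kf_def ip_scale_left mult_ac)
    then show ?thesis unfolding sum_words_less_eq_sum_eq sum_mon .
  qed
  then have "(\<lambda>N. (\<Sum>n<N. cinner_d l z ^ n) * ip y x) \<longlonglongrightarrow> ltwo_ip ip (Kf z y) (Kf l x)"
    using ip_Kf_lim[OF Kf_mem[of z y], of l x] assms by simp
  moreover have "(\<lambda>N. (\<Sum>n<N. cinner_d l z ^ n) * ip y x) \<longlonglongrightarrow> kd l z * ip y x"
    using geometric_sums[OF cinner_d_less_1[OF assms(2,1)]]
    by (intro tendsto_mult_right) (simp add: kd_def sums_def)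
  ultimately show ?thesis by (rule LIMSEQ_unique)
qed

text \<open>Replacing \<open>z\<close> by \<open>t z\<close> with a scalar t turns the pairing into
  a power series in t, which isolates the homogeneous parts. Each vanishes on the ball, and symmetry
  of \<open>g\<close> then kills every coefficient.\<close>

lemma Kf_total:
  assumes g: "g \<in> fock V ip"
    and 0: "\<And>z y. (z::complex^'d) \<in> ball_d \<Longrightarrow> y \<in> V \<Longrightarrow> ltwo_ip ip g (Kf z y) = 0"
  shows "g = 0"
proof
  fix w
  show "g w = 0 w"
  proof (rule eq_if_ip_eq)
    fix y assume y: "y \<in> V"
    define c where "c w = ip (g w) y" for w
    have sym: "symmetric c"
      unfolding symmetric_def c_def using fock_symmetric[OF g] by metis
    have "(\<Sum>w | length w = n. mon z w * c w) = 0" if z: "z \<in> ball_d" for z :: "complex^'d" and n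
    proof (rule powser_zero_coeff)
      fix t :: complex assume t: "cmod t < 1"
      define tz where "tz = (\<chi> j. t * z $ j)"
      have "norm tz = cmod t * norm z"
        by (simp add: tz_def norm_vec_def norm_mult L2_set_right_distrib)
      then have tz: "tz \<in> ball_d"
        using z t mult_strict_mono[of "cmod t" 1 "norm z" 1] by (auto simp: ball_d_iff)
      have mon: "mon tz w = t ^ length w * mon z w" for w
        by (induction w) (auto simp: tz_def)
      have "(\<lambda>N. \<Sum>w | length w < N. mon tz w * c w) \<longlonglongrightarrow> 0"
        using ip_Kf_lim[OF g tz y] 0[OF tz y] by (simp add: c_def)
      moreover have "(\<Sum>w | length w < N. mon tz w * c w) =
          (\<Sum>n<N. (\<Sum>w | length w = n. mon z w * c w) * t ^ n)" for N
        unfolding sum_words_less_eq_sum_eq sum_distrib_right mon by (simp add: mult_ac)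
      ultimately show "(\<lambda>n. (\<Sum>w | length w = n. mon z w * c w) * t ^ n) sums 0"
        by (simp add: sums_def)
    qed
    then have "c w = 0" using homogeneous_zero[OF sym] by blast
    then show "ip (g w) y = ip (0 w) y" using y by (simp add: c_def)
  qed (use g in auto)
qed

lemma eq_if_ip_Kf_eq:
  assumes "g \<in> fock V ip" "h \<in> fock V ip"
    and "\<And>z y. (z::complex^'d) \<in> ball_d \<Longrightarrow> y \<in> V \<Longrightarrow> ltwo_ip ip g (Kf z y) = ltwo_ip ip h (Kf z y)"
  shows "g = h"
  using Kf_total[of "g - h"] assms by (simp add: F.ip_diff_left)

section \<open>Backward shifts on word-indexed families\<close>

lemma shift_mem [simp]:
  fixes g :: "'d list \<Rightarrow> 'a"
  assumes g: "g \<in> fock V ip"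
  shows "shift j g \<in> fock V ip"
proof -
  have "(\<Sum>w\<in>F. (nrm (shift j g w))\<^sup>2) \<le> (F.nrm g)\<^sup>2" if "finite F" for F
  proof -
    have "(\<Sum>w\<in>F. (nrm (shift j g w))\<^sup>2) = (\<Sum>w\<in>(#) j ` F. (nrm (g w))\<^sup>2)"
      by (subst sum.reindex) (auto simp: shift_def)
    also have "\<dots> \<le> (F.nrm g)\<^sup>2"
      using that by (intro ltwo_finite_sum_le fock_ltwo g) simp
    finally show ?thesis .
  qed
  then have "shift j g \<in> ltwo V ip"
    using g by (intro ltwo_nrm_sq_le) (auto simp: shift_def)
  then show ?thesis using g by (auto simp: fock_def shift_def symmetric_Cons)
qed

lemma fock_nrm_lim:
  assumes "g \<in> fock V ip"
  shows "(\<lambda>N. \<Sum>w | length (w::'d list) < N. (nrm (g w))\<^sup>2) \<longlonglongrightarrow> (F.nrm g)\<^sup>2"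
  unfolding ltwo_nrm_sq[OF fock_ltwo[OF assms]]
  using assms by (intro infsum_words_lim ltwoD fock_ltwo)

text \<open>Every nonempty word has a unique first letter. This is the model of an isometric output
  pair: the shifts as state tuple, the value at the empty word as output.\<close>

lemma shift_nrm:
  fixes g :: "'d list \<Rightarrow> 'a"
  assumes g: "g \<in> fock V ip"
  shows "(\<Sum>j\<in>UNIV. (F.nrm (shift j g))\<^sup>2) + (nrm (g []))\<^sup>2 = (F.nrm g)\<^sup>2"
proof (rule LIMSEQ_unique)
  have "(\<lambda>N. (\<Sum>j\<in>UNIV. \<Sum>w | length w < N. (nrm (shift j g w))\<^sup>2) + (nrm (g []))\<^sup>2)
      \<longlonglongrightarrow> (\<Sum>j\<in>UNIV. (F.nrm (shift j g))\<^sup>2) + (nrm (g []))\<^sup>2"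
    using g by (intro tendsto_intros fock_nrm_lim shift_mem)
  then show "(\<lambda>N. \<Sum>w | length w < Suc N. (nrm (g w))\<^sup>2)
      \<longlonglongrightarrow> (\<Sum>j\<in>UNIV. (F.nrm (shift j g))\<^sup>2) + (nrm (g []))\<^sup>2"
    by (simp add: sum_words_less_Cons shift_def add.commute)
  show "(\<lambda>N. \<Sum>w | length w < Suc N. (nrm (g w))\<^sup>2) \<longlonglongrightarrow> (F.nrm g)\<^sup>2"
    by (rule LIMSEQ_Suc[OF fock_nrm_lim[OF g]])
qed

text \<open>In terms of functions: f(z) = f(0) + sum_j z_j f_j(z), where f_j is the function of the
  shifted family.\<close>

lemma ip_Kf_shift:
  fixes z :: "complex^'d"
  assumes g: "g \<in> fock V ip" and z: "z \<in> ball_d" and y: "y \<in> V"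
  shows "ltwo_ip ip g (Kf z y) = ip (g []) y + (\<Sum>j\<in>UNIV. z $ j * ltwo_ip ip (shift j g) (Kf z y))"
proof (rule LIMSEQ_unique)
  show "(\<lambda>N. \<Sum>w | length w < Suc N. mon z w * ip (g w) y) \<longlonglongrightarrow> ltwo_ip ip g (Kf z y)"
    by (rule LIMSEQ_Suc[OF ip_Kf_lim[OF assms]])
  have "(\<lambda>N. ip (g []) y + (\<Sum>j\<in>UNIV. z $ j * (\<Sum>w | length w < N. mon z w * ip (shift j g w) y)))
      \<longlonglongrightarrow> ip (g []) y + (\<Sum>j\<in>UNIV. z $ j * ltwo_ip ip (shift j g) (Kf z y))"
    using assms by (intro tendsto_intros ip_Kf_lim shift_mem)
  then show "(\<lambda>N. \<Sum>w | length w < Suc N. mon z w * ip (g w) y)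
      \<longlonglongrightarrow> ip (g []) y + (\<Sum>j\<in>UNIV. z $ j * ltwo_ip ip (shift j g) (Kf z y))"
    by (simp add: sum_words_less_Cons shift_def sum_distrib_left mult.assoc)
qed

lemma shift_Kf: "shift j (Kf z y) = cnj (z $ j) *\<^sub>C Kf z y"
  by (simp add: shift_def Kf_def fun_eq_iff scaleC_scaleC)

lemma shift_nrm_le:
  fixes g :: "'d list \<Rightarrow> 'a"
  assumes g: "g \<in> fock V ip"
  shows "F.nrm (shift j g) \<le> F.nrm g"
proof (rule power2_le_imp_le)
  have "(F.nrm (shift j g))\<^sup>2 \<le> (\<Sum>j\<in>UNIV. (F.nrm (shift j g))\<^sup>2)"
    by (rule member_le_sum) auto
  then show "(F.nrm (shift j g))\<^sup>2 \<le> (F.nrm g)\<^sup>2"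
    using shift_nrm[OF g] zero_le_power2[of "nrm (g [])"] by linarith
qed (use g in simp)

lemma shift_bounded: "bounded_op (fock V ip :: ('d list \<Rightarrow> 'a) set) (ltwo_ip ip) (fock V ip) (ltwo_ip ip) (shift j)"
  unfolding bounded_op_def
  using shift_nrm_le by (auto intro!: exI[of _ 1]) (auto simp: shift_def fun_eq_iff)

sublocale shift: hop "fock V ip :: ('d list \<Rightarrow> 'a) set" "ltwo_ip ip" "fock V ip" "ltwo_ip ip" "shift j" for j
  by unfold_locales (rule shift_bounded)

text \<open>Kernel functions are joint eigenvectors of the shifts, so the adjoint shifts multiply
  values by the coordinates.\<close>

lemma shift_adj_Kf:
  "g \<in> fock V ip \<Longrightarrow> z \<in> ball_d \<Longrightarrow> y \<in> V \<Longrightarrow>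
    ltwo_ip ip (shift.adj j g) (Kf z y) = z $ j * ltwo_ip ip g (Kf z y)"
  by (simp add: shift.adj_ip' shift_Kf F.ip_scale_right)

text \<open>\<open>rkrep f g\<close> says \<open>f(z) = \<Sum>\<^sub>w z\<^sup>w g\<^sub>w\<close> over words \<open>w\<close>: each Taylor coefficient of \<open>f\<close> is
  spread evenly over the words with the same letter counts, which turns the weighted
  coefficient norm of \<open>H(k\<^sub>d)\<close> into the plain \<open>\<ell>\<^sup>2\<close> norm.\<close>

definition rkrep :: "(complex^'d \<Rightarrow> 'a) \<Rightarrow> ('d list \<Rightarrow> 'a) \<Rightarrow> bool" where
  "rkrep f g \<longleftrightarrow> g \<in> fock V ip \<and>
     (\<forall>l\<in>ball_d. f l \<in> V \<and> (\<forall>y\<in>V. ip (f l) y = ltwo_ip ip g (Kf l y)))"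

lemma rkrep_mem [simp]: "rkrep f g \<Longrightarrow> g \<in> fock V ip"
  and rkrep_val: "rkrep f g \<Longrightarrow> l \<in> ball_d \<Longrightarrow> f l \<in> V"
  and rkrep_ip: "rkrep f g \<Longrightarrow> l \<in> ball_d \<Longrightarrow> y \<in> V \<Longrightarrow> ltwo_ip ip g (Kf l y) = ip (f l) y"
  by (auto simp: rkrep_def)

lemma rkrep_unique: "rkrep f g \<Longrightarrow> rkrep f h \<Longrightarrow> g = h"
  by (rule eq_if_ip_Kf_eq) (auto simp: rkrep_ip)

lemma rkrep_inj: "rkrep f g \<Longrightarrow> rkrep f' g \<Longrightarrow> l \<in> ball_d \<Longrightarrow> f l = f' l"
  by (rule eq_if_ip_eq) (auto simp: rkrep_val rkrep_ip[symmetric])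

lemma rkrep_add: "rkrep f g \<Longrightarrow> rkrep f' g' \<Longrightarrow> rkrep (\<lambda>z. f z + f' z) (g + g')"
  unfolding rkrep_def by (auto simp: F.ip_add_left ip_add_left)

lemma rkrep_scale: "rkrep f g \<Longrightarrow> rkrep (\<lambda>z. c *\<^sub>C f z) (c *\<^sub>C g)"
  unfolding rkrep_def by (auto simp: F.ip_scale_left ip_scale_left)

text \<open>The value f(l) is the vector representing y |-> <Kf l y, g>. This functional is bounded
  because |Kf l y|^2 = \<open>kd l l\<close> |y|^2.\<close>

lemma rkrep_exists:
  assumes g: "g \<in> fock V ip"
  obtains f where "rkrep f g"
proof -
  have "\<exists>v. v \<in> V \<and> (\<forall>y\<in>V. ip v y = ltwo_ip ip g (Kf l y))" if l: "l \<in> ball_d" for l :: "complex^'d"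
  proof (rule riesz_subspace[of V "\<lambda>y. ltwo_ip ip (Kf l y) g" "sqrt (Re (kd l l)) * F.nrm g"])
    fix y assume y: "y \<in> V"
    have "cmod (ltwo_ip ip (Kf l y) g) \<le> F.nrm (Kf l y) * F.nrm g"
      using l y g by (intro F.cauchy_schwarz) auto
    also have "F.nrm (Kf l y) = sqrt (Re (kd l l)) * nrm y"
      using gram[OF l l y y] y
      by (simp add: hnorm_def[of "ltwo_ip ip"] ip_self real_sqrt_mult del: of_real_power)
    finally show "cmod (ltwo_ip ip (Kf l y) g) \<le> sqrt (Re (kd l l)) * F.nrm g * nrm y"
      by (simp add: mult_ac)
    show "ltwo_ip ip (Kf l (c *\<^sub>C y)) g = c * ltwo_ip ip (Kf l y) g" for c
      using l y g by (simp add: Kf_scale F.ip_scale_left)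
  next
    fix x y assume "x \<in> V" "y \<in> V"
    then show "ltwo_ip ip (Kf l (x + y)) g = ltwo_ip ip (Kf l x) g + ltwo_ip ip (Kf l y) g"
      using l g by (simp add: Kf_add F.ip_add_left)
  next
    have "0 \<le> Re (kd l l)"
      using l by (simp add: kd_def cinner_d_self ball_d_iff abs_square_le_1 Re_divide_of_real flip: of_real_diff of_real_power)
    then show "0 \<le> sqrt (Re (kd l l)) * F.nrm g" using g by simp
  next
    fix v s assume v: "v \<in> V" "\<And>y. y \<in> V \<Longrightarrow> ip y v = ltwo_ip ip (Kf l y) g"
    have "ip v y = ltwo_ip ip g (Kf l y)" if "y \<in> V" for y
      using ip_sym[OF that v(1)] F.ip_sym[of "Kf l y" g] v(2)[OF that] l g that by simp
    then show ?thesis using v(1) by blast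
  qed auto
  then obtain f where "\<And>l. l \<in> ball_d \<Longrightarrow> f l \<in> V \<and> (\<forall>y\<in>V. ip (f l) y = ltwo_ip ip g (Kf l y))"
    by metis
  then show thesis using that[of f] g unfolding rkrep_def by blast
qed

text \<open>Identifies the quadratic form in \<open>rk_bound\<close> as a squared norm; in
  particular it is nonnegative.\<close>

lemma nrm_sum_Kf:
  fixes \<zeta> :: "nat \<Rightarrow> complex^'d"
  assumes "\<forall>i<n. \<zeta> i \<in> ball_d \<and> y i \<in> V"
  shows "(F.nrm (\<Sum>i<n. Kf (\<zeta> i) (y i)))\<^sup>2 = Re (\<Sum>i<n. \<Sum>j<n. kd (\<zeta> j) (\<zeta> i) * ip (y i) (y j))"
proof -
  have m: "Kf (\<zeta> i) (y i) \<in> fock V ip" if "i \<in> {..<n}" for i using assms that by simp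
  have sm: "(\<Sum>i<n. Kf (\<zeta> i) (y i)) \<in> fock V ip" by (rule F.sum_mem) (rule m)
  have "ltwo_ip ip (\<Sum>i<n. Kf (\<zeta> i) (y i)) (\<Sum>i<n. Kf (\<zeta> i) (y i))
      = (\<Sum>i<n. \<Sum>j<n. ltwo_ip ip (Kf (\<zeta> i) (y i)) (Kf (\<zeta> j) (y j)))"
    using sm m by (subst F.ip_sum_left) (auto intro!: sum.cong F.ip_sum_right)
  also have "\<dots> = (\<Sum>i<n. \<Sum>j<n. kd (\<zeta> j) (\<zeta> i) * ip (y i) (y j))"
    using assms by (intro sum.cong refl gram) auto
  finally show ?thesis
    using sm by (simp add: F.nrm_sq)
qed

lemma rk_bound_rkrep:
  assumes f: "rkrep f g"
  shows "rk_bound V ip f ((F.nrm g)\<^sup>2)"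
  unfolding rk_bound_def
proof (intro allI impI)
  fix n :: nat and \<zeta> :: "nat \<Rightarrow> complex^'d" and y
  assume *: "\<forall>i<n. \<zeta> i \<in> ball_d \<and> y i \<in> V"
  have m: "Kf (\<zeta> i) (y i) \<in> fock V ip" if "i \<in> {..<n}" for i using * that by simp
  have "(\<Sum>i<n. ip (f (\<zeta> i)) (y i)) = ltwo_ip ip g (\<Sum>i<n. Kf (\<zeta> i) (y i))"
    using * f m by (subst F.ip_sum_right) (auto intro!: sum.cong simp: rkrep_ip)
  then have "cmod (\<Sum>i<n. ip (f (\<zeta> i)) (y i)) \<le> F.nrm g * F.nrm (\<Sum>i<n. Kf (\<zeta> i) (y i))"
    using F.cauchy_schwarz[of g "\<Sum>i<n. Kf (\<zeta> i) (y i)"] f m F.sum_mem[of "{..<n}"] by simp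
  then have "(cmod (\<Sum>i<n. ip (f (\<zeta> i)) (y i)))\<^sup>2 \<le> (F.nrm g)\<^sup>2 * (F.nrm (\<Sum>i<n. Kf (\<zeta> i) (y i)))\<^sup>2"
    unfolding power_mult_distrib[symmetric] by (intro power_mono) auto
  then show "(cmod (\<Sum>i<n. ip (f (\<zeta> i)) (y i)))\<^sup>2
      \<le> (F.nrm g)\<^sup>2 * Re (\<Sum>i<n. \<Sum>j<n. kd (\<zeta> j) (\<zeta> i) * ip (y i) (y j))"
    unfolding nrm_sum_Kf[OF *] .
qed

text \<open>\<open>rk_bound\<close> is the hypothesis of \<open>moment_problem\<close> for the
  kernel functions and the values <y, f(z)>; the solution is the family of \<open>f\<close>.\<close>

lemma rk_bound_imp_rkrep:
  fixes f :: "complex^'d \<Rightarrow> 'a"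
  assumes f: "\<And>l. l \<in> ball_d \<Longrightarrow> f l \<in> V" and M: "0 \<le> M" "rk_bound V ip f M"
  obtains g where "rkrep f g" "(F.nrm g)\<^sup>2 \<le> M"
proof -
  define a :: "(complex^'d) \<times> 'a \<Rightarrow> 'd list \<Rightarrow> 'a" where "a = (\<lambda>(z, y). Kf z y)"
  define \<phi> where "\<phi> = (\<lambda>(z, y). ip y (f z))"
  have a: "\<forall>i\<in>ball_d \<times> V. a i \<in> fock V ip" by (auto simp: a_def)
  obtain g where g: "g \<in> clspan (fock V ip) (ltwo_ip ip) a (ball_d \<times> V)"
    "\<And>i. i \<in> ball_d \<times> V \<Longrightarrow> ltwo_ip ip (a i) g = \<phi> i" "F.nrm g \<le> sqrt M"
  proof (rule F.moment_problem[OF a, of "sqrt M" \<phi>])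
    fix xs :: "(complex \<times> (complex^'d) \<times> 'a) list"
    assume xs: "set xs \<subseteq> UNIV \<times> ball_d \<times> V"
    define n where "n = length xs"
    define \<zeta> where "\<zeta> i = fst (snd (xs ! i))" for i
    \<comment> \<open>\<open>rk_bound\<close> carries no scalar weights, so the coefficients are
      absorbed into the vectors.\<close>
    define y where "y i = fst (xs ! i) *\<^sub>C snd (snd (xs ! i))" for i
    have mem: "xs ! i \<in> UNIV \<times> ball_d \<times> V" if "i < n" for i
      using xs that nth_mem[of i xs] by (auto simp: n_def)
    have *: "\<forall>i<n. \<zeta> i \<in> ball_d \<and> y i \<in> V"
      using mem by (fastforce simp: \<zeta>_def y_def)
    have "a (snd (xs ! i)) = Kf (\<zeta> i) (snd (snd (xs ! i)))" for i
      by (simp add: a_def \<zeta>_def case_prod_beta)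
    then have la: "lcomb a xs = (\<Sum>i<n. Kf (\<zeta> i) (y i))"
      unfolding lcomb_nth n_def[symmetric] by (simp add: y_def Kf_scale)
    have "fst (xs ! i) *\<^sub>C \<phi> (snd (xs ! i)) = cnj (ip (f (\<zeta> i)) (y i))" if "i < n" for i
    proof -
      have m: "snd (snd (xs ! i)) \<in> V" "f (\<zeta> i) \<in> V"
        using mem[OF that] * that f by (auto simp: mem_Times_iff)
      have "fst (xs ! i) *\<^sub>C \<phi> (snd (xs ! i)) = ip (y i) (f (\<zeta> i))"
        using m by (simp add: \<phi>_def case_prod_beta y_def ip_scale_left \<zeta>_def scaleC_complex_def)
      then show ?thesis using ip_sym[of "f (\<zeta> i)" "y i"] m by (simp add: y_def)
    qed
    then have "lcomb \<phi> xs = cnj (\<Sum>i<n. ip (f (\<zeta> i)) (y i))"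
      unfolding lcomb_nth n_def[symmetric] by simp
    then have "(cmod (lcomb \<phi> xs))\<^sup>2 \<le> M * (F.nrm (lcomb a xs))\<^sup>2"
      using M(2) * unfolding rk_bound_def la nrm_sum_Kf[OF *] by (simp del: cnj_sum)
    also have "\<dots> = (sqrt M * F.nrm (lcomb a xs))\<^sup>2"
      using M(1) by (simp add: power_mult_distrib)
    finally show "cmod (lcomb \<phi> xs) \<le> sqrt M * F.nrm (lcomb a xs)"
      using M(1) F.lcomb_mem[OF a xs] by (auto intro: power2_le_imp_le)
  next
    fix z assume "z \<in> clspan (fock V ip) (ltwo_ip ip) a (ball_d \<times> V)"
      "\<And>i. i \<in> ball_d \<times> V \<Longrightarrow> ltwo_ip ip (a i) z = \<phi> i" "F.nrm z \<le> sqrt M"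
    then show thesis using that by blast
  qed (use M in auto)
  have gF: "g \<in> fock V ip" using g(1) F.clspan_subset by blast
  have "ip (f l) y = ltwo_ip ip g (Kf l y)" if "l \<in> ball_d" "y \<in> V" for l y
    using g(2)[of "(l, y)"] that F.ip_sym[of "Kf l y" g] gF ip_sym[of y "f l"] f
    by (simp add: a_def \<phi>_def)
  then have "rkrep f g" using f gF by (auto simp: rkrep_def)
  moreover have "(F.nrm g)\<^sup>2 \<le> M"
    using power_mono[OF g(3), of 2] gF M(1) by simp
  ultimately show thesis using that by blast
qed

text \<open>Enlarging the constant is legitimate because the form it multiplies is a squared norm by
  \<open>nrm_sum_Kf\<close>.\<close>

lemma rk_bound_mono:
  fixes f :: "complex^'d \<Rightarrow> 'a"
  assumes "rk_bound V ip f M" "M \<le> M'"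
  shows "rk_bound V ip f M'"
  unfolding rk_bound_def
proof (intro allI impI)
  fix n :: nat and \<zeta> :: "nat \<Rightarrow> complex^'d" and y
  assume *: "\<forall>i<n. \<zeta> i \<in> ball_d \<and> y i \<in> V"
  have "(cmod (\<Sum>i<n. ip (f (\<zeta> i)) (y i)))\<^sup>2 \<le> M * (F.nrm (\<Sum>i<n. Kf (\<zeta> i) (y i)))\<^sup>2"
    using assms(1) * unfolding rk_bound_def nrm_sum_Kf[OF *] by blast
  also have "\<dots> \<le> M' * (F.nrm (\<Sum>i<n. Kf (\<zeta> i) (y i)))\<^sup>2"
    using assms(2) by (intro mult_right_mono) auto
  finally show "(cmod (\<Sum>i<n. ip (f (\<zeta> i)) (y i)))\<^sup>2
      \<le> M' * Re (\<Sum>i<n. \<Sum>j<n. kd (\<zeta> j) (\<zeta> i) * ip (y i) (y j))"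
    unfolding nrm_sum_Kf[OF *] .
qed

lemma rk_bound_iff:
  assumes f: "rkrep f g" and M: "0 \<le> M"
  shows "rk_bound V ip f M \<longleftrightarrow> (F.nrm g)\<^sup>2 \<le> M"
proof
  assume "rk_bound V ip f M"
  then obtain h where "rkrep f h" "(F.nrm h)\<^sup>2 \<le> M"
    using rk_bound_imp_rkrep[of f M] rkrep_val[OF f] M by blast
  then show "(F.nrm g)\<^sup>2 \<le> M" using rkrep_unique[OF f] by blast
qed (rule rk_bound_mono[OF rk_bound_rkrep[OF f]])

lemma in_Hkd_iff:
  fixes f :: "complex^'d \<Rightarrow> 'a"
  shows "in_Hkd V ip f \<longleftrightarrow> (\<exists>g. rkrep f g)"
proof
  assume f: "in_Hkd V ip f"
  then obtain M where M: "rk_bound V ip f M" by (auto simp: in_Hkd_def)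
  \<comment> \<open>\<open>in_Hkd\<close> admits a negative \<open>M\<close>, whereas
    \<open>rk_bound_imp_rkrep\<close> takes a square root of it.\<close>
  then have "rk_bound V ip f (max M 0)" by (rule rk_bound_mono) simp
  then show "\<exists>g. rkrep f g"
    using rk_bound_imp_rkrep[of f "max M 0"] f by (auto simp: in_Hkd_def)
next
  assume "\<exists>g. rkrep f g"
  then show "in_Hkd V ip f"
    using rk_bound_rkrep by (auto simp: in_Hkd_def rkrep_val)
qed

lemma Hkd_norm_rkrep:
  assumes f: "rkrep f g"
  shows "Hkd_norm V ip f = F.nrm g"
proof -
  have "0 \<le> M" if "(F.nrm g)\<^sup>2 \<le> M" for M
    using that by (rule order_trans[OF zero_le_power2])
  then have "{M. 0 \<le> M \<and> rk_bound V ip f M} = {(F.nrm g)\<^sup>2..}"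
    using rk_bound_iff[OF f] by auto
  then show ?thesis using f by (simp add: Hkd_norm_def)
qed

lemma Hkd_inner_rkrep:
  assumes f: "rkrep f g" and f': "rkrep f' g'"
  shows "Hkd_inner V ip f f' = ltwo_ip ip g g'"
  using F.polarization[of g g'] f f' Hkd_norm_rkrep[OF rkrep_add[OF f rkrep_scale[OF f']]]
  by (simp add: Hkd_inner_def)

end

section \<open>Multiplication operators\<close>

text \<open>The range of \<open>adj\<close> is orthogonal to the kernel, and a contraction that
  preserves |x| satisfies T^* T x = x, as expanding |T^* T x - x|^2 shows. Conversely the adjoint
  identity gives T T^* T = T, so g - T^* T g lies in the kernel; if g is orthogonal to the kernel,
  this difference is orthogonal to itself.\<close>

lemma (in hop) partial_isometry_iff:
  assumes contr: "\<And>x. x \<in> V \<Longrightarrow> W.nrm (T x) \<le> V.nrm x"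
  shows "(\<forall>g\<in>V. (\<forall>k\<in>V. T k = 0 \<longrightarrow> ipV g k = 0) \<longrightarrow> W.nrm (T g) = V.nrm g) \<longleftrightarrow>
    (\<forall>y\<in>W. adj (T (adj y)) = adj y)"
proof
  assume iso: "\<forall>g\<in>V. (\<forall>k\<in>V. T k = 0 \<longrightarrow> ipV g k = 0) \<longrightarrow> W.nrm (T g) = V.nrm g"
  show "\<forall>y\<in>W. adj (T (adj y)) = adj y"
  proof
    fix y assume y: "y \<in> W"
    define x where "x = adj y"
    have x: "x \<in> V" using y by (simp add: x_def)
    have eq: "W.nrm (T x) = V.nrm x"
      using iso[rule_format, OF x] y by (simp add: x_def adj_ip')
    have "(V.nrm (adj (T x) - x))\<^sup>2 = (V.nrm (adj (T x)))\<^sup>2 - 2 * (W.nrm (T x))\<^sup>2 + (V.nrm x)\<^sup>2"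
      using x by (simp add: V.nrm_diff_sq adj_ip' W.nrm_sq)
    also have "(V.nrm (adj (T x)))\<^sup>2 \<le> (W.nrm (T x))\<^sup>2"
      using adj_norm_le[of 1 "T x"] contr x by (intro power_mono) auto
    finally have "(V.nrm (adj (T x) - x))\<^sup>2 \<le> 0" by (simp add: eq)
    then have "V.nrm (adj (T x) - x) = 0" by simp
    then show "adj (T (adj y)) = adj y"
      using V.nrm_eq_0[of "adj (T x) - x"] x by (simp add: x_def)
  qed
next
  assume adj: "\<forall>y\<in>W. adj (T (adj y)) = adj y"
  show "\<forall>g\<in>V. (\<forall>k\<in>V. T k = 0 \<longrightarrow> ipV g k = 0) \<longrightarrow> W.nrm (T g) = V.nrm g"
  proof (intro ballI impI)
    fix g assume g: "g \<in> V" and perp: "\<forall>k\<in>V. T k = 0 \<longrightarrow> ipV g k = 0"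
    have TT: "T (adj (T g)) = T g"
    proof (rule W.eq_if_ip_eq)
      fix y assume y: "y \<in> W"
      have "ipW (T (adj (T g))) y = ipV g (adj (T (adj y)))"
        using g y by (simp add: adj_ip[symmetric] adj_ip')
      then show "ipW (T (adj (T g))) y = ipW (T g) y" using adj g y by (simp add: adj_ip)
    qed (use g in auto)
    define k where "k = g - adj (T g)"
    have k: "k \<in> V" "T k = 0" using g TT by (auto simp: k_def diff)
    have "ipV k k = ipV g k - ipV (adj (T g)) k" using g k by (simp add: k_def V.ip_diff_left)
    also have "\<dots> = 0" using perp k g by (simp add: adj_ip')
    finally have "k = 0" using V.ip_pos[OF k(1)] by auto
    then have "g = adj (T g)" by (simp add: k_def)
    then have "ipV g g = ipW (T g) (T g)" using adj_ip[of g "T g"] g by simp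
    then show "W.nrm (T g) = V.nrm g" by (simp add: hnorm_def)
  qed
qed

section \<open>Multiplication by S on word-indexed families\<close>

locale multiplier = U: rkhs U ipU dim + Y: rkhs Y ipY dim
  for U :: "'u::cvector set" and ipU and Y :: "'y::cvector set" and ipY
    and dim :: "'d::finite itself" +
  fixes S :: "complex^'d \<Rightarrow> 'u \<Rightarrow> 'y"
  assumes S_bounded: "l \<in> ball_d \<Longrightarrow> bounded_op U ipU Y ipY (S l)"
begin

abbreviation Sa :: "complex^'d \<Rightarrow> 'y \<Rightarrow> 'u" where "Sa l \<equiv> hadj U ipU Y ipY (S l)"

lemma hop_S: "l \<in> ball_d \<Longrightarrow> hop U ipU Y ipY (S l)"
  using S_bounded U.hilbert Y.hilbert by (rule_tac hopI)

lemmas S_mem [simp] = hop.mem[OF hop_S]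
  and Sa_mem [simp] = hop.adj_mem[OF hop_S]
  and Sa_ip = hop.adj_ip[OF hop_S]
  and Sa_hop = hop.hop_adj[OF hop_S]

text \<open>From <S(z) f(z), y> = <f(z), S(z)^* y>: the product is described by its pairings with
  kernel functions alone, without mentioning a function on the ball.\<close>

definition is_product :: "('d list \<Rightarrow> 'u) \<Rightarrow> ('d list \<Rightarrow> 'y) \<Rightarrow> bool" where
  "is_product g h \<longleftrightarrow> h \<in> fock Y ipY \<and>
     (\<forall>z\<in>ball_d. \<forall>y\<in>Y. ltwo_ip ipY h (Kf z y) = ltwo_ip ipU g (Kf z (Sa z y)))"

lemma is_product_rkrep:
  assumes "U.rkrep f g"
  shows "Y.rkrep (mult_op S f) h \<longleftrightarrow> is_product g h"
  using assms unfolding is_product_def Y.rkrep_def mult_op_def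
  by (auto simp: U.rkrep_ip U.rkrep_val Sa_ip)

lemma is_product_unique: "is_product g h \<Longrightarrow> is_product g h' \<Longrightarrow> h = h'"
  by (rule Y.eq_if_ip_Kf_eq) (auto simp: is_product_def)

end

locale contractive_multiplier = multiplier U ipU Y ipY dim S
  for U :: "'u::cvector set" and ipU and Y :: "'y::cvector set" and ipY
    and dim :: "'d::finite itself" and S +
  assumes S_contractive:
    "in_Hkd U ipU f \<Longrightarrow> in_Hkd Y ipY (mult_op S f) \<and> Hkd_norm Y ipY (mult_op S f) \<le> Hkd_norm U ipU f"
begin

definition M :: "('d list \<Rightarrow> 'u) \<Rightarrow> 'd list \<Rightarrow> 'y" where
  "M g = (THE h. is_product g h)"

lemma is_product_M:
  assumes "g \<in> fock U ipU"
  shows "is_product g (M g)" "Y.F.nrm (M g) \<le> U.F.nrm g"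
proof -
  obtain f where f: "U.rkrep f g" using U.rkrep_exists[OF assms] by blast
  then have *: "in_Hkd Y ipY (mult_op S f)" "Hkd_norm Y ipY (mult_op S f) \<le> Hkd_norm U ipU f"
    using S_contractive[of f] U.in_Hkd_iff[of f] by auto
  obtain h where h: "Y.rkrep (mult_op S f) h" using *(1)[unfolded Y.in_Hkd_iff] by blast
  then have "is_product g h" using is_product_rkrep[OF f] by simp
  then have "M g = h" unfolding M_def using is_product_unique by blast
  then show "is_product g (M g)" "Y.F.nrm (M g) \<le> U.F.nrm g"
    using \<open>is_product g h\<close> *(2) Y.Hkd_norm_rkrep[OF h] U.Hkd_norm_rkrep[OF f] by auto
qed

lemma M_rkrep: "U.rkrep f g \<Longrightarrow> Y.rkrep (mult_op S f) (M g)"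
  using is_product_rkrep is_product_M by simp

lemma M_mem: "g \<in> fock U ipU \<Longrightarrow> M g \<in> fock Y ipY"
  using is_product_M by (simp add: is_product_def)

lemma M_ip:
  "g \<in> fock U ipU \<Longrightarrow> z \<in> ball_d \<Longrightarrow> y \<in> Y \<Longrightarrow>
    ltwo_ip ipY (M g) (Kf z y) = ltwo_ip ipU g (Kf z (Sa z y))"
  using is_product_M by (simp add: is_product_def)

lemma M_bounded: "bounded_op (fock U ipU) (ltwo_ip ipU) (fock Y ipY) (ltwo_ip ipY) M"
proof -
  have "M (x + y) = M x + M y" if "x \<in> fock U ipU" "y \<in> fock U ipU" for x y
    using that by (intro Y.eq_if_ip_Kf_eq) (auto simp: M_mem M_ip Y.F.ip_add_left U.F.ip_add_left)
  moreover have "M (c *\<^sub>C x) = c *\<^sub>C M x" if "x \<in> fock U ipU" for x c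
    using that by (intro Y.eq_if_ip_Kf_eq) (auto simp: M_mem M_ip Y.F.ip_scale_left U.F.ip_scale_left)
  ultimately show ?thesis
    unfolding bounded_op_def using is_product_M(2) by (auto simp: M_mem intro!: exI[of _ 1])
qed

sublocale M: hop "fock U ipU :: ('d list \<Rightarrow> 'u) set" "ltwo_ip ipU" "fock Y ipY" "ltwo_ip ipY" M
  by unfold_locales (rule M_bounded)

lemma M_adj_Kf: "z \<in> ball_d \<Longrightarrow> y \<in> Y \<Longrightarrow> M.adj (Kf z y) = Kf z (Sa z y)"
  by (rule M.adj_eqI) (auto simp: M_ip)

lemma M_eq_0_iff:
  assumes f: "U.rkrep f g"
  shows "M g = 0 \<longleftrightarrow> (\<forall>l\<in>ball_d. S l (f l) = 0)"
proof
  have 0: "Y.rkrep (\<lambda>_. 0) 0" by (auto simp: Y.rkrep_def)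
  show "\<forall>l\<in>ball_d. S l (f l) = 0" if "M g = 0"
    using Y.rkrep_inj[OF _ 0, of "mult_op S f"] M_rkrep[OF f] that by (auto simp: mult_op_def)
  show "M g = 0" if *: "\<forall>l\<in>ball_d. S l (f l) = 0"
  proof (rule Y.Kf_total)
    show "M g \<in> fock Y ipY" using f by simp
    show "ltwo_ip ipY (M g) (Kf z y) = 0" if "z \<in> ball_d" "y \<in> Y" for z :: "complex^'d" and y
      using Y.rkrep_ip[OF M_rkrep[OF f] that] * that by (simp add: mult_op_def)
  qed
qed

text \<open>Orthogonality to the kernel, stated for functions, is carried through
  \<open>rkrep\<close> to families, where \<open>partial_isometry_iff\<close> applies.\<close>

lemma inner_multiplier_iff:
  assumes "op_holomorphic U ipU Y ipY S"
  shows "inner_multiplier U ipU Y ipY S \<longleftrightarrow> (\<forall>h\<in>fock Y ipY. M.adj (M (M.adj h)) = M.adj h)"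
proof -
  have "inner_multiplier U ipU Y ipY S \<longleftrightarrow>
    (\<forall>g\<in>fock U ipU. (\<forall>k\<in>fock U ipU. M k = 0 \<longrightarrow> ltwo_ip ipU g k = 0) \<longrightarrow> Y.F.nrm (M g) = U.F.nrm g)"
    (is "_ \<longleftrightarrow> ?R")
  proof
    assume L: "inner_multiplier U ipU Y ipY S"
    show ?R
    proof (intro ballI impI)
      fix g assume g: "g \<in> fock U ipU" and perp: "\<forall>k\<in>fock U ipU. M k = 0 \<longrightarrow> ltwo_ip ipU g k = 0"
      obtain f where f: "U.rkrep f g" using U.rkrep_exists[OF g] by blast
      have perp': "Hkd_inner U ipU f f' = 0" if f': "in_Hkd U ipU f'" "\<forall>l\<in>ball_d. S l (f' l) = 0" for f'
      proof -
        obtain k where k: "U.rkrep f' k" using f'(1)[unfolded U.in_Hkd_iff] by blast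
        then show ?thesis using perp f' M_eq_0_iff[OF k] U.Hkd_inner_rkrep[OF f k] by simp
      qed
      have "in_Hkd U ipU f" unfolding U.in_Hkd_iff using f by blast
      then have "Hkd_norm Y ipY (mult_op S f) = Hkd_norm U ipU f"
        using L[unfolded inner_multiplier_def, THEN conjunct2, THEN spec, of f] perp' by fast
      then show "Y.F.nrm (M g) = U.F.nrm g"
        using Y.Hkd_norm_rkrep[OF M_rkrep[OF f]] U.Hkd_norm_rkrep[OF f] by simp
    qed
  next
    assume R: ?R
    show "inner_multiplier U ipU Y ipY S"
      unfolding inner_multiplier_def schur_class_def
    proof (intro conjI allI impI)
      fix f assume f': "in_Hkd U ipU f \<and> (\<forall>g. in_Hkd U ipU g \<and> (\<forall>l\<in>ball_d. S l (g l) = 0) \<longrightarrow> Hkd_inner U ipU f g = 0)"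
      obtain g where f: "U.rkrep f g" using f'[THEN conjunct1, unfolded U.in_Hkd_iff] by blast
      have "ltwo_ip ipU g k = 0" if k: "k \<in> fock U ipU" "M k = 0" for k
      proof -
        obtain e where e: "U.rkrep e k" using U.rkrep_exists[OF k(1)] by blast
        then have "in_Hkd U ipU e" unfolding U.in_Hkd_iff by blast
        then have "Hkd_inner U ipU f e = 0" using f' k M_eq_0_iff[OF e] by simp
        then show ?thesis using U.Hkd_inner_rkrep[OF f e] by simp
      qed
      then have "Y.F.nrm (M g) = U.F.nrm g" using R f by simp
      then show "Hkd_norm Y ipY (mult_op S f) = Hkd_norm U ipU f"
        using Y.Hkd_norm_rkrep[OF M_rkrep[OF f]] U.Hkd_norm_rkrep[OF f] by simp
    qed (use assms S_contractive in auto)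
  qed
  also have "\<dots> \<longleftrightarrow> (\<forall>h\<in>fock Y ipY. M.adj (M (M.adj h)) = M.adj h)"
    using M.partial_isometry_iff is_product_M(2) by blast
  finally show ?thesis .
qed

end

section \<open>Powers of commuting tuples\<close>

lemma fold_commute_mset:
  assumes A: "\<And>j x. x \<in> X \<Longrightarrow> A j x \<in> X" and comm: "commutative_tuple X A"
    and x: "x \<in> X" and vw: "mset v = mset w"
  shows "fold A v x = fold A w x"
proof -
  \<comment> \<open>\<open>fold_multiset_equiv\<close> asks for commuting maps on the whole type.
    Extending by the identity off \<open>X\<close> provides that without changing anything on
    \<open>X\<close>.\<close>
  define A' where "A' j x = (if x \<in> X then A j x else x)" for j x
  have "fold A' v = fold A' w"
    using comm A by (intro fold_multiset_equiv vw)
      (auto simp: A'_def fun_eq_iff commutative_tuple_def)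
  moreover have "fold A' u x = fold A u x" for u
    using x by (induction u arbitrary: x) (auto simp: A'_def A)
  ultimately show ?thesis by metis
qed

text \<open>\<open>mpow\<close> applies the operator of the last enumerated letter first, while
  \<open>fold\<close> starts at the head of the list; hence the reversed enumeration.\<close>

definition word_of :: "('d::enum \<Rightarrow> nat) \<Rightarrow> 'd list" where
  "word_of n = concat (map (\<lambda>j. replicate (n j) j) (rev enum_class.enum))"

lemma count_word_of: "count (mset (word_of n)) = n"
proof
  fix j
  have "count (mset (concat (map (\<lambda>j. replicate (n j) j) js))) j = (if j \<in> set js then n j else 0)"
    if "distinct js" for js
    using that by (induction js) auto
  from this[of "rev enum_class.enum"] show "count (mset (word_of n)) j = n j"
    by (simp add: word_of_def enum_distinct UNIV_enum[symmetric])
qed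

lemma mpow_eq_fold: "mpow A n x = fold A (word_of n) x"
proof -
  have rep: "fold A (replicate m j) x = (A j ^^ m) x" for m j x
    by (induction m arbitrary: x) (auto simp: funpow_swap1)
  have "foldr (\<lambda>j acc. (A j ^^ n j) \<circ> acc) js id x = fold A (concat (map (\<lambda>j. replicate (n j) j) (rev js))) x"
    for js by (induction js) (auto simp: rep)
  then show ?thesis by (simp add: mpow_def word_of_def)
qed

lemma length_eq_sum_count: "length w = (\<Sum>j\<in>UNIV. count (mset w) (j::'d::finite))"
proof -
  have "length w = size (mset w)" by simp
  also have "\<dots> = (\<Sum>j\<in>set_mset (mset w). count (mset w) j)" by (rule size_multiset_overloaded_eq)
  also have "\<dots> = (\<Sum>j\<in>UNIV. count (mset w) j)"
    by (rule sum.mono_neutral_left) (auto simp: count_eq_zero_iff)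
  finally show ?thesis .
qed

text \<open>Words of length N are grouped by their letter counts n. By commutativity all words of a
  group act alike, and the group has N!/n! members.\<close>

lemma sum_multinomial_eq_sum_words:
  fixes A :: "'d::{finite,enum} \<Rightarrow> 'x \<Rightarrow> 'x" and h :: "'x \<Rightarrow> real"
  assumes A: "\<And>j x. x \<in> X \<Longrightarrow> A j x \<in> X" and comm: "commutative_tuple X A" and x: "x \<in> X"
  shows "(\<Sum>n\<in>{n::'d \<Rightarrow> nat. (\<Sum>j\<in>UNIV. n j) = N}.
      real (fact N) / real (\<Prod>j\<in>UNIV. fact (n j)) * h (mpow A n x)) = (\<Sum>w | length w = N. h (fold A w x))"
proof -
  let ?S = "{w::'d list. length w = N}" and ?T = "{n::'d \<Rightarrow> nat. (\<Sum>j\<in>UNIV. n j) = N}"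
  let ?g = "\<lambda>w::'d list. count (mset w)"
  have "word_of n \<in> ?S" if "n \<in> ?T" for n
    using that by (simp add: length_eq_sum_count count_word_of)
  then have "?T \<subseteq> ?g ` ?S" by (metis (no_types, lifting) count_word_of image_eqI subsetI)
  then have finT: "finite ?T" using finite_surj[OF finite_words_eq] by blast
  have "(\<Sum>w\<in>?S. h (fold A w x)) = (\<Sum>n\<in>?T. \<Sum>w\<in>{w \<in> ?S. ?g w = n}. h (fold A w x))"
    using finT by (intro sum.group[symmetric]) (auto simp: length_eq_sum_count[symmetric])
  also have "\<dots> = (\<Sum>n\<in>?T. real (fact N) / real (\<Prod>j\<in>UNIV. fact (n j)) * h (mpow A n x))"
  proof (rule sum.cong[OF refl])
    fix n assume n: "n \<in> ?T"
    let ?m = "mset (word_of n)"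
    have set: "{w \<in> ?S. ?g w = n} = permutations_of_multiset ?m"
    proof -
      have "?g w = n \<longleftrightarrow> mset w = ?m" for w
        by (metis count_inject count_word_of)
      then show ?thesis
        using n by (auto simp: permutations_of_multiset_def length_eq_sum_count count_word_of)
    qed
    have "n j = 0" if "j \<notin># ?m" for j
      using that unfolding not_in_iff count_word_of .
    then have "(\<Prod>j\<in>set_mset ?m. fact (count ?m j)) = (\<Prod>j\<in>UNIV. fact (n j) :: nat)"
      unfolding count_word_of
      by (intro prod.mono_neutral_left) auto
    moreover have "size ?m = N"
      using n length_eq_sum_count[of "word_of n"] by (simp add: count_word_of)
    ultimately have card: "card (permutations_of_multiset ?m) * (\<Prod>j\<in>UNIV. fact (n j)) = fact N"
      using card_permutations_of_multiset_aux[of ?m] by metis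
    have pos: "(\<Prod>j\<in>UNIV. fact (n j) :: nat) > 0" by (simp add: prod_pos)
    have "real (card (permutations_of_multiset ?m)) * real (\<Prod>j\<in>UNIV. fact (n j)) = real (fact N)"
      unfolding of_nat_mult[symmetric] card by simp
    then have card': "real (card (permutations_of_multiset ?m)) = real (fact N) / real (\<Prod>j\<in>UNIV. fact (n j))"
      using pos by (simp add: eq_divide_eq del: of_nat_prod of_nat_fact)
    have "(\<Sum>w\<in>{w \<in> ?S. ?g w = n}. h (fold A w x)) = (\<Sum>w\<in>permutations_of_multiset ?m. h (mpow A n x))"
      unfolding set mpow_eq_fold
      by (intro sum.cong refl arg_cong[of _ _ h] fold_commute_mset[OF A comm x])
        (auto simp: permutations_of_multiset_def)
    then show "(\<Sum>w\<in>{w \<in> ?S. ?g w = n}. h (fold A w x)) =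
        real (fact N) / real (\<Prod>j\<in>UNIV. fact (n j)) * h (mpow A n x)"
      using card' by simp
  qed
  finally show ?thesis by simp
qed

section \<open>Isometric output pairs\<close>

text \<open>Isolates the cross term. With \<open>re_mult_cnj_eq_0\<close>, a norm identity valid for
  all scalars \<open>c\<close> becomes an identity of inner products.\<close>

lemma (in hilb) nrm_polar:
  assumes "x \<in> V" "y \<in> V"
  shows "(nrm (x + c *\<^sub>C y))\<^sup>2 - (nrm (x + (- c) *\<^sub>C y))\<^sup>2 = 4 * Re (cnj c * ip x y)"
  using assms by (simp add: nrm_add_sq nrm_scale ip_scale_right)

lemma re_mult_cnj_eq_0:
  assumes "\<And>c. Re (cnj c * q) = 0"
  shows "q = 0"
  using assms[of 1] assms[of \<i>] by (simp add: complex_eq_iff)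

text \<open>The isometry is stated through norms, the form that is iterated below;
  \<open>isometric_output_pair_iff\<close> relates it to the operator identity.\<close>

locale isopair = X: hilb X ipX + Y: rkhs Y ipY dim
  for X :: "'x::cvector set" and ipX and Y :: "'y::cvector set" and ipY
    and dim :: "'d::finite itself" +
  fixes A :: "'d \<Rightarrow> 'x \<Rightarrow> 'x" and C :: "'x \<Rightarrow> 'y"
  assumes A_bounded: "bounded_op X ipX X ipX (A j)"
    and C_bounded: "bounded_op X ipX Y ipY C"
    and isometric: "x \<in> X \<Longrightarrow> (\<Sum>j\<in>UNIV. (X.nrm (A j x))\<^sup>2) + (Y.nrm (C x))\<^sup>2 = (X.nrm x)\<^sup>2"

sublocale isopair \<subseteq> A: hop X ipX X ipX "A j" for j
  by unfold_locales (rule A_bounded)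

sublocale isopair \<subseteq> C: hop X ipX Y ipY C
  by unfold_locales (rule C_bounded)

context isopair
begin

abbreviation Aa :: "'d \<Rightarrow> 'x \<Rightarrow> 'x" where "Aa j \<equiv> hadj X ipX X ipX (A j)"
abbreviation Ca :: "'y \<Rightarrow> 'x" where "Ca \<equiv> hadj X ipX Y ipY C"

text \<open>\<open>Z l\<close> is the product Z(l)A of the realization formula, not the row Z(l)
  alone; \<open>Za z\<close> turns out to be its adjoint A^* Z(z)^*.\<close>

definition Z :: "complex^'d \<Rightarrow> 'x \<Rightarrow> 'x" where
  "Z l x = (\<Sum>j\<in>UNIV. (l $ j) *\<^sub>C A j x)"

definition Za :: "complex^'d \<Rightarrow> 'x \<Rightarrow> 'x" where
  "Za z x = (\<Sum>j\<in>UNIV. cnj (z $ j) *\<^sub>C Aa j x)"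

lemma Z_mem [simp]: "x \<in> X \<Longrightarrow> Z l x \<in> X"
  by (auto simp: Z_def intro!: X.sum_mem)

lemma Za_mem [simp]: "x \<in> X \<Longrightarrow> Za z x \<in> X"
  by (auto simp: Za_def intro!: X.sum_mem)

text \<open>Cauchy-Schwarz over the coordinates, and the column of the \<open>A j\<close> is a
  contraction. On the ball \<open>norm l < 1\<close>, which makes both I - Z(l)A and its adjoint
  invertible.\<close>

lemma Z_nrm:
  assumes "x \<in> X"
  shows "X.nrm (Z l x) \<le> norm l * X.nrm x"
proof -
  have "X.nrm (Z l x) \<le> (\<Sum>j\<in>UNIV. X.nrm ((l $ j) *\<^sub>C A j x))"
    unfolding Z_def using assms by (intro X.nrm_sum_le) simp
  also have "\<dots> = (\<Sum>j\<in>UNIV. \<bar>cmod (l $ j)\<bar> * \<bar>X.nrm (A j x)\<bar>)"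
    using assms by (simp add: X.nrm_scale)
  also have "\<dots> \<le> norm l * L2_set (\<lambda>j. X.nrm (A j x)) UNIV"
    unfolding norm_vec_def by (rule L2_set_mult_ineq)
  also have "L2_set (\<lambda>j. X.nrm (A j x)) UNIV \<le> X.nrm x"
    unfolding L2_set_def
  proof (rule real_le_lsqrt)
    show "(\<Sum>j\<in>UNIV. (X.nrm (A j x))\<^sup>2) \<le> (X.nrm x)\<^sup>2"
      using isometric[OF assms] zero_le_power2[of "Y.nrm (C x)"] by linarith
  qed (use assms in \<open>auto simp: sum_nonneg\<close>)
  finally show ?thesis by (simp add: mult_left_mono)
qed

lemma Z_hop: "hop X ipX X ipX (Z l)"
proof -
  have "Z l (x + y) = Z l x + Z l y" if "x \<in> X" "y \<in> X" for x y
    using that by (simp add: Z_def A.add scaleC_add_right sum.distrib)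
  moreover have "Z l (c *\<^sub>C x) = c *\<^sub>C Z l x" if "x \<in> X" for x c
    using that by (simp add: Z_def A.scale scaleC_sum_right scaleC_scaleC mult.commute)
  ultimately have "bounded_op X ipX X ipX (Z l)"
    unfolding bounded_op_def using Z_nrm[of _ l] by (auto intro!: exI[of _ "norm l"])
  then show ?thesis using X.hilbert by (rule_tac hopI)
qed

lemma Za_eq: "x \<in> X \<Longrightarrow> hadj X ipX X ipX (Z z) x = Za z x"
  by (rule hop.adj_eqI[OF Z_hop])
    (auto simp: Z_def Za_def X.ip_sum_left X.ip_sum_right X.ip_scale_left X.ip_scale_right A.adj_ip
      intro!: X.sum_mem)

lemma Za_nrm: "x \<in> X \<Longrightarrow> X.nrm (Za z x) \<le> norm z * X.nrm x"
  using hop.adj_norm_le[OF Z_hop[of z], of "norm z" x] Z_nrm[of _ z] Za_eq[of x z] by simp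

lemma Za_hop: "hop X ipX X ipX (Za z)"
proof -
  interpret Za: hop X ipX X ipX "hadj X ipX X ipX (Z z)" by (rule hop.hop_adj[OF Z_hop])
  have "bounded_op X ipX X ipX (Za z)"
    unfolding bounded_op_def
    using Za.add Za.scale Za_nrm[of _ z] by (auto simp: Za_eq intro!: exI[of _ "norm z"])
  then show ?thesis using X.hilbert by (rule_tac hopI)
qed

definition R :: "complex^'d \<Rightarrow> 'x \<Rightarrow> 'x" where "R l = inv_I_minus X (Z l)"

text \<open>The vector whose images under Z(z)^* generate D. For a stable commuting tuple it is also
  the image of the kernel function at \<open>z\<close> under the adjoint of \<open>J\<close>, see
  \<open>J_ip_Kf\<close>.\<close>

definition xi :: "complex^'d \<Rightarrow> 'y \<Rightarrow> 'x" where "xi z y = inv_I_minus X (Za z) (Ca y)"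

lemma R_mem [simp]: "l \<in> ball_d \<Longrightarrow> x \<in> X \<Longrightarrow> R l x \<in> X"
  and R_eq: "l \<in> ball_d \<Longrightarrow> x \<in> X \<Longrightarrow> R l x - Z l (R l x) = x"
  unfolding R_def using X.inv_I_minus(1,2)[OF Z_hop[of l], of "norm l" x] Z_nrm[of _ l]
  by (auto simp: ball_d_iff)

lemma xi_mem [simp]: "z \<in> ball_d \<Longrightarrow> y \<in> Y \<Longrightarrow> xi z y \<in> X"
  and xi_eq: "z \<in> ball_d \<Longrightarrow> y \<in> Y \<Longrightarrow> xi z y - Za z (xi z y) = Ca y"
  unfolding xi_def using X.inv_I_minus(1,2)[OF Za_hop[of z], of "norm z" "Ca y"] Za_nrm[of _ z]
  by (auto simp: ball_d_iff)

lemma xi_unique: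
  "z \<in> ball_d \<Longrightarrow> y \<in> Y \<Longrightarrow> q \<in> X \<Longrightarrow> q - Za z q = Ca y \<Longrightarrow> xi z y = q"
  unfolding xi_def using X.inv_I_minus(3)[OF Za_hop[of z], of "norm z" q "Ca y"] Za_nrm[of _ z]
  by (auto simp: ball_d_iff)

lemma D_gen_eq: "D_gen X ipX Y ipY A C z y = (\<lambda>j. cnj (z $ j) *\<^sub>C xi z y)"
  by (simp add: D_gen_def xi_def Za_def[abs_def] Let_def)

lemma ip_Z: "x \<in> X \<Longrightarrow> y \<in> X \<Longrightarrow> ipX x (Za z y) = ipX (Z z x) y"
  using hop.adj_ip[OF Z_hop] by (simp add: Za_eq)

lemma C_ip_xi:
  assumes "z \<in> ball_d" "x \<in> X" "y \<in> Y"
  shows "ipY (C x) y = ipX (x - Z z x) (xi z y)"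
proof -
  have "ipY (C x) y = ipX x (xi z y - Za z (xi z y))"
    using assms by (simp add: C.adj_ip xi_eq)
  then show ?thesis using assms by (simp add: X.ip_diff_left X.ip_diff_right ip_Z)
qed

lemma CR_ip:
  assumes "z \<in> ball_d" "x \<in> X" "y \<in> Y"
  shows "ipY (C (R z x)) y = ipX x (xi z y)"
  using C_ip_xi[of z "R z x" y] assms by (simp add: R_eq)

lemma fold_A_mem [simp]: "x \<in> X \<Longrightarrow> fold A w x \<in> X"
  by (induction w arbitrary: x) auto

text \<open>The isometry relation iterated N times: the energy still in the state after N steps plus
  the energy of the outputs so far.\<close>

lemma energy:
  assumes "x \<in> X"
  shows "(\<Sum>w | length w = N. (X.nrm (fold A w x))\<^sup>2) +
    (\<Sum>w | length w < N. (Y.nrm (C (fold A w x)))\<^sup>2) = (X.nrm x)\<^sup>2"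
  using assms
proof (induction N arbitrary: x)
  case (Suc N)
  have "(\<Sum>w | length w = Suc N. (X.nrm (fold A w x))\<^sup>2) +
      (\<Sum>w | length w < Suc N. (Y.nrm (C (fold A w x)))\<^sup>2) =
      (\<Sum>j\<in>UNIV. (\<Sum>w | length w = N. (X.nrm (fold A w (A j x)))\<^sup>2) +
        (\<Sum>w | length w < N. (Y.nrm (C (fold A w (A j x))))\<^sup>2)) + (Y.nrm (C x))\<^sup>2"
    by (simp add: sum_words_Suc sum_words_less_Cons sum.distrib)
  also have "\<dots> = (X.nrm x)\<^sup>2" using Suc by (simp add: isometric)
  finally show ?case .
qed simp

text \<open>The partial expansion of <C (I - Z(z)A)^{-1} x, y> over words, with the remainder after
  N steps.\<close>

lemma telescope:
  assumes "z \<in> ball_d" "y \<in> Y" "x \<in> X"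
  shows "(\<Sum>w | length w < N. mon z w * ipY (C (fold A w x)) y) =
    ipX x (xi z y) - (\<Sum>w | length w = N. mon z w * ipX (fold A w x) (xi z y))"
  using assms(3)
proof (induction N arbitrary: x)
  case (Suc N)
  have "(\<Sum>w | length w < Suc N. mon z w * ipY (C (fold A w x)) y) = ipY (C x) y +
      (\<Sum>j\<in>UNIV. z $ j * (\<Sum>w | length w < N. mon z w * ipY (C (fold A w (A j x))) y))"
    by (simp add: sum_words_less_Cons sum_distrib_left mult.assoc)
  also have "\<dots> = ipY (C x) y + (\<Sum>j\<in>UNIV. z $ j * ipX (A j x) (xi z y)) -
      (\<Sum>j\<in>UNIV. z $ j * (\<Sum>w | length w = N. mon z w * ipX (fold A w (A j x)) (xi z y)))"
    using Suc by (simp add: right_diff_distrib sum_subtractf)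
  also have "ipY (C x) y + (\<Sum>j\<in>UNIV. z $ j * ipX (A j x) (xi z y)) = ipX x (xi z y)"
    using assms Suc.prems
    by (simp add: C_ip_xi X.ip_diff_left) (simp add: Z_def X.ip_sum_left X.ip_scale_left)
  finally show ?case by (simp add: sum_words_Suc sum_distrib_left mult.assoc)
qed simp

end

locale stable_isopair = isopair +
  assumes commutative: "commutative_tuple X A"
    and stable: "x \<in> X \<Longrightarrow> (\<lambda>N. \<Sum>w | length w = N. (X.nrm (fold A w x))\<^sup>2) \<longlonglongrightarrow> 0"
begin

text \<open>The observability operator of the output pair.\<close>

definition J :: "'a \<Rightarrow> 'c list \<Rightarrow> 'b" where "J x = (\<lambda>w. C (fold A w x))"

lemma J_mem [simp]:
  assumes x: "x \<in> X"
  shows "J x \<in> fock Y ipY"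
proof -
  have "(\<Sum>w\<in>F. (Y.nrm (J x w))\<^sup>2) \<le> (X.nrm x)\<^sup>2" if "finite F" for F
  proof (rule finite_sum_le_words)
    fix N show "(\<Sum>w | length w < N. (Y.nrm (J x w))\<^sup>2) \<le> (X.nrm x)\<^sup>2"
      unfolding energy[OF x, of N, symmetric] J_def by (simp add: sum_nonneg)
  qed (use that in auto)
  then have "J x \<in> ltwo Y ipY" using x by (intro Y.ltwo_nrm_sq_le) (auto simp: J_def)
  moreover have "symmetric (J x)"
    unfolding symmetric_def J_def
    using fold_commute_mset[OF _ commutative x] by (metis A.mem)
  ultimately show ?thesis by (simp add: fock_def)
qed

text \<open>Stability is exactly the vanishing of the state term in \<open>energy\<close>.\<close>

lemma J_nrm:
  assumes x: "x \<in> X"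
  shows "Y.F.nrm (J x) = X.nrm x"
proof -
  have "(\<lambda>N. (X.nrm x)\<^sup>2 - (\<Sum>w | length w = N. (X.nrm (fold A w x))\<^sup>2)) \<longlonglongrightarrow> (X.nrm x)\<^sup>2 - 0"
    by (intro tendsto_intros stable x)
  moreover have "(X.nrm x)\<^sup>2 - (\<Sum>w | length w = N. (X.nrm (fold A w x))\<^sup>2) =
      (\<Sum>w | length w < N. (Y.nrm (J x w))\<^sup>2)" for N
    using energy[OF x, of N] by (simp add: J_def)
  ultimately have "(\<lambda>N. \<Sum>w | length w < N. (Y.nrm (J x w))\<^sup>2) \<longlonglongrightarrow> (X.nrm x)\<^sup>2" by simp
  then have "(Y.F.nrm (J x))\<^sup>2 = (X.nrm x)\<^sup>2"
    using LIMSEQ_unique Y.fock_nrm_lim[OF J_mem[OF x]] by blast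
  then show ?thesis using x by (intro power2_eq_imp_eq[of "Y.F.nrm (J x)"]) auto
qed

lemma J_add: "x \<in> X \<Longrightarrow> y \<in> X \<Longrightarrow> J (x + y) = J x + J y"
proof -
  assume xy: "x \<in> X" "y \<in> X"
  have "fold A w (x + y) = fold A w x + fold A w y" for w
    using xy by (induction w arbitrary: x y) (auto simp: A.add)
  then show ?thesis using xy by (auto simp: J_def C.add fun_eq_iff)
qed

lemma J_scale: "x \<in> X \<Longrightarrow> J (c *\<^sub>C x) = c *\<^sub>C J x"
proof -
  assume x: "x \<in> X"
  have "fold A w (c *\<^sub>C x) = c *\<^sub>C fold A w x" for w
    using x by (induction w arbitrary: x) (auto simp: A.scale)
  then show ?thesis using x by (auto simp: J_def C.scale fun_eq_iff)
qed

lemma J_bounded: "bounded_op X ipX (fock Y ipY) (ltwo_ip ipY) J"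
  unfolding bounded_op_def by (auto simp: J_add J_scale J_nrm intro!: exI[of _ 1])

sublocale J: hop X ipX "fock Y ipY :: ('c list \<Rightarrow> 'b) set" "ltwo_ip ipY" J
  by unfold_locales (rule J_bounded)

lemma J_ip: "x \<in> X \<Longrightarrow> y \<in> X \<Longrightarrow> ltwo_ip ipY (J x) (J y) = ipX x y"
  by (simp add: Y.F.polarization X.polarization J_add[symmetric] J_scale[symmetric] J_nrm)

lemma J_adj_J: "x \<in> X \<Longrightarrow> J.adj (J x) = x"
  by (rule J.adj_eqI) (auto simp: J_ip)

text \<open>The remainder in \<open>telescope\<close> tends to 0: Cauchy-Schwarz over the words of
  length N bounds it by |z|^N |x| |xi z y|, since \<open>energy\<close> bounds the state term by
  |x|^2.\<close>

lemma J_ip_Kf: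
  assumes "z \<in> ball_d" "y \<in> Y" "x \<in> X"
  shows "ltwo_ip ipY (J x) (Kf z y) = ipX x (xi z y)"
proof -
  let ?e = "\<lambda>N. \<Sum>w | length w = N. mon z w * ipX (fold A w x) (xi z y)"
  have "?e \<longlonglongrightarrow> 0"
  proof (rule Lim_null_comparison)
    show "\<forall>\<^sub>F N in sequentially. norm (?e N) \<le> norm z ^ N * X.nrm x * X.nrm (xi z y)"
    proof (intro always_eventually allI)
      fix N
      let ?W = "{w::'c list. length w = N}"
      \<comment> \<open>The absolute values of nonnegative terms are there to match
        \<open>L2_set_mult_ineq\<close>.\<close>
      have "norm (?e N) \<le> (\<Sum>w\<in>?W. \<bar>cmod (mon z w)\<bar> * \<bar>X.nrm (fold A w x)\<bar> * X.nrm (xi z y))"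
      proof (rule sum_norm_le)
        fix w
        have "cmod (ipX (fold A w x) (xi z y)) \<le> X.nrm (fold A w x) * X.nrm (xi z y)"
          using assms by (intro X.cauchy_schwarz) auto
        then show "norm (mon z w * ipX (fold A w x) (xi z y))
            \<le> \<bar>cmod (mon z w)\<bar> * \<bar>X.nrm (fold A w x)\<bar> * X.nrm (xi z y)"
          using assms by (simp add: norm_mult mult.assoc mult_left_mono)
      qed
      also have "\<dots> \<le> L2_set (\<lambda>w. cmod (mon z w)) ?W * L2_set (\<lambda>w. X.nrm (fold A w x)) ?W * X.nrm (xi z y)"
        unfolding sum_distrib_right[symmetric] using assms
        by (intro mult_right_mono L2_set_mult_ineq) auto
      also have "\<dots> \<le> norm z ^ N * X.nrm x * X.nrm (xi z y)"
      proof (intro mult_right_mono mult_mono)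
        show "L2_set (\<lambda>w. cmod (mon z w)) ?W \<le> norm z ^ N"
          unfolding L2_set_def sum_norm_mon by (simp add: real_sqrt_power)
        show "L2_set (\<lambda>w. X.nrm (fold A w x)) ?W \<le> X.nrm x"
          unfolding L2_set_def
        proof (rule real_le_lsqrt)
          show "(\<Sum>w\<in>?W. (X.nrm (fold A w x))\<^sup>2) \<le> (X.nrm x)\<^sup>2"
            unfolding energy[OF assms(3), of N, symmetric] by (simp add: sum_nonneg)
        qed (use assms in \<open>auto simp: sum_nonneg\<close>)
      qed (use assms in auto)
      finally show "norm (?e N) \<le> norm z ^ N * X.nrm x * X.nrm (xi z y)" .
    qed
    have "(\<lambda>N. norm z ^ N * X.nrm x * X.nrm (xi z y)) \<longlonglongrightarrow> 0 * X.nrm x * X.nrm (xi z y)"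
      using assms by (intro tendsto_intros LIMSEQ_realpow_zero) (auto simp: ball_d_iff)
    then show "(\<lambda>N. norm z ^ N * X.nrm x * X.nrm (xi z y)) \<longlonglongrightarrow> 0" by simp
  qed
  then have "(\<lambda>N. ipX x (xi z y) - ?e N) \<longlonglongrightarrow> ipX x (xi z y) - 0"
    by (intro tendsto_intros)
  then have "(\<lambda>N. \<Sum>w | length w < N. mon z w * ipY (J x w) y) \<longlonglongrightarrow> ipX x (xi z y)"
    using telescope[OF assms] by (simp add: J_def)
  then show ?thesis
    using LIMSEQ_unique Y.ip_Kf_lim[OF J_mem[OF assms(3)] assms(1,2)] by blast
qed

end

section \<open>From realizations to inner multipliers\<close>

lemma scaleC_diff_left: "(a - b) *\<^sub>C (x::'a::cvector) = a *\<^sub>C x - b *\<^sub>C x"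
  using scaleC_add_left[of a "-b" x] by (simp add: scaleC_minus_left)

text \<open>Caratheodory's form of differentiability: slopes \<open>g j\<close> that are continuous
  at \<open>l\<close>, so no separate remainder has to be estimated. The resolvent identity supplies
  such slopes for a realized function.\<close>

lemma has_derivative_caratheodory:
  fixes f :: "complex^'d::finite \<Rightarrow> complex"
  assumes ev: "\<forall>\<^sub>F x in at l. f x - f l = (\<Sum>j\<in>UNIV. (x $ j - l $ j) * g j x)"
    and lim: "\<And>j. (g j \<longlongrightarrow> g j l) (at l)"
  shows "(f has_derivative (\<lambda>h. \<Sum>j\<in>UNIV. h $ j * g j l)) (at l)"
  unfolding has_derivative_iff_norm
proof
  show "bounded_linear (\<lambda>h::complex^'d. \<Sum>j\<in>UNIV. h $ j * g j l)"
    by (intro bounded_linear_sum bounded_linear_compose[OF bounded_linear_mult_left] bounded_linear_vec_nth)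
  show "((\<lambda>x. norm (f x - f l - (\<Sum>j\<in>UNIV. (x - l) $ j * g j l)) / norm (x - l)) \<longlongrightarrow> 0) (at l)"
  proof (rule Lim_null_comparison)
    have "norm (f x - f l - (\<Sum>j\<in>UNIV. (x - l) $ j * g j l)) / norm (x - l) \<le> (\<Sum>j\<in>UNIV. norm (g j x - g j l))"
      if x: "f x - f l = (\<Sum>j\<in>UNIV. (x $ j - l $ j) * g j x)" for x
    proof -
      have "f x - f l - (\<Sum>j\<in>UNIV. (x - l) $ j * g j l) = (\<Sum>j\<in>UNIV. (x - l) $ j * (g j x - g j l))"
        unfolding x by (simp add: sum_subtractf[symmetric] algebra_simps)
      also have "norm \<dots> \<le> (\<Sum>j\<in>UNIV. norm (x - l) * norm (g j x - g j l))"
      proof (rule sum_norm_le)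
        fix j
        show "norm ((x - l) $ j * (g j x - g j l)) \<le> norm (x - l) * norm (g j x - g j l)"
          unfolding norm_mult by (rule mult_right_mono[OF Finite_Cartesian_Product.norm_nth_le]) simp
      qed
      finally have "norm (f x - f l - (\<Sum>j\<in>UNIV. (x - l) $ j * g j l)) \<le> norm (x - l) * (\<Sum>j\<in>UNIV. norm (g j x - g j l))"
        by (simp add: sum_distrib_left)
      then show ?thesis
        by (cases "x = l") (auto simp: divide_le_eq mult.commute sum_nonneg)
    qed
    then show "\<forall>\<^sub>F x in at l. norm (norm (f x - f l - (\<Sum>j\<in>UNIV. (x - l) $ j * g j l)) / norm (x - l))
        \<le> (\<Sum>j\<in>UNIV. norm (g j x - g j l))"
      using ev by (auto elim!: eventually_mono)
    have "((\<lambda>x. \<Sum>j\<in>UNIV. norm (g j x - g j l)) \<longlongrightarrow> (\<Sum>j::'d\<in>UNIV. 0)) (at l)"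
      using lim by (intro tendsto_sum tendsto_norm_zero) (simp add: LIM_zero)
    then show "((\<lambda>x. \<Sum>j\<in>UNIV. norm (g j x - g j l)) \<longlongrightarrow> 0) (at l)" by simp
  qed
qed

lemma sum_hop_two_terms:
  assumes T: "\<forall>j. hop V ipV W ipW (T j)" and "a \<in> V" "b \<in> V"
  shows "(\<Sum>j\<in>I. T j (p j *\<^sub>C a + c *\<^sub>C (q j *\<^sub>C b))) =
    (\<Sum>j\<in>I. p j *\<^sub>C T j a) + c *\<^sub>C (\<Sum>j\<in>I. q j *\<^sub>C T j b)"
proof -
  interpret hop V ipV W ipW "T j" for j using T by blast
  show ?thesis
    using assms(2,3) by (simp add: add scale sum.distrib scaleC_sum_right)
qed

locale weak_realization =
  stable_isopair X ipX Y ipY dim A C + multiplier U ipU Y ipY dim S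
  for X :: "'x::cvector set" and ipX and Y :: "'y::cvector set" and ipY
    and dim :: "'d::finite itself" and A C
    and U :: "'u::cvector set" and ipU and S +
  fixes B :: "'d \<Rightarrow> 'u \<Rightarrow> 'x" and D :: "'u \<Rightarrow> 'y"
  assumes B_bounded: "bounded_op U ipU X ipX (B j)"
    and D_bounded: "bounded_op U ipU Y ipY D"
    and realization: "l \<in> ball_d \<Longrightarrow> u \<in> U \<Longrightarrow> S l u = D u + C (R l (\<Sum>j\<in>UNIV. (l $ j) *\<^sub>C B j u))"
    and coisometric: "w \<in> D_space X ipX Y ipY A C \<Longrightarrow> y \<in> Y \<Longrightarrow>
        (X.nrm ((\<Sum>j\<in>UNIV. Aa j (w j)) + Ca y))\<^sup>2
        + (U.nrm ((\<Sum>j\<in>UNIV. hadj U ipU X ipX (B j) (w j)) + hadj U ipU Y ipY D y))\<^sup>2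
        = (hnorm_d ipX w)\<^sup>2 + (Y.nrm y)\<^sup>2"

sublocale weak_realization \<subseteq> B: hop U ipU X ipX "B j" for j
  by unfold_locales (rule B_bounded)

sublocale weak_realization \<subseteq> D: hop U ipU Y ipY D
  by unfold_locales (rule D_bounded)

context weak_realization
begin

abbreviation Ba :: "'d \<Rightarrow> 'x \<Rightarrow> 'u" where "Ba j \<equiv> hadj U ipU X ipX (B j)"
abbreviation Da :: "'y \<Rightarrow> 'u" where "Da \<equiv> hadj U ipU Y ipY D"

definition b :: "'u \<Rightarrow> complex^'d \<Rightarrow> 'x" where
  "b u l = (\<Sum>j\<in>UNIV. (l $ j) *\<^sub>C B j u)"

lemma b_mem [simp]: "u \<in> U \<Longrightarrow> b u l \<in> X"
  by (auto simp: b_def intro!: X.sum_mem)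

text \<open>The adjoint of the realization formula: S(z)^* y is the second component of the adjoint
  connecting operator at (Z(z)^* xi z y, y). The first component is \<open>xi z y\<close> itself, by
  \<open>xi_eq\<close>.\<close>

lemma Sa_eq:
  assumes "z \<in> ball_d" "y \<in> Y"
  shows "Sa z y = Da y + (\<Sum>j\<in>UNIV. cnj (z $ j) *\<^sub>C Ba j (xi z y))"
proof (rule hop.adj_eqI[OF hop_S])
  have m: "(\<Sum>j\<in>UNIV. cnj (z $ j) *\<^sub>C Ba j (xi z y)) \<in> U"
    using assms by (auto intro!: U.sum_mem)
  then show "Da y + (\<Sum>j\<in>UNIV. cnj (z $ j) *\<^sub>C Ba j (xi z y)) \<in> U" using assms by simp
  fix u assume u: "u \<in> U"
  have "ipY (S z u) y = ipY (D u) y + ipX (b u z) (xi z y)"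
    using assms u by (simp add: realization b_def[symmetric] Y.ip_add_left CR_ip)
  also have "ipX (b u z) (xi z y) = ipU u (\<Sum>j\<in>UNIV. cnj (z $ j) *\<^sub>C Ba j (xi z y))"
    using assms u
    by (simp add: b_def X.ip_sum_left U.ip_sum_right X.ip_scale_left U.ip_scale_right B.adj_ip)
  finally show "ipY (S z u) y = ipU u (Da y + (\<Sum>j\<in>UNIV. cnj (z $ j) *\<^sub>C Ba j (xi z y)))"
    using assms u m by (simp add: U.ip_add_right D.adj_ip)
qed (use assms in auto)

text \<open>Two generators and one scalar are all that polarization of the coisometry condition
  requires.\<close>

lemma two_term_mem_D_space:
  assumes "z \<in> ball_d" "l \<in> ball_d" "y \<in> Y" "x \<in> Y"
  shows "(\<lambda>j. cnj (z $ j) *\<^sub>C xi z y + c *\<^sub>C (cnj (l $ j) *\<^sub>C xi l x)) \<in> D_space X ipX Y ipY A C"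
    (is "?w \<in> _")
  unfolding D_space_def
proof (intro CollectI conjI allI impI)
  show "?w j \<in> X" for j using assms by simp
  fix e :: real assume "e > 0"
  let ?c = "\<lambda>i::nat. if i = 0 then 1 else c"
  let ?z = "\<lambda>i::nat. if i = 0 then z else l"
  let ?y = "\<lambda>i::nat. if i = 0 then y else x"
  have "{..<2::nat} = {0, 1}" by auto
  then have "?w - (\<Sum>i<(2::nat). ?c i *\<^sub>C D_gen X ipX Y ipY A C (?z i) (?y i)) = 0"
    by (simp add: D_gen_eq fun_eq_iff scaleC_one)
  then have "hnorm_d ipX (?w - (\<Sum>i<(2::nat). ?c i *\<^sub>C D_gen X ipX Y ipY A C (?z i) (?y i))) < e"
    using \<open>e > 0\<close> by (simp add: hnorm_d_def)
  moreover have "\<forall>i<2. ?z i \<in> ball_d \<and> ?y i \<in> Y" using assms by auto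
  ultimately show "\<exists>n c \<zeta> y. (\<forall>i<(n::nat). \<zeta> i \<in> ball_d \<and> y i \<in> Y) \<and>
      hnorm_d ipX (?w - (\<Sum>i<n. c i *\<^sub>C D_gen X ipX Y ipY A C (\<zeta> i) (y i))) < e"
    by (intro exI[of _ "2::nat"] exI[of _ ?c] exI[of _ ?z] exI[of _ ?y] conjI)
qed

text \<open>The adjoint connecting operator sends (Z(z)^* xi z y, y) to (xi z y, S(z)^* y) and
  preserves norms of combinations of two such vectors; polarization in \<open>c\<close> gives
  preservation of their inner product.\<close>

lemma kernel_identity:
  assumes z: "z \<in> ball_d" and l: "l \<in> ball_d" and y: "y \<in> Y" and x: "x \<in> Y"
  shows "ipX (xi z y) (xi l x) + ipU (Sa z y) (Sa l x) =
    cinner_d l z * ipX (xi z y) (xi l x) + ipY y x"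
proof -
  let ?a = "xi z y" and ?b = "xi l x"
  have m: "?a \<in> X" "?b \<in> X" "Sa z y \<in> U" "Sa l x \<in> U" using assms by auto
  have key: "(X.nrm (?a + c *\<^sub>C ?b))\<^sup>2 + (U.nrm (Sa z y + c *\<^sub>C Sa l x))\<^sup>2 =
      (\<Sum>j\<in>UNIV. (X.nrm (cnj (z $ j) *\<^sub>C ?a + c *\<^sub>C (cnj (l $ j) *\<^sub>C ?b)))\<^sup>2) + (Y.nrm (y + c *\<^sub>C x))\<^sup>2" for c
  proof -
    have "(\<Sum>j\<in>UNIV. Aa j (cnj (z $ j) *\<^sub>C ?a + c *\<^sub>C (cnj (l $ j) *\<^sub>C ?b))) + Ca (y + c *\<^sub>C x)
        = ?a + c *\<^sub>C ?b"
    proof -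
      have e: "Za z ?a + Ca y = ?a" "Za l ?b + Ca x = ?b"
        unfolding xi_eq[OF z y, symmetric] xi_eq[OF l x, symmetric] by simp_all
      have "(Za z ?a + c *\<^sub>C Za l ?b) + (Ca y + c *\<^sub>C Ca x) = (Za z ?a + Ca y) + c *\<^sub>C (Za l ?b + Ca x)"
        by (simp add: scaleC_add_right algebra_simps)
      then have "(Za z ?a + c *\<^sub>C Za l ?b) + (Ca y + c *\<^sub>C Ca x) = ?a + c *\<^sub>C ?b"
        unfolding e .
      moreover have "Ca (y + c *\<^sub>C x) = Ca y + c *\<^sub>C Ca x"
        using y x by (simp add: hop.add[OF C.hop_adj] hop.scale[OF C.hop_adj])
      ultimately show ?thesis 
        using sum_hop_two_terms[of X ipX X ipX Aa ?a ?b] A.hop_adj m by (simp add: Za_def)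
    qed
    moreover have "(\<Sum>j\<in>UNIV. Ba j (cnj (z $ j) *\<^sub>C ?a + c *\<^sub>C (cnj (l $ j) *\<^sub>C ?b))) + Da (y + c *\<^sub>C x)
        = Sa z y + c *\<^sub>C Sa l x"
      using sum_hop_two_terms[of X ipX U ipU Ba ?a ?b] B.hop_adj m x y z l
      by (simp add: Sa_eq hop.add[OF D.hop_adj] hop.scale[OF D.hop_adj] scaleC_add_right)
    moreover have "(hnorm_d ipX w)\<^sup>2 = (\<Sum>j\<in>UNIV. (X.nrm (w j))\<^sup>2)" for w
      by (simp add: hnorm_d_def sum_nonneg)
    ultimately show ?thesis
      using coisometric[OF two_term_mem_D_space[OF assms, of c], of "y + c *\<^sub>C x"] x y by simp
  qed
  have "Re (cnj c * (ipX ?a ?b + ipU (Sa z y) (Sa l x) - (cinner_d l z * ipX ?a ?b + ipY y x))) = 0" for c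
  proof -
    let ?n = "\<lambda>c j. (X.nrm (cnj (z $ j) *\<^sub>C ?a + c *\<^sub>C (cnj (l $ j) *\<^sub>C ?b)))\<^sup>2"
    have "(\<Sum>j\<in>UNIV. ?n c j) - (\<Sum>j\<in>UNIV. ?n (- c) j) =
        (\<Sum>j\<in>UNIV. 4 * Re (cnj c * ipX (cnj (z $ j) *\<^sub>C ?a) (cnj (l $ j) *\<^sub>C ?b)))"
      unfolding sum_subtractf[symmetric] using m by (intro sum.cong refl X.nrm_polar) auto
    then have "Re (cnj c * ipX ?a ?b) + Re (cnj c * ipU (Sa z y) (Sa l x)) =
        (\<Sum>j\<in>UNIV. Re (cnj c * ipX (cnj (z $ j) *\<^sub>C ?a) (cnj (l $ j) *\<^sub>C ?b))) + Re (cnj c * ipY y x)"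
      unfolding sum_distrib_left[symmetric]
      using key[of c] key[of "-c"] X.nrm_polar[OF m(1,2), of c] U.nrm_polar[OF m(3,4), of c]
        Y.nrm_polar[OF y x, of c] by linarith
    also have "(\<Sum>j\<in>UNIV. Re (cnj c * ipX (cnj (z $ j) *\<^sub>C ?a) (cnj (l $ j) *\<^sub>C ?b))) =
        Re (cnj c * (cinner_d l z * ipX ?a ?b))"
    proof -
      have "(\<Sum>j\<in>UNIV. ipX (cnj (z $ j) *\<^sub>C ?a) (cnj (l $ j) *\<^sub>C ?b)) = cinner_d l z * ipX ?a ?b"
        using m by (simp add: X.ip_scale_left X.ip_scale_right cinner_d_def sum_distrib_right mult_ac)
      then show ?thesis
        unfolding Re_sum[symmetric] sum_distrib_left[symmetric] by simp
    qed
    finally show ?thesis by (simp add: algebra_simps)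
  qed
  then have "ipX ?a ?b + ipU (Sa z y) (Sa l x) - (cinner_d l z * ipX ?a ?b + ipY y x) = 0"
    by (rule re_mult_cnj_eq_0)
  then show ?thesis by simp
qed

lemma kernel_identity':
  assumes "z \<in> ball_d" "l \<in> ball_d" "y \<in> Y" "x \<in> Y"
  shows "kd l z * ipU (Sa z y) (Sa l x) + ipX (xi z y) (xi l x) = kd l z * ipY y x"
proof -
  have "1 - cinner_d l z \<noteq> 0"
    using cinner_d_less_1[OF assms(2,1)] by auto
  then show ?thesis
    using kernel_identity[OF assms] by (simp add: kd_def field_simps)
qed

text \<open>By \<open>kernel_identity'\<close>, passing from the vectors y_i to S^* y_i lowers the
  kernel form by |sum_i xi (z_i) y_i|^2, so the bound for f is inherited by S f.\<close>

lemma S_is_contractive: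
  assumes f: "in_Hkd U ipU f"
  shows "in_Hkd Y ipY (mult_op S f) \<and> Hkd_norm Y ipY (mult_op S f) \<le> Hkd_norm U ipU f"
proof -
  obtain g where g: "U.rkrep f g" using f[unfolded U.in_Hkd_iff] by blast
  have "rk_bound Y ipY (mult_op S f) ((U.F.nrm g)\<^sup>2)"
    unfolding rk_bound_def
  proof (intro allI impI)
    fix n :: nat and \<zeta> :: "nat \<Rightarrow> complex^'d" and y
    assume *: "\<forall>i<n. \<zeta> i \<in> ball_d \<and> y i \<in> Y"
    let ?s = "\<lambda>i. Sa (\<zeta> i) (y i)"
    have "(\<Sum>i<n. ipY (mult_op S f (\<zeta> i)) (y i)) = (\<Sum>i<n. ipU (f (\<zeta> i)) (?s i))"
      using * U.rkrep_val[OF g] by (auto intro!: sum.cong simp: mult_op_def Sa_ip)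
    also have "(cmod \<dots>)\<^sup>2 \<le> (U.F.nrm g)\<^sup>2 * Re (\<Sum>i<n. \<Sum>j<n. kd (\<zeta> j) (\<zeta> i) * ipU (?s i) (?s j))"
      using U.rk_bound_rkrep[OF g, unfolded rk_bound_def, rule_format, of n \<zeta> ?s] * by simp
    also have "\<dots> \<le> (U.F.nrm g)\<^sup>2 * Re (\<Sum>i<n. \<Sum>j<n. kd (\<zeta> j) (\<zeta> i) * ipY (y i) (y j))"
    proof (rule mult_left_mono)
      have m: "xi (\<zeta> i) (y i) \<in> X" if "i \<in> {..<n}" for i using * that by simp
      have sm: "(\<Sum>i<n. xi (\<zeta> i) (y i)) \<in> X" by (rule X.sum_mem) (rule m)
      have "(\<Sum>i<n. \<Sum>j<n. kd (\<zeta> j) (\<zeta> i) * ipY (y i) (y j)) =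
          (\<Sum>i<n. \<Sum>j<n. kd (\<zeta> j) (\<zeta> i) * ipU (?s i) (?s j) + ipX (xi (\<zeta> i) (y i)) (xi (\<zeta> j) (y j)))"
        using * by (intro sum.cong refl kernel_identity'[symmetric]) auto
      also have "\<dots> = (\<Sum>i<n. \<Sum>j<n. kd (\<zeta> j) (\<zeta> i) * ipU (?s i) (?s j)) +
          ipX (\<Sum>i<n. xi (\<zeta> i) (y i)) (\<Sum>i<n. xi (\<zeta> i) (y i))"
      proof -
        have "ipX (\<Sum>i<n. xi (\<zeta> i) (y i)) (\<Sum>i<n. xi (\<zeta> i) (y i)) =
            (\<Sum>i<n. \<Sum>j<n. ipX (xi (\<zeta> i) (y i)) (xi (\<zeta> j) (y j)))"
          using sm m by (subst X.ip_sum_left) (auto intro!: sum.cong X.ip_sum_right)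
        then show ?thesis by (simp add: sum.distrib)
      qed
      finally show "Re (\<Sum>i<n. \<Sum>j<n. kd (\<zeta> j) (\<zeta> i) * ipU (?s i) (?s j))
          \<le> Re (\<Sum>i<n. \<Sum>j<n. kd (\<zeta> j) (\<zeta> i) * ipY (y i) (y j))"
        using X.ip_self_nonneg[OF sm] by simp
    qed simp
    finally show "(cmod (\<Sum>i<n. ipY (mult_op S f (\<zeta> i)) (y i)))\<^sup>2
        \<le> (U.F.nrm g)\<^sup>2 * Re (\<Sum>i<n. \<Sum>j<n. kd (\<zeta> j) (\<zeta> i) * ipY (y i) (y j))" .
  qed
  moreover have "mult_op S f l \<in> Y" if "l \<in> ball_d" for l
    using that U.rkrep_val[OF g] by (simp add: mult_op_def)
  ultimately obtain h where h: "Y.rkrep (mult_op S f) h" "(Y.F.nrm h)\<^sup>2 \<le> (U.F.nrm g)\<^sup>2"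
    using Y.rk_bound_imp_rkrep[of "mult_op S f" "(U.F.nrm g)\<^sup>2"] by auto
  then have "Y.F.nrm h \<le> U.F.nrm g" using g by (auto intro: power2_le_imp_le)
  then show ?thesis
    using h(1) Y.Hkd_norm_rkrep[OF h(1)] U.Hkd_norm_rkrep[OF g] Y.in_Hkd_iff by auto
qed

text \<open>A resolvent-type identity writes the increment of <S(m) u, y> from \<open>l\<close> as
  sum_j (m_j - l_j) g_j(m). The slopes are continuous because the state \<open>x m\<close> is
  Lipschitz near \<open>l\<close>.\<close>

lemma S_holomorphic: "op_holomorphic U ipU Y ipY S"
  unfolding op_holomorphic_def
proof (intro conjI ballI)
  show "bounded_op U ipU Y ipY (S l)" if "l \<in> ball_d" for l by (rule S_bounded[OF that])
  fix u y assume u: "u \<in> U" and y: "y \<in> Y"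
  show "holomorphic_d (\<lambda>l. ipY (S l u) y) ball_d"
    unfolding holomorphic_d_def
  proof
    fix l :: "complex^'d" assume l: "l \<in> ball_d"
    define x where "x m = R m (b u m)" for m
    have xX: "x m \<in> X" and x_eq: "x m - Z m (x m) = b u m" if "m \<in> ball_d" for m
      using that u by (auto simp: x_def R_eq)
    define \<xi> where "\<xi> = xi l y"
    have \<xi>: "\<xi> \<in> X" using l y by (simp add: \<xi>_def)
    define g where "g j m = ipX (A j (x m) + B j u) \<xi>" for j m
    have diff: "b u m - b u l + (Z m v - Z l v) = (\<Sum>j\<in>UNIV. (m $ j - l $ j) *\<^sub>C (A j v + B j u))" for m v
      by (simp add: b_def Z_def sum_subtractf[symmetric] sum.distrib[symmetric] scaleC_diff_left
          scaleC_add_right algebra_simps)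
    \<comment> \<open>The output is expressed through the fixed vector \<open>xi l y\<close> even at
      the point \<open>m\<close>, so only \<open>x m\<close> varies.\<close>
    have f_eq: "ipY (S m u) y = ipY (D u) y + ipX (x m - Z l (x m)) \<xi>" if m: "m \<in> ball_d" for m
      using m u y l by (simp add: realization b_def[symmetric] x_def[symmetric] Y.ip_add_left xX
          C_ip_xi[OF l xX[OF m] y] \<xi>_def)
    have split: "ipY (S m u) y - ipY (S l u) y = (\<Sum>j\<in>UNIV. (m $ j - l $ j) * g j m)" if m: "m \<in> ball_d" for m
    proof -
      have "x m - Z l (x m) - (x l - Z l (x l)) = b u m - b u l + (Z m (x m) - Z l (x m))"
        using x_eq[OF m] x_eq[OF l] by (metis (no_types, lifting) add_diff_cancel_left' add_diff_eq diff_add_eq diff_diff_eq2)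
      also have "\<dots> = (\<Sum>j\<in>UNIV. (m $ j - l $ j) *\<^sub>C (A j (x m) + B j u))" by (rule diff)
      finally have "ipX (x m - Z l (x m)) \<xi> - ipX (x l - Z l (x l)) \<xi> =
          ipX (\<Sum>j\<in>UNIV. (m $ j - l $ j) *\<^sub>C (A j (x m) + B j u)) \<xi>"
        using X.ip_diff_left[of "x m - Z l (x m)" "x l - Z l (x l)" \<xi>] xX[OF m] xX[OF l] \<xi> by simp
      also have "\<dots> = (\<Sum>j\<in>UNIV. (m $ j - l $ j) * g j m)"
        using xX[OF m] u \<xi> by (simp add: X.ip_sum_left X.ip_scale_left g_def)
      finally show ?thesis by (simp add: f_eq m l)
    qed
    \<comment> \<open>For d = x m - x l, the difference d - Z m d equals sum_j (m_j - l_j)(A_j x_l +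
      B_j u), and its norm is at least (1 - |m|) |d|. The resulting bound vanishes at
      \<open>m = l\<close>.\<close>
    define K where "K m = (\<Sum>j\<in>UNIV. cmod (m $ j - l $ j) * X.nrm (A j (x l) + B j u)) / (1 - norm m)" for m
    have x_lip: "X.nrm (x m - x l) \<le> K m" if m: "m \<in> ball_d" for m
    proof -
      interpret Zm: hop X ipX X ipX "Z m" by (rule Z_hop)
      let ?d = "x m - x l"
      have d: "?d \<in> X" using xX m l by simp
      have "?d - Z m ?d = (x m - Z m (x m)) - (x l - Z l (x l)) + (Z m (x l) - Z l (x l))"
        using xX m l by (simp add: Zm.diff)
      also have "\<dots> = (\<Sum>j\<in>UNIV. (m $ j - l $ j) *\<^sub>C (A j (x l) + B j u))"
        unfolding x_eq[OF m] x_eq[OF l] by (rule diff)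
      finally have eq: "?d - Z m ?d = (\<Sum>j\<in>UNIV. (m $ j - l $ j) *\<^sub>C (A j (x l) + B j u))" .
      have "X.nrm ?d \<le> X.nrm (?d - Z m ?d) + X.nrm (Z m ?d)"
        using X.nrm_triangle[of "?d - Z m ?d" "Z m ?d"] d by simp
      then have "(1 - norm m) * X.nrm ?d \<le> X.nrm (?d - Z m ?d)"
        using Z_nrm[OF d, of m] by (simp add: algebra_simps)
      also have "\<dots> \<le> (\<Sum>j\<in>UNIV. X.nrm ((m $ j - l $ j) *\<^sub>C (A j (x l) + B j u)))"
        unfolding eq using xX[OF l] u by (intro X.nrm_sum_le) simp
      also have "\<dots> = (\<Sum>j\<in>UNIV. cmod (m $ j - l $ j) * X.nrm (A j (x l) + B j u))"
        using xX[OF l] u by (simp add: X.nrm_scale)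
      finally show ?thesis
        using m by (simp add: K_def ball_d_iff le_divide_eq mult.commute)
    qed
    have evb: "\<forall>\<^sub>F m in at l. m \<in> ball_d"
      using eventually_at_topological open_ball_d l by blast
    have K0: "(K \<longlongrightarrow> 0) (at l)"
    proof -
      have "(K \<longlongrightarrow> (\<Sum>j\<in>UNIV. cmod (l $ j - l $ j) * X.nrm (A j (x l) + B j u)) / (1 - norm l)) (at l)"
        unfolding K_def using l by (intro tendsto_intros) (auto simp: ball_d_iff)
      then show ?thesis by simp
    qed
    have glim: "(g j \<longlongrightarrow> g j l) (at l)" for j
    proof -
      have "((\<lambda>m. g j m - g j l) \<longlongrightarrow> 0) (at l)"
      proof (rule Lim_null_comparison)
        show "\<forall>\<^sub>F m in at l. norm (g j m - g j l) \<le> K m * X.nrm \<xi>"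
          using evb
        proof eventually_elim
          case (elim m)
          have d: "x m - x l \<in> X" using xX elim l by simp
          have "g j m - g j l = ipX (A j (x m - x l)) \<xi>"
            using xX elim l u \<xi> by (simp add: g_def X.ip_diff_left[symmetric] A.diff)
          also have "cmod \<dots> \<le> X.nrm (A j (x m - x l)) * X.nrm \<xi>"
            using d \<xi> by (intro X.cauchy_schwarz) auto
          also have "\<dots> \<le> K m * X.nrm \<xi>"
          proof (rule mult_right_mono)
            have "(X.nrm (A j (x m - x l)))\<^sup>2 \<le> (\<Sum>j\<in>UNIV. (X.nrm (A j (x m - x l)))\<^sup>2)"
              by (rule member_le_sum) auto
            also have "\<dots> \<le> (X.nrm (x m - x l))\<^sup>2"
              using isometric[OF d] zero_le_power2[of "Y.nrm (C (x m - x l))"] by linarith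
            finally have "X.nrm (A j (x m - x l)) \<le> X.nrm (x m - x l)"
              using d by (auto intro: power2_le_imp_le)
            then show "X.nrm (A j (x m - x l)) \<le> K m" using x_lip[OF elim] by linarith
          qed (use \<xi> in simp)
          finally show ?case .
        qed
        show "((\<lambda>m. K m * X.nrm \<xi>) \<longlongrightarrow> 0) (at l)" using tendsto_mult_left_zero[OF K0] .
      qed
      then show ?thesis by (simp add: LIM_zero_iff)
    qed
    have "((\<lambda>l. ipY (S l u) y) has_derivative (\<lambda>h. \<Sum>j\<in>UNIV. h $ j * g j l)) (at l)"
      by (rule has_derivative_caratheodory[OF _ glim]) (use evb split in \<open>auto elim: eventually_mono\<close>)
    moreover have "\<forall>c v. (\<Sum>j\<in>UNIV. (\<chi> j. c * v $ j) $ j * g j l) = c * (\<Sum>j\<in>UNIV. v $ j * g j l)"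
      by (simp add: sum_distrib_left mult.assoc)
    ultimately show "\<exists>L. ((\<lambda>l. ipY (S l u) y) has_derivative L) (at l) \<and> (\<forall>c v. L (\<chi> j. c * v $ j) = c * L v)"
      by blast
  qed
qed

section \<open>The partial isometry property\<close>

sublocale contractive_multiplier U ipU Y ipY dim S
  by unfold_locales (rule S_is_contractive)

lemma M_Kf_plus_J: "z \<in> ball_d \<Longrightarrow> y \<in> Y \<Longrightarrow> M (Kf z (Sa z y)) + J (xi z y) = Kf z y"
  by (rule Y.eq_if_ip_Kf_eq)
    (auto simp: Y.F.ip_add_left M_ip J_ip_Kf U.gram Y.gram kernel_identity')

text \<open>\<open>M_Kf_plus_J\<close> is this identity on kernel functions; self-adjointness of
  both terms moves it onto \<open>h\<close>.\<close>

lemma M_M_adj_plus_J_J_adj: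
  assumes h: "h \<in> fock Y ipY"
  shows "M (M.adj h) + J (J.adj h) = h"
proof (rule Y.eq_if_ip_Kf_eq)
  fix z :: "complex^'d" and y assume z: "z \<in> ball_d" and y: "y \<in> Y"
  have "ltwo_ip ipY (M (M.adj h) + J (J.adj h)) (Kf z y) =
      ltwo_ip ipY h (M (Kf z (Sa z y)) + J (xi z y))"
    using h z y by (simp add: Y.F.ip_add_left Y.F.ip_add_right M_ip J_ip_Kf M.adj_ip' J.adj_ip')
  then show "ltwo_ip ipY (M (M.adj h) + J (J.adj h)) (Kf z y) = ltwo_ip ipY h (Kf z y)"
    using M_Kf_plus_J[OF z y] by simp
qed (use h in auto)

lemma M_adj_J:
  assumes x: "x \<in> X"
  shows "M.adj (J x) = 0"
proof -
  \<comment> \<open>Since \<open>J\<close> is isometric, the second term of the decomposition of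
    \<open>J x\<close> is already \<open>J x\<close>.\<close>
  have "M (M.adj (J x)) = 0"
    using M_M_adj_plus_J_J_adj[of "J x"] x by (simp add: J_adj_J)
  then have "ltwo_ip ipU (M.adj (J x)) (M.adj (J x)) = 0"
    using x M.adj_ip[of "M.adj (J x)" "J x"] by simp
  then show ?thesis using U.F.ip_pos[of "M.adj (J x)"] x by force
qed

theorem inner: "inner_multiplier U ipU Y ipY S"
  unfolding inner_multiplier_iff[OF S_holomorphic]
proof
  fix h :: "'d list \<Rightarrow> 'y" assume h: "h \<in> fock Y ipY"
  interpret Ma: hop "fock Y ipY" "ltwo_ip ipY" "fock U ipU" "ltwo_ip ipU" M.adj
    by (rule M.hop_adj)
  have "M (M.adj h) = h - J (J.adj h)"
    using M_M_adj_plus_J_J_adj[OF h] by (metis add_diff_cancel_right')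
  then show "M.adj (M (M.adj h)) = M.adj h"
    using h by (simp add: Ma.diff M_adj_J)
qed

end

section \<open>From inner multipliers to realizations\<close>

lemma (in hop) tendsto:
  assumes "\<And>n. s n \<in> V" "l \<in> V" "(\<lambda>n. V.nrm (s n - l)) \<longlonglongrightarrow> 0"
  shows "(\<lambda>n. W.nrm (T (s n) - T l)) \<longlonglongrightarrow> 0"
proof -
  obtain K where K: "0 \<le> K" "\<And>x. x \<in> V \<Longrightarrow> W.nrm (T x) \<le> K * V.nrm x"
    using bound by blast
  show ?thesis
  proof (rule Lim_null_comparison)
    have "norm (W.nrm (T (s n) - T l)) \<le> K * V.nrm (s n - l)" for n
      using K(2)[of "s n - l"] assms(1,2) by (simp add: diff)
    then show "\<forall>\<^sub>F n in sequentially. norm (W.nrm (T (s n) - T l)) \<le> K * V.nrm (s n - l)"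
      by simp
    show "(\<lambda>n. K * V.nrm (s n - l)) \<longlonglongrightarrow> 0" by (rule tendsto_mult_right_zero[OF assms(3)])
  qed
qed

lemma (in hop) lcomb:
  assumes "\<forall>i\<in>I. a i \<in> V" "set xs \<subseteq> UNIV \<times> I"
  shows "T (lcomb a xs) = lcomb (\<lambda>i. T (a i)) xs"
  using assms(2)
proof (induction xs)
  case (Cons p xs)
  then show ?case
    using assms(1) V.lcomb_mem[OF assms(1)] by (cases p) (auto simp: add scale)
qed simp

lemma lcomb_diff_left: "lcomb (\<lambda>i. a i - b i) xs = lcomb a xs - lcomb b xs"
  by (induction xs) (auto simp: scaleC_diff_right algebra_simps)

lemma lcomb_cong: "(\<And>i. i \<in> I \<Longrightarrow> a i = b i) \<Longrightarrow> set xs \<subseteq> UNIV \<times> I \<Longrightarrow> lcomb a xs = lcomb b xs"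
  by (induction xs) auto

lemma (in hilb) ip_lcomb_self:
  assumes a: "\<forall>i\<in>I. a i \<in> V" and xs: "set xs \<subseteq> UNIV \<times> I"
  shows "ip (lcomb a xs) (lcomb a xs) =
    (\<Sum>m<length xs. \<Sum>n<length xs. fst (xs ! m) * cnj (fst (xs ! n)) * ip (a (snd (xs ! m))) (a (snd (xs ! n))))"
proof -
  have m: "a (snd (xs ! m)) \<in> V" if "m < length xs" for m
    using a xs nth_mem[OF that] by (auto simp: mem_Times_iff)
  then have s: "(\<Sum>m<length xs. fst (xs ! m) *\<^sub>C a (snd (xs ! m))) \<in> V" by (auto intro!: sum_mem)
  have r: "ip v (\<Sum>m<length xs. fst (xs ! m) *\<^sub>C a (snd (xs ! m))) =
      (\<Sum>m<length xs. cnj (fst (xs ! m)) * ip v (a (snd (xs ! m))))" if "v \<in> V" for v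
    using m that by (subst ip_sum_right) (auto intro!: sum.cong simp: ip_scale_right)
  show ?thesis
    unfolding lcomb_nth using m s
    by (subst ip_sum_left)
      (auto intro!: sum.cong simp: ip_scale_left ip_scale_right sum_distrib_left mult_ac r)
qed

text \<open>The state space is to consist of functions on the ball, whereas the analysis takes place
  on words. This carries the Hilbert space structure along the linear bijection between the
  two.\<close>

lemma hilbert_space_transport:
  assumes W: "hilbert_space W ip"
    and add: "\<And>x y. x \<in> W \<Longrightarrow> y \<in> W \<Longrightarrow> \<Phi> (x + y) = \<Phi> x + \<Phi> y"
    and scale: "\<And>c x. x \<in> W \<Longrightarrow> \<Phi> (c *\<^sub>C x) = c *\<^sub>C \<Phi> x"
    and inv: "\<And>x. x \<in> W \<Longrightarrow> J (\<Phi> x) = x"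
  shows "hilbert_space (\<Phi> ` W) (\<lambda>x y. ip (J x) (J y))"
proof -
  interpret hilb W ip by unfold_locales (rule W)
  have z: "\<Phi> 0 = 0" using scale[of 0 0] by simp
  have diff: "\<Phi> (x - y) = \<Phi> x - \<Phi> y" if "x \<in> W" "y \<in> W" for x y
    using add[of x "(-1) *\<^sub>C y"] scale[of y "-1"] that by (simp add: scaleC_minus_one)
  have nrm: "hnorm (\<lambda>x y. ip (J x) (J y)) (\<Phi> x - \<Phi> y) = nrm (x - y)" if "x \<in> W" "y \<in> W" for x y
    using that by (simp add: diff[symmetric] hnorm_def inv)
  show ?thesis
    unfolding hilbert_space_def
  proof (intro conjI ballI allI impI)
    show "0 \<in> \<Phi> ` W" using z zero_mem by (metis imageI)
  next
    fix x y assume "x \<in> \<Phi> ` W" "y \<in> \<Phi> ` W"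
    then obtain x' y' where x: "x = \<Phi> x'" "x' \<in> W" and y: "y = \<Phi> y'" "y' \<in> W" by blast
    show "x + y \<in> \<Phi> ` W" using x y add[of x' y'] by (metis add_mem imageI)
    show "ip (J y) (J x) = cnj (ip (J x) (J y))"
      using x y ip_sym[of x' y'] by (simp add: inv)
    show "ip (J (c *\<^sub>C x)) (J y) = c * ip (J x) (J y)" for c
      using x y by (simp add: scale[symmetric] inv ip_scale_left)
    fix v assume "v \<in> \<Phi> ` W"
    then obtain v' where v: "v = \<Phi> v'" "v' \<in> W" by blast
    show "ip (J (x + y)) (J v) = ip (J x) (J v) + ip (J y) (J v)"
      using x y v by (simp add: add[symmetric] inv ip_add_left)
  next
    fix x c assume "x \<in> \<Phi> ` W"
    then obtain x' where x: "x = \<Phi> x'" "x' \<in> W" by blast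
    show "c *\<^sub>C x \<in> \<Phi> ` W" using x scale[of x' c] by (metis scale_mem imageI)
    assume "x \<noteq> 0"
    then have "x' \<noteq> 0" using x z by auto
    then show "0 < Re (ip (J x) (J x))" using x by (simp add: inv ip_pos)
  next
    fix s :: "nat \<Rightarrow> 'b"
    assume s: "(\<forall>n. s n \<in> \<Phi> ` W) \<and>
      (\<forall>e>0. \<exists>N. \<forall>m\<ge>N. \<forall>n\<ge>N. hnorm (\<lambda>x y. ip (J x) (J y)) (s m - s n) < e)"
    then obtain t where t: "\<And>n. s n = \<Phi> (t n)" "\<And>n. t n \<in> W"
      unfolding image_iff by metis
    have "\<exists>N. \<forall>m\<ge>N. \<forall>n\<ge>N. nrm (t m - t n) < e" if "e > 0" for e
      using s[THEN conjunct2, rule_format, OF that] t nrm[OF t(2) t(2)] by simp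
    then obtain l where l: "l \<in> W" "(\<lambda>n. nrm (t n - l)) \<longlonglongrightarrow> 0"
      using complete[of t] t(2) by metis
    then show "\<exists>l\<in>\<Phi> ` W. (\<lambda>n. hnorm (\<lambda>x y. ip (J x) (J y)) (s n - l)) \<longlonglongrightarrow> 0"
      using t nrm[OF t(2) l(1)] by (intro bexI[of _ "\<Phi> l"]) auto
  qed
qed

section \<open>Functions on the ball attached to word-indexed families\<close>

context rkhs
begin

text \<open>\<open>rkrep\<close> leaves values outside the ball free. Prescribing 0 there makes the
  function unique, and \<open>hat\<close> therefore linear.\<close>

definition hat :: "('d list \<Rightarrow> 'a) \<Rightarrow> complex^'d \<Rightarrow> 'a" where
  "hat g = (SOME f. rkrep f g \<and> (\<forall>z. z \<notin> ball_d \<longrightarrow> f z = 0))"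

definition coeffs :: "(complex^'d \<Rightarrow> 'a) \<Rightarrow> 'd list \<Rightarrow> 'a" where
  "coeffs f = (THE g. rkrep f g)"

lemma hat:
  assumes g: "g \<in> fock V ip"
  shows "rkrep (hat g) g" "z \<notin> ball_d \<Longrightarrow> hat g z = 0"
proof -
  obtain f where f: "rkrep f g" using rkrep_exists[OF g] by blast
  have "rkrep (\<lambda>z. if z \<in> ball_d then f z else 0) g"
    using f by (auto simp: rkrep_def)
  then have "\<exists>f. rkrep f g \<and> (\<forall>z. z \<notin> ball_d \<longrightarrow> f z = 0)" by force
  from someI_ex[OF this] show "rkrep (hat g) g" "z \<notin> ball_d \<Longrightarrow> hat g z = 0"
    by (auto simp: hat_def)
qed

lemma hat_eqI:
  assumes "rkrep f g" "\<And>z. z \<notin> ball_d \<Longrightarrow> f z = 0"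
  shows "hat g = f"
proof
  fix z
  show "hat g z = f z"
    using rkrep_inj[OF hat(1) assms(1), of z] hat(2)[of g z] assms by (cases "z \<in> ball_d") auto
qed

lemma hat_add: "g \<in> fock V ip \<Longrightarrow> h \<in> fock V ip \<Longrightarrow> hat (g + h) = hat g + hat h"
  using rkrep_add[OF hat(1) hat(1)] by (intro hat_eqI) (auto simp: hat(2) plus_fun_def)

lemma hat_scale: "g \<in> fock V ip \<Longrightarrow> hat (c *\<^sub>C g) = c *\<^sub>C hat g"
  using rkrep_scale[OF hat(1)] by (intro hat_eqI) (auto simp: hat(2) scaleC_fun_def)

lemma coeffs_hat: "g \<in> fock V ip \<Longrightarrow> coeffs (hat g) = g"
  unfolding coeffs_def using hat(1) rkrep_unique by blast

end

locale inner_mult = contractive_multiplier U ipU Y ipY dim S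
  for U :: "'u::cvector set" and ipU and Y :: "'y::cvector set" and ipY
    and dim :: "'d::finite itself" and S +
  assumes M_partial: "h \<in> fock Y ipY \<Longrightarrow> M.adj (M (M.adj h)) = M.adj h"
begin

definition W :: "('d list \<Rightarrow> 'y) set" where "W = {h \<in> fock Y ipY. M.adj h = 0}"

definition X :: "(complex^'d \<Rightarrow> 'y) set" where "X = Y.hat ` W"

definition ipX :: "(complex^'d \<Rightarrow> 'y) \<Rightarrow> (complex^'d \<Rightarrow> 'y) \<Rightarrow> complex" where
  "ipX f g = ltwo_ip ipY (Y.coeffs f) (Y.coeffs g)"

text \<open>\<open>M_partial\<close> makes M M^* a projection, so this is the orthogonal projection
  onto \<open>W\<close>; the \<open>q z y\<close> below are the kernel functions of the state
  space.\<close>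

definition Q :: "('d list \<Rightarrow> 'y) \<Rightarrow> 'd list \<Rightarrow> 'y" where "Q h = h - M (M.adj h)"

definition A :: "'d \<Rightarrow> (complex^'d \<Rightarrow> 'y) \<Rightarrow> complex^'d \<Rightarrow> 'y" where
  "A j f = Y.hat (shift j (Y.coeffs f))"

definition C :: "(complex^'d \<Rightarrow> 'y) \<Rightarrow> 'y" where "C f = Y.coeffs f []"

definition q :: "complex^'d \<Rightarrow> 'y \<Rightarrow> complex^'d \<Rightarrow> 'y" where "q z y = Y.hat (Q (Kf z y))"

lemma W_fock: "h \<in> W \<Longrightarrow> h \<in> fock Y ipY"
  by (simp add: W_def)

lemma W_ip_M: "h \<in> W \<Longrightarrow> g \<in> fock U ipU \<Longrightarrow> ltwo_ip ipY h (M g) = 0"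
  using M.adj_ip'[of g h] by (simp add: W_def)

lemma W_hilbert: "hilbert_space W (ltwo_ip ipY)"
proof -
  interpret Ma: hop "fock Y ipY :: ('d list \<Rightarrow> 'y) set" "ltwo_ip ipY" "fock U ipU" "ltwo_ip ipU" M.adj
    by (rule M.hop_adj)
  show ?thesis
  proof (rule Y.F.closed_subspace_hilbert)
    fix s l assume s: "\<And>n::nat. s n \<in> W" and l: "l \<in> fock Y ipY" and lim: "(\<lambda>n. Y.F.nrm (s n - l)) \<longlonglongrightarrow> 0"
    have "(\<lambda>n. U.F.nrm (M.adj (s n) - M.adj l)) \<longlonglongrightarrow> 0"
      using Ma.tendsto[of s l] s l lim W_fock by blast
    then have "(\<lambda>n. U.F.nrm (M.adj l)) \<longlonglongrightarrow> 0"
      using s l U.F.nrm_minus[of "M.adj l"] by (simp add: W_def)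
    then have "U.F.nrm (M.adj l) = 0" by (simp add: LIMSEQ_const_iff)
    then show "l \<in> W" using l U.F.nrm_eq_0[of "M.adj l"] by (simp add: W_def)
  qed (auto simp: W_def Ma.add Ma.scale)
qed

lemma coeffs_hat_W: "h \<in> W \<Longrightarrow> Y.coeffs (Y.hat h) = h"
  by (simp add: W_fock Y.coeffs_hat)

lemma X_hilbert: "hilbert_space X ipX"
  unfolding X_def ipX_def[abs_def]
  by (rule hilbert_space_transport[OF W_hilbert])
    (auto simp: W_fock Y.hat_add Y.hat_scale coeffs_hat_W)

sublocale X: hilb X ipX
  by unfold_locales (rule X_hilbert)

lemma XE:
  assumes "x \<in> X"
  shows "Y.coeffs x \<in> W" "Y.hat (Y.coeffs x) = x"
  using assms by (auto simp: X_def coeffs_hat_W)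

lemma coeffs_fock [simp]: "x \<in> X \<Longrightarrow> Y.coeffs x \<in> fock Y ipY"
  using XE W_fock by blast

lemma hat_mem [simp]: "h \<in> W \<Longrightarrow> Y.hat h \<in> X"
  by (simp add: X_def)

lemma coeffs_add: "x \<in> X \<Longrightarrow> y \<in> X \<Longrightarrow> Y.coeffs (x + y) = Y.coeffs x + Y.coeffs y"
  using Y.coeffs_hat[of "Y.coeffs x + Y.coeffs y"]
  by (simp add: Y.hat_add XE)

lemma coeffs_scale: "x \<in> X \<Longrightarrow> Y.coeffs (c *\<^sub>C x) = c *\<^sub>C Y.coeffs x"
  using Y.coeffs_hat[of "c *\<^sub>C Y.coeffs x"]
  by (simp add: Y.hat_scale XE)

lemma X_nrm: "X.nrm x = Y.F.nrm (Y.coeffs x)"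
  by (simp add: hnorm_def ipX_def)

text \<open>Both sides represent z_j S(z) g(z). Taking adjoints, the kernel of M^* is invariant
  under the backward shifts.\<close>

lemma M_intertwines: "g \<in> fock U ipU \<Longrightarrow> Y.shift.adj j (M g) = M (U.shift.adj j g)"
  by (rule Y.eq_if_ip_Kf_eq) (auto simp: Y.shift_adj_Kf U.shift_adj_Kf M_ip)

lemma shift_W [simp]:
  assumes h: "h \<in> W"
  shows "shift j h \<in> W"
proof -
  have hF: "h \<in> fock Y ipY" using h by (rule W_fock)
  have "M.adj (shift j h) = 0"
  proof (rule U.F.eq_if_ip_eq)
    fix g :: "'d list \<Rightarrow> 'u" assume g: "g \<in> fock U ipU"
    have "ltwo_ip ipU (M.adj (shift j h)) g = ltwo_ip ipY h (Y.shift.adj j (M g))"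
      using g hF by (simp add: M.adj_ip' Y.shift.adj_ip)
    also have "\<dots> = 0" using g h by (simp add: M_intertwines W_ip_M)
    finally show "ltwo_ip ipU (M.adj (shift j h)) g = ltwo_ip ipU 0 g" using g by simp
  qed (use hF in auto)
  then show ?thesis using hF by (simp add: W_def)
qed

lemma A_mem: "x \<in> X \<Longrightarrow> A j x \<in> X"
  by (simp add: A_def XE)

lemma coeffs_A: "x \<in> X \<Longrightarrow> Y.coeffs (A j x) = shift j (Y.coeffs x)"
  by (simp add: A_def XE coeffs_hat_W)

sublocale P: isopair X ipX Y ipY dim A C
proof
  fix j
  have add: "A j (x + y) = A j x + A j y" if "x \<in> X" "y \<in> X" for x y
    using that Y.shift.add by (simp add: A_def coeffs_add Y.hat_add)
  have scale: "A j (c *\<^sub>C x) = c *\<^sub>C A j x" if "x \<in> X" for x c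
    using that Y.shift.scale by (simp add: A_def coeffs_scale Y.hat_scale)
  have "X.nrm (A j x) \<le> X.nrm x" if "x \<in> X" for x
    using that Y.shift_nrm_le by (simp add: X_nrm coeffs_A)
  with add scale show "bounded_op X ipX X ipX (A j)"
    by (auto simp: bounded_op_def A_mem intro!: exI[of _ 1])
  have "Y.nrm (C x) \<le> X.nrm x" if "x \<in> X" for x
    using Y.ltwo_coord_le[OF Y.fock_ltwo[OF coeffs_fock[OF that]]] by (simp add: X_nrm C_def)
  then show "bounded_op X ipX Y ipY C"
    by (auto simp: bounded_op_def C_def coeffs_add coeffs_scale intro!: exI[of _ 1])
  show "(\<Sum>j\<in>UNIV. (X.nrm (A j x))\<^sup>2) + (Y.nrm (C x))\<^sup>2 = (X.nrm x)\<^sup>2" if "x \<in> X" for x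
    using that Y.shift_nrm[of "Y.coeffs x"] by (simp add: X_nrm coeffs_A C_def)
qed

lemma Q_W: "h \<in> fock Y ipY \<Longrightarrow> Q h \<in> W"
  using hop.diff[OF M.hop_adj, of h "M (M.adj h)"] by (simp add: Q_def W_def M_partial)

lemma q_mem [simp]: "z \<in> ball_d \<Longrightarrow> y \<in> Y \<Longrightarrow> q z y \<in> X"
  by (simp add: q_def Q_W)

lemma ip_q:
  assumes "x \<in> X" "z \<in> ball_d" "y \<in> Y"
  shows "ipX x (q z y) = ltwo_ip ipY (Y.coeffs x) (Kf z y)"
  using assms W_ip_M[OF XE(1)[OF assms(1)]]
  by (simp add: ipX_def q_def coeffs_hat_W Q_W) (simp add: Q_def Y.F.ip_diff_right)

text \<open>Tested against x, the decomposition of \<open>ip_Kf_shift\<close> says that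
  \<open>q z y\<close> solves the equation characterising \<open>xi\<close>. The generators of D are
  thereby known explicitly.\<close>

lemma xi_eq_q:
  assumes z: "z \<in> ball_d" and y: "y \<in> Y"
  shows "P.xi z y = q z y"
proof (rule P.xi_unique[OF z y])
  show "q z y \<in> X" using z y by simp
  show "q z y - P.Za z (q z y) = P.Ca y"
  proof (rule X.eq_if_ip_eq_left)
    fix x assume x: "x \<in> X"
    have "ipX x (q z y - P.Za z (q z y)) = ipX x (q z y) - ipX (P.Z z x) (q z y)"
      using x z y by (simp add: X.ip_diff_right P.ip_Z)
    also have "ipX (P.Z z x) (q z y) = (\<Sum>j\<in>UNIV. z $ j * ltwo_ip ipY (shift j (Y.coeffs x)) (Kf z y))"
      using x z y by (simp add: P.Z_def X.ip_sum_left ip_q coeffs_A coeffs_scale Y.F.ip_scale_left)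
    finally have e: "ipX x (q z y - P.Za z (q z y)) =
        ipX x (q z y) - (\<Sum>j\<in>UNIV. z $ j * ltwo_ip ipY (shift j (Y.coeffs x)) (Kf z y))" .
    show "ipX x (q z y - P.Za z (q z y)) = ipX x (P.Ca y)"
      unfolding e using x z y Y.ip_Kf_shift[of "Y.coeffs x" z y] by (simp add: ip_q P.C.adj_ip C_def)
  qed (use z y in auto)
qed

lemma zero_ball [simp]: "(0::complex^'d) \<in> ball_d"
  by (simp add: ball_d_iff)

lemma Ca_eq: "y \<in> Y \<Longrightarrow> P.Ca y = q 0 y"
  using P.xi_eq[of 0 y] by (simp add: xi_eq_q P.Za_def)

text \<open>The kernel of the state space is \<open>kd l z\<close> times I - S(l) S(z)^*. Clearing
  the denominator shows that (Z(z)^* q z y, y) |-> (q z y, S(z)^* y) preserves inner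
  products.\<close>

lemma gram_q:
  assumes "z \<in> ball_d" "l \<in> ball_d" "y \<in> Y" "x \<in> Y"
  shows "ipX (q z y) (q l x) + ipU (Sa z y) (Sa l x) = cinner_d l z * ipX (q z y) (q l x) + ipY y x"
proof -
  have "ipX (q z y) (q l x) = ltwo_ip ipY (Q (Kf z y)) (Kf l x)"
    using assms by (simp add: ip_q) (simp add: q_def coeffs_hat_W Q_W)
  also have "\<dots> = kd l z * ipY y x - kd l z * ipU (Sa z y) (Sa l x)"
    using assms by (simp add: Q_def Y.F.ip_diff_left M_adj_Kf M_ip Y.gram U.gram)
  finally have "ipX (q z y) (q l x) = kd l z * ipY y x - kd l z * ipU (Sa z y) (Sa l x)" .
  moreover have "1 - cinner_d l z \<noteq> 0"
    using cinner_d_less_1[OF assms(2,1)] by auto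
  ultimately show ?thesis by (simp add: kd_def field_simps)
qed

section \<open>The direct sum X^d, the subspace D and the lurking isometry\<close>

abbreviation Xd :: "('d \<Rightarrow> complex^'d \<Rightarrow> 'y) set" where "Xd \<equiv> ltwo X ipX"
abbreviation ipd :: "('d \<Rightarrow> complex^'d \<Rightarrow> 'y) \<Rightarrow> ('d \<Rightarrow> complex^'d \<Rightarrow> 'y) \<Rightarrow> complex" where
  "ipd \<equiv> ltwo_ip ipX"

sublocale Xd: hilb Xd ipd
  by unfold_locales (rule X.ltwo_hilbert)

lemma Xd_iff: "w \<in> Xd \<longleftrightarrow> (\<forall>j. w j \<in> X)"
  by (simp add: ltwo_def)

lemma ipd_eq: "ipd w v = (\<Sum>j\<in>UNIV. ipX (w j) (v j))"
  by (simp add: ltwo_ip_def)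

lemma Xd_nrm: "w \<in> Xd \<Longrightarrow> hnorm_d ipX w = Xd.nrm w"
  using X.ltwo_nrm_sq[of w] X.ltwo_nrm_nonneg[of w]
  by (simp add: hnorm_d_def real_sqrt_unique)

definition idx :: "((complex^'d) \<times> 'y) set" where "idx = ball_d \<times> Y"

definition a :: "(complex^'d) \<times> 'y \<Rightarrow> 'd \<Rightarrow> complex^'d \<Rightarrow> 'y" where
  "a = (\<lambda>(z, y) j. cnj (z $ j) *\<^sub>C q z y)"

lemma a_mem: "\<forall>i\<in>idx. a i \<in> Xd"
  by (auto simp: idx_def a_def Xd_iff)

text \<open>Gives access to the general results on closed spans; with \<open>xi_eq_q\<close> the two
  sets of approximants are the same.\<close>

lemma D_space_eq: "D_space X ipX Y ipY A C = clspan Xd ipd a idx"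
proof (intro set_eqI iffI)
  fix w assume w: "w \<in> D_space X ipX Y ipY A C"
  have wX: "w \<in> Xd" using w by (simp add: D_space_def Xd_iff)
  show "w \<in> clspan Xd ipd a idx"
    unfolding clspan_def
  proof (intro CollectI conjI allI impI)
    fix e :: real assume "e > 0"
    then obtain n c \<zeta> y where *: "\<forall>i<(n::nat). \<zeta> i \<in> ball_d \<and> y i \<in> Y"
      "hnorm_d ipX (w - (\<Sum>i<n. c i *\<^sub>C D_gen X ipX Y ipY A C (\<zeta> i) (y i))) < e"
      using w unfolding D_space_def by blast
    define xs where "xs = map (\<lambda>i. (c i, (\<zeta> i, y i))) [0..<n]"
    have xs: "set xs \<subseteq> UNIV \<times> idx" using *(1) by (auto simp: xs_def idx_def)
    have "(\<Sum>i<n. c i *\<^sub>C D_gen X ipX Y ipY A C (\<zeta> i) (y i)) = lcomb a xs"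
      unfolding lcomb_nth using *(1) by (simp add: xs_def P.D_gen_eq a_def xi_eq_q)
    then have "hnorm_d ipX (w - lcomb a xs) < e" using *(2) by simp
    then show "\<exists>xs. set xs \<subseteq> UNIV \<times> idx \<and> Xd.nrm (w - lcomb a xs) < e"
      using xs Xd_nrm[of "w - lcomb a xs"] wX Xd.lcomb_mem[OF a_mem xs] by auto
  qed (rule wX)
next
  fix w assume w: "w \<in> clspan Xd ipd a idx"
  have wX: "w \<in> Xd" using w Xd.clspan_subset by blast
  show "w \<in> D_space X ipX Y ipY A C"
    unfolding D_space_def
  proof (intro CollectI conjI allI impI)
    show "w j \<in> X" for j using wX by (simp add: Xd_iff)
    fix e :: real assume e: "e > 0"
    obtain xs where xs: "set xs \<subseteq> UNIV \<times> idx" "Xd.nrm (w - lcomb a xs) < e"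
      using Xd.clspanE[OF w e] by blast
    let ?c = "\<lambda>i. fst (xs ! i)" and ?z = "\<lambda>i. fst (snd (xs ! i))" and ?y = "\<lambda>i. snd (snd (xs ! i))"
    have m: "\<forall>i<length xs. ?z i \<in> ball_d \<and> ?y i \<in> Y"
      using xs(1) nth_mem by (fastforce simp: idx_def)
    have "(\<Sum>i<length xs. ?c i *\<^sub>C D_gen X ipX Y ipY A C (?z i) (?y i)) = lcomb a xs"
      unfolding lcomb_nth using m by (simp add: P.D_gen_eq a_def xi_eq_q case_prod_beta)
    then have "hnorm_d ipX (w - (\<Sum>i<length xs. ?c i *\<^sub>C D_gen X ipX Y ipY A C (?z i) (?y i))) < e"
      using xs(2) Xd_nrm[of "w - lcomb a xs"] wX Xd.lcomb_mem[OF a_mem xs(1)] by simp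
    with m show "\<exists>n c \<zeta> y. (\<forall>i<(n::nat). \<zeta> i \<in> ball_d \<and> y i \<in> Y) \<and>
        hnorm_d ipX (w - (\<Sum>i<n. c i *\<^sub>C D_gen X ipX Y ipY A C (\<zeta> i) (y i))) < e"
      by (intro exI[of _ "length xs"] exI[of _ ?c] exI[of _ ?z] exI[of _ ?y] conjI)
  qed
qed

text \<open>The adjoints \<open>A\<^sup>*\<close> and \<open>B\<^sup>*\<close> must map \<open>a (z, y)\<close> to these increments.\<close>

definition tq :: "(complex^'d) \<times> 'y \<Rightarrow> complex^'d \<Rightarrow> 'y" where
  "tq = (\<lambda>(z, y). q z y - q 0 y)"

definition ts :: "(complex^'d) \<times> 'y \<Rightarrow> 'u" where
  "ts = (\<lambda>(z, y). Sa z y - Sa 0 y)"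

lemma ts_mem: "\<forall>i\<in>idx. ts i \<in> U"
  by (auto simp: idx_def ts_def)

lemma hop_q0: "hop Y ipY X ipX P.Ca"
  by (rule P.C.hop_adj)

text \<open>\<open>gram_q\<close> ties the Y component to the list. Weak coisometry needs the two
  independent, which is why the images are written as increments from the point 0.\<close>

lemma lcomb_isometry:
  assumes xs: "set xs \<subseteq> UNIV \<times> idx" and y0: "y0 \<in> Y"
  shows "(X.nrm (lcomb tq xs + q 0 y0))\<^sup>2 + (U.nrm (lcomb ts xs + Sa 0 y0))\<^sup>2 =
    (Xd.nrm (lcomb a xs))\<^sup>2 + (Y.nrm y0)\<^sup>2"
proof -
  let ?q = "\<lambda>(z, y). q z y" and ?s = "\<lambda>(z, y). Sa z y" and ?y = "\<lambda>(z::complex^'d, y). y"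
  have q: "\<forall>i\<in>idx. ?q i \<in> X" and s: "\<forall>i\<in>idx. ?s i \<in> U" and y: "\<forall>i\<in>idx. ?y i \<in> Y"
    by (auto simp: idx_def)
  have eq: "(X.nrm (lcomb ?q zs))\<^sup>2 + (U.nrm (lcomb ?s zs))\<^sup>2 = (Xd.nrm (lcomb a zs))\<^sup>2 + (Y.nrm (lcomb ?y zs))\<^sup>2"
    if zs: "set zs \<subseteq> UNIV \<times> idx" for zs
  proof -
    have pair: "ipX (?q i) (?q k) + ipU (?s i) (?s k) = ipd (a i) (a k) + ipY (?y i) (?y k)"
      if "i \<in> idx" "k \<in> idx" for i k
    proof -
      obtain z y l x where ik: "i = (z, y)" "k = (l, x)" by (metis prod.exhaust)
      have m: "z \<in> ball_d" "l \<in> ball_d" "y \<in> Y" "x \<in> Y" using that ik by (auto simp: idx_def)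
      have "ipd (a i) (a k) = cinner_d l z * ipX (q z y) (q l x)"
        using m by (simp add: ipd_eq a_def ik X.ip_scale_left X.ip_scale_right cinner_d_def
            sum_distrib_right mult_ac)
      then show ?thesis using gram_q[OF m] ik by simp
    qed
    have mem: "snd (zs ! m) \<in> idx" if "m < length zs" for m
      using zs nth_mem[OF that] by (auto simp: mem_Times_iff)
    have "ipX (lcomb ?q zs) (lcomb ?q zs) + ipU (lcomb ?s zs) (lcomb ?s zs) =
        ipd (lcomb a zs) (lcomb a zs) + ipY (lcomb ?y zs) (lcomb ?y zs)"
      unfolding X.ip_lcomb_self[OF q zs] U.ip_lcomb_self[OF s zs] Xd.ip_lcomb_self[OF a_mem zs]
        Y.ip_lcomb_self[OF y zs] sum.distrib[symmetric] distrib_left[symmetric]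
      using mem by (intro sum.cong refl arg_cong2[of _ _ _ _ "(*)"] pair) auto
    then show ?thesis
      using X.lcomb_mem[OF q zs] U.lcomb_mem[OF s zs] Xd.lcomb_mem[OF a_mem zs] Y.lcomb_mem[OF y zs]
      by (simp add: X.nrm_sq U.nrm_sq Xd.nrm_sq Y.nrm_sq flip: plus_complex.sel)
  qed
  \<comment> \<open>An entry at the point 0 contributes nothing to \<open>a\<close>, so
    \<open>y1\<close> corrects the Y component to \<open>y0\<close> at no cost in X^d.\<close>
  define y1 where "y1 = y0 - lcomb ?y xs"
  have yx: "lcomb ?y xs \<in> Y" by (rule Y.lcomb_mem[OF y xs])
  have y1: "y1 \<in> Y" using y0 yx by (simp add: y1_def)
  define zs where "zs = (1, (0, y1)) # xs"
  have zs: "set zs \<subseteq> UNIV \<times> idx" using xs y1 by (auto simp: zs_def idx_def)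
  interpret C': hop Y ipY X ipX P.Ca by (rule hop_q0)
  interpret S0: hop Y ipY U ipU "Sa 0" by (rule Sa_hop) simp
  have "lcomb (\<lambda>(z, y). q 0 y) xs = lcomb (\<lambda>i. P.Ca (?y i)) xs"
    using xs by (intro lcomb_cong[of idx]) (auto simp: idx_def Ca_eq)
  also have "\<dots> = q 0 (lcomb ?y xs)"
    using C'.lcomb[OF y xs] Ca_eq[OF yx] by simp
  finally have q0: "lcomb (\<lambda>(z, y). q 0 y) xs = q 0 (lcomb ?y xs)" .
  have "lcomb (\<lambda>(z, y). Sa 0 y) xs = lcomb (\<lambda>i. Sa 0 (?y i)) xs"
    by (simp add: case_prod_beta')
  also have "\<dots> = Sa 0 (lcomb ?y xs)"
    using S0.lcomb[OF y xs] by simp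
  finally have s0: "lcomb (\<lambda>(z, y). Sa 0 y) xs = Sa 0 (lcomb ?y xs)" .
  have "lcomb tq xs = lcomb ?q xs - q 0 (lcomb ?y xs)"
    unfolding q0[symmetric] lcomb_diff_left[symmetric] tq_def by (simp add: case_prod_beta')
  moreover have "q 0 y1 = q 0 y0 - q 0 (lcomb ?y xs)"
    using C'.diff[OF y0 yx] Ca_eq y0 yx y1 by (simp add: y1_def)
  ultimately have 1: "lcomb ?q zs = lcomb tq xs + q 0 y0"
    by (simp add: zs_def scaleC_one)
  have "lcomb ts xs = lcomb ?s xs - Sa 0 (lcomb ?y xs)"
    unfolding s0[symmetric] lcomb_diff_left[symmetric] ts_def by (simp add: case_prod_beta')
  moreover have "Sa 0 y1 = Sa 0 y0 - Sa 0 (lcomb ?y xs)"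
    using S0.diff[OF y0 yx] by (simp add: y1_def)
  ultimately have 2: "lcomb ?s zs = lcomb ts xs + Sa 0 y0"
    by (simp add: zs_def scaleC_one)
  have "a (0, y1) = 0" by (simp add: a_def fun_eq_iff)
  then have 3: "lcomb a zs = lcomb a xs" by (simp add: zs_def)
  have 4: "lcomb ?y zs = y0" by (simp add: zs_def scaleC_one y1_def)
  show ?thesis using eq[OF zs] unfolding 1 2 3 4 .
qed

lemma lcomb_ts_le:
  assumes xs: "set xs \<subseteq> UNIV \<times> idx"
  shows "U.nrm (lcomb ts xs) \<le> Xd.nrm (lcomb a xs)"
proof (rule power2_le_imp_le)
  have "q 0 0 = 0" using Ca_eq[of 0] hop.zero[OF hop_q0] by simp
  moreover have "Sa 0 0 = 0" using hop.zero[OF Sa_hop[of 0]] by simp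
  ultimately have "(X.nrm (lcomb tq xs))\<^sup>2 + (U.nrm (lcomb ts xs))\<^sup>2 = (Xd.nrm (lcomb a xs))\<^sup>2"
    using lcomb_isometry[OF xs, of 0] by simp
  then show "(U.nrm (lcomb ts xs))\<^sup>2 \<le> (Xd.nrm (lcomb a xs))\<^sup>2"
    by (metis le_add_same_cancel2 zero_le_power2)
qed (use Xd.lcomb_mem[OF a_mem xs] in simp)

text \<open>The column of B, as adjoint of the map \<open>a i\<close> |-> \<open>ts i\<close>, which
  \<open>lcomb_ts_le\<close> shows to be contractive. Demanding a solution in the closed span makes
  it unique, hence linear in \<open>u\<close>, and places the range of B in D.\<close>

definition Bv :: "'u \<Rightarrow> 'd \<Rightarrow> complex^'d \<Rightarrow> 'y" where
  "Bv u = (SOME v. v \<in> clspan Xd ipd a idx \<and> (\<forall>i\<in>idx. ipd (a i) v = ipU (ts i) u) \<and> Xd.nrm v \<le> U.nrm u)"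

lemma Bv:
  assumes u: "u \<in> U"
  shows "Bv u \<in> clspan Xd ipd a idx" "i \<in> idx \<Longrightarrow> ipd (a i) (Bv u) = ipU (ts i) u" "Xd.nrm (Bv u) \<le> U.nrm u"
proof -
  have "\<exists>v. v \<in> clspan Xd ipd a idx \<and> (\<forall>i\<in>idx. ipd (a i) v = ipU (ts i) u) \<and> Xd.nrm v \<le> U.nrm u"
  proof (rule Xd.moment_problem[OF a_mem, of "U.nrm u" "\<lambda>i. ipU (ts i) u"])
    fix xs :: "(complex \<times> (complex^'d) \<times> 'y) list" assume xs: "set xs \<subseteq> UNIV \<times> idx"
    have "lcomb (\<lambda>i. ipU (ts i) u) xs = ipU (lcomb ts xs) u"
      unfolding U.ip_lcomb_left[OF ts_mem xs u] ..
    also have "cmod \<dots> \<le> U.nrm (lcomb ts xs) * U.nrm u"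
      using U.lcomb_mem[OF ts_mem xs] u by (rule U.cauchy_schwarz)
    also have "\<dots> \<le> Xd.nrm (lcomb a xs) * U.nrm u"
      using lcomb_ts_le[OF xs] u by (intro mult_right_mono) auto
    finally show "cmod (lcomb (\<lambda>i. ipU (ts i) u) xs) \<le> U.nrm u * Xd.nrm (lcomb a xs)"
      by (simp add: mult.commute)
  next
    fix v assume "v \<in> clspan Xd ipd a idx" "\<And>i. i \<in> idx \<Longrightarrow> ipd (a i) v = ipU (ts i) u" "Xd.nrm v \<le> U.nrm u"
    then show ?thesis by blast
  qed (use u in simp)
  from someI_ex[OF this] show "Bv u \<in> clspan Xd ipd a idx"
    "i \<in> idx \<Longrightarrow> ipd (a i) (Bv u) = ipU (ts i) u" "Xd.nrm (Bv u) \<le> U.nrm u"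
    unfolding Bv_def by auto
qed

lemmas cl_add = Xd.clspan_add[OF a_mem]
  and cl_scale = Xd.clspan_scale[OF a_mem]

lemma cl_Xd: "w \<in> clspan Xd ipd a idx \<Longrightarrow> w \<in> Xd"
  using Xd.clspan_subset by blast

lemma Bv_Xd [simp]: "u \<in> U \<Longrightarrow> Bv u \<in> Xd"
  using Bv(1) cl_Xd by blast

lemma cl_eqI:
  assumes "v \<in> clspan Xd ipd a idx" "w \<in> clspan Xd ipd a idx" "\<And>i. i \<in> idx \<Longrightarrow> ipd (a i) v = ipd (a i) w"
  shows "v = w"
proof -
  have "v - w = 0"
    using assms a_mem cl_add[of v "(-1) *\<^sub>C w"] cl_scale[of w "-1"]
    by (intro Xd.clspan_eq_0[OF a_mem]) (auto simp: Xd.ip_diff_right cl_Xd scaleC_minus_one)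
  then show ?thesis by simp
qed

lemma Bv_add: "u \<in> U \<Longrightarrow> v \<in> U \<Longrightarrow> Bv (u + v) = Bv u + Bv v"
  using a_mem ts_mem by (intro cl_eqI) (auto simp: Bv cl_add Xd.ip_add_right U.ip_add_right)

lemma Bv_scale: "u \<in> U \<Longrightarrow> Bv (c *\<^sub>C u) = c *\<^sub>C Bv u"
  using a_mem ts_mem by (intro cl_eqI) (auto simp: Bv cl_scale Xd.ip_scale_right U.ip_scale_right)

definition B :: "'d \<Rightarrow> 'u \<Rightarrow> complex^'d \<Rightarrow> 'y" where "B j u = Bv u j"

lemma B_bounded: "bounded_op U ipU X ipX (B j)"
proof -
  have "X.nrm (B j u) \<le> U.nrm u" if u: "u \<in> U" for u
    using X.ltwo_coord_le[OF Bv_Xd[OF u], of j] Bv(3)[OF u] by (simp add: B_def)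
  moreover have "B j u \<in> X" if "u \<in> U" for u
    using Bv_Xd[OF that] by (simp add: B_def Xd_iff)
  ultimately show ?thesis
    by (auto simp: bounded_op_def B_def Bv_add Bv_scale intro!: exI[of _ 1])
qed

sublocale B: hop U ipU X ipX "B j" for j
  by unfold_locales (rule B_bounded)

abbreviation Ba :: "'d \<Rightarrow> (complex^'d \<Rightarrow> 'y) \<Rightarrow> 'u" where "Ba j \<equiv> hadj U ipU X ipX (B j)"

lemma hop_sum_coords:
  assumes T: "\<forall>j. hop X ipX V ipV (T j)"
  shows "hop Xd ipd V ipV (\<lambda>w. \<Sum>j\<in>UNIV. T j (w j))"
proof -
  interpret T: hop X ipX V ipV "T j" for j using T by blast
  have "\<exists>K. 0 \<le> K \<and> (\<forall>x\<in>X. hnorm ipV (T j x) \<le> K * X.nrm x)" for j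
    using T.bound[of j] by metis
  then obtain K where K: "\<And>j. 0 \<le> K j" "\<And>j x. x \<in> X \<Longrightarrow> hnorm ipV (T j x) \<le> K j * X.nrm x" by metis
  have "hnorm ipV (\<Sum>j\<in>UNIV. T j (w j)) \<le> (\<Sum>j\<in>UNIV. K j) * Xd.nrm w" if w: "w \<in> Xd" for w
  proof -
    have "hnorm ipV (\<Sum>j\<in>UNIV. T j (w j)) \<le> (\<Sum>j\<in>UNIV. hnorm ipV (T j (w j)))"
      using w by (intro T.W.nrm_sum_le) (simp add: Xd_iff)
    also have "\<dots> \<le> (\<Sum>j\<in>UNIV. K j * Xd.nrm w)"
    proof (rule sum_mono)
      fix j
      have "hnorm ipV (T j (w j)) \<le> K j * X.nrm (w j)" using K w by (simp add: Xd_iff)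
      also have "\<dots> \<le> K j * Xd.nrm w" using K X.ltwo_coord_le[OF w] by (intro mult_left_mono)
      finally show "hnorm ipV (T j (w j)) \<le> K j * Xd.nrm w" .
    qed
    finally show ?thesis by (simp add: sum_distrib_right)
  qed
  then have "bounded_op Xd ipd V ipV (\<lambda>w. \<Sum>j\<in>UNIV. T j (w j))"
    unfolding bounded_op_def
    by (auto simp: Xd_iff T.add T.scale sum.distrib scaleC_sum_right
        intro!: T.W.sum_mem exI[of _ "\<Sum>j\<in>UNIV. K j"])
  then show ?thesis using Xd.hilbert T.W.hilbert by (rule_tac hopI)
qed

text \<open>\<open>TA\<close> and \<open>TB\<close> are the rows A^* and B^* on X^d: the action of
  the adjoint connecting operator on its first argument.\<close>

definition TA :: "('d \<Rightarrow> complex^'d \<Rightarrow> 'y) \<Rightarrow> complex^'d \<Rightarrow> 'y" where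
  "TA w = (\<Sum>j\<in>UNIV. P.Aa j (w j))"

definition TB :: "('d \<Rightarrow> complex^'d \<Rightarrow> 'y) \<Rightarrow> 'u" where
  "TB w = (\<Sum>j\<in>UNIV. Ba j (w j))"

sublocale TA: hop Xd ipd X ipX TA
  unfolding TA_def[abs_def] by (rule hop_sum_coords) (simp add: P.A.hop_adj)

sublocale TB: hop Xd ipd U ipU TB
  unfolding TB_def[abs_def] by (rule hop_sum_coords) (simp add: B.hop_adj)

lemma ip_TA: "x \<in> X \<Longrightarrow> w \<in> Xd \<Longrightarrow> ipX x (TA w) = ipd (\<lambda>j. A j x) w"
  by (simp add: TA_def ipd_eq X.ip_sum_right P.A.adj_ip Xd_iff)

lemma ip_TB: "u \<in> U \<Longrightarrow> w \<in> Xd \<Longrightarrow> ipU u (TB w) = ipd (Bv u) w"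
  by (simp add: TB_def ipd_eq U.ip_sum_right B.adj_ip Xd_iff) (simp add: B_def)

lemma TA_a: "i \<in> idx \<Longrightarrow> TA (a i) = tq i"
proof -
  assume i: "i \<in> idx"
  obtain z y where zy: "i = (z, y)" by (cases i)
  have m: "z \<in> ball_d" "y \<in> Y" using i zy by (auto simp: idx_def)
  have "TA (a i) = P.Za z (q z y)"
    using m by (simp add: TA_def a_def zy P.Za_def hop.scale[OF P.A.hop_adj])
  also have "\<dots> = q z y - P.Ca y" using P.xi_eq[OF m] m by (simp add: xi_eq_q algebra_simps)
  finally show ?thesis using m by (simp add: Ca_eq tq_def zy)
qed

lemma TB_a:
  assumes i: "i \<in> idx"
  shows "TB (a i) = ts i"
proof (rule U.eq_if_ip_eq_left)
  have ai: "a i \<in> Xd" and ti: "ts i \<in> U" using a_mem ts_mem i by auto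
  then show "TB (a i) \<in> U" "ts i \<in> U" by auto
  fix u assume u: "u \<in> U"
  then show "ipU u (TB (a i)) = ipU u (ts i)"
    using Bv(2)[OF u i] Xd.ip_sym[OF ai Bv_Xd[OF u]] U.ip_sym[OF ti u] ai by (simp add: ip_TB)
qed

text \<open>\<open>lcomb_isometry\<close> for approximating lists, passed to the limit by continuity
  of \<open>TA\<close> and \<open>TB\<close>.\<close>

lemma coisometry:
  assumes w: "w \<in> clspan Xd ipd a idx" and y: "y \<in> Y"
  shows "(X.nrm (TA w + q 0 y))\<^sup>2 + (U.nrm (TB w + Sa 0 y))\<^sup>2 = (Xd.nrm w)\<^sup>2 + (Y.nrm y)\<^sup>2"
proof -
  obtain xs where xs: "\<And>n::nat. set (xs n) \<subseteq> UNIV \<times> idx" "(\<lambda>n. Xd.nrm (lcomb a (xs n) - w)) \<longlonglongrightarrow> 0"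
    using Xd.clspan_approx[OF a_mem w] by blast
  have wX: "w \<in> Xd" using w by (rule cl_Xd)
  have lX: "lcomb a (xs n) \<in> Xd" for n using Xd.lcomb_mem[OF a_mem xs(1)] .
  have q0: "q 0 y \<in> X" and s0: "Sa 0 y \<in> U" using y by auto
  have TAl: "TA (lcomb a (xs n)) = lcomb tq (xs n)" for n
    unfolding TA.lcomb[OF a_mem xs(1)] using TA_a xs(1) by (rule lcomb_cong)
  have TBl: "TB (lcomb a (xs n)) = lcomb ts (xs n)" for n
    unfolding TB.lcomb[OF a_mem xs(1)] using TB_a xs(1) by (rule lcomb_cong)
  have 1: "(\<lambda>n. X.nrm (lcomb tq (xs n) + q 0 y)) \<longlonglongrightarrow> X.nrm (TA w + q 0 y)"
    using TA.tendsto[OF lX wX xs(2)] lX wX q0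
    by (intro X.tendsto_nrm) (auto simp: TAl[symmetric])
  have 2: "(\<lambda>n. U.nrm (lcomb ts (xs n) + Sa 0 y)) \<longlonglongrightarrow> U.nrm (TB w + Sa 0 y)"
    using TB.tendsto[OF lX wX xs(2)] lX wX s0
    by (intro U.tendsto_nrm) (auto simp: TBl[symmetric])
  have "(\<lambda>n. (X.nrm (lcomb tq (xs n) + q 0 y))\<^sup>2 + (U.nrm (lcomb ts (xs n) + Sa 0 y))\<^sup>2)
      \<longlonglongrightarrow> (X.nrm (TA w + q 0 y))\<^sup>2 + (U.nrm (TB w + Sa 0 y))\<^sup>2"
    by (intro tendsto_intros 1 2)
  moreover have "(\<lambda>n. (Xd.nrm (lcomb a (xs n)))\<^sup>2 + (Y.nrm y)\<^sup>2) \<longlonglongrightarrow> (Xd.nrm w)\<^sup>2 + (Y.nrm y)\<^sup>2"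
    by (intro tendsto_intros Xd.tendsto_nrm lX wX xs(2))
  ultimately show ?thesis
    unfolding lcomb_isometry[OF xs(1) y] by (rule LIMSEQ_unique)
qed

text \<open>Orthogonality to the generators means sum_j z_j w_j(z) = 0 on the ball. Adjoint shifts
  multiply by z_j, so \<open>G\<close> is the family of that function and vanishes; and the column
  of A at x pairs with w as x pairs with \<open>G\<close>.\<close>

lemma A_perp:
  assumes x: "x \<in> X" and w: "w \<in> Xd" and perp: "\<And>i. i \<in> idx \<Longrightarrow> ipd (a i) w = 0"
  shows "ipd (\<lambda>j. A j x) w = 0"
proof -
  have wj: "w j \<in> X" for j using w by (simp add: Xd_iff)
  define G where "G = (\<Sum>j\<in>UNIV. Y.shift.adj j (Y.coeffs (w j)))"
  have G: "G \<in> fock Y ipY" unfolding G_def using wj by (intro Y.F.sum_mem) simp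
  have "ltwo_ip ipY G (Kf z y) = 0" if z: "z \<in> ball_d" and y: "y \<in> Y" for z :: "complex^'d" and y
  proof -
    have i: "(z, y) \<in> idx" using z y by (simp add: idx_def)
    have "ltwo_ip ipY G (Kf z y) = (\<Sum>j\<in>UNIV. z $ j * ipX (w j) (q z y))"
      unfolding G_def using wj z y by (simp add: Y.F.ip_sum_left Y.shift_adj_Kf ip_q)
    also have "\<dots> = ipd w (a (z, y))"
      using wj z y by (simp add: ipd_eq a_def X.ip_scale_right)
    also have "\<dots> = 0"
      using perp[OF i] Xd.ip_sym[of "a (z, y)" w] a_mem i w by simp
    finally show ?thesis .
  qed
  then have "G = 0" using Y.Kf_total[OF G] by blast
  have "ipd (\<lambda>j. A j x) w = (\<Sum>j\<in>UNIV. ltwo_ip ipY (Y.coeffs x) (Y.shift.adj j (Y.coeffs (w j))))"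
    using x wj by (simp add: ipd_eq ipX_def coeffs_A Y.shift.adj_ip)
  also have "\<dots> = ltwo_ip ipY (Y.coeffs x) G"
    unfolding G_def using x wj by (subst Y.F.ip_sum_right) auto
  finally show ?thesis using \<open>G = 0\<close> x by simp
qed

lemma A_col_Xd [simp]: "x \<in> X \<Longrightarrow> (\<lambda>j. A j x) \<in> Xd"
  by (simp add: Xd_iff)

text \<open>\<open>moment_problem\<close> supplies the projection \<open>p\<close> of the column
  onto D. The error is orthogonal to \<open>p\<close>, and by \<open>A_perp\<close> to the column,
  hence to itself.\<close>

lemma A_col_cl:
  assumes x: "x \<in> X"
  shows "(\<lambda>j. A j x) \<in> clspan Xd ipd a idx"
proof -
  let ?v = "\<lambda>j. A j x"
  have v: "?v \<in> Xd" using x by simp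
  obtain p where p: "p \<in> clspan Xd ipd a idx" "\<And>i. i \<in> idx \<Longrightarrow> ipd (a i) p = ipd (a i) ?v"
  proof (rule Xd.moment_problem[OF a_mem, of "Xd.nrm ?v" "\<lambda>i. ipd (a i) ?v"])
    fix xs :: "(complex \<times> (complex^'d) \<times> 'y) list" assume xs: "set xs \<subseteq> UNIV \<times> idx"
    have "lcomb (\<lambda>i. ipd (a i) ?v) xs = ipd (lcomb a xs) ?v"
      unfolding Xd.ip_lcomb_left[OF a_mem xs v] ..
    then show "cmod (lcomb (\<lambda>i. ipd (a i) ?v) xs) \<le> Xd.nrm ?v * Xd.nrm (lcomb a xs)"
      using Xd.cauchy_schwarz[OF Xd.lcomb_mem[OF a_mem xs] v] by (simp add: mult.commute)
  qed (use v in auto)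
  define e where "e = ?v - p"
  have pX: "p \<in> Xd" using p(1) by (rule cl_Xd)
  have e: "e \<in> Xd" using v pX by (simp add: e_def)
  have perp: "ipd (a i) e = 0" if "i \<in> idx" for i
    using p(2)[OF that] a_mem that v pX by (simp add: e_def Xd.ip_diff_right)
  have "ipd e e = ipd ?v e - ipd p e" using v pX e by (simp add: e_def Xd.ip_diff_left)
  also have "\<dots> = 0"
    using A_perp[OF x e perp] Xd.ip_clspan_eq_0[OF a_mem p(1) e perp] by simp
  finally have "e = 0" using Xd.ip_pos[OF e] by auto
  then show ?thesis using p(1) by (simp add: e_def)
qed

text \<open>Let (v, y) be the image of (x, u), and (p, r) the image of (v, y) under the adjoint. As
  v lies in D, |(p, r)| = |(v, y)|, while |(v, y)|^2 = <(x, u), (p, r)>.\<close>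

lemma contraction:
  assumes x: "x \<in> X" and u: "u \<in> U"
  shows "(\<Sum>j\<in>UNIV. (X.nrm (A j x + B j u))\<^sup>2) + (Y.nrm (C x + S 0 u))\<^sup>2 \<le> (X.nrm x)\<^sup>2 + (U.nrm u)\<^sup>2"
proof -
  define v where "v = (\<lambda>j. A j x) + Bv u"
  define y where "y = C x + S 0 u"
  have v: "v \<in> clspan Xd ipd a idx" unfolding v_def using A_col_cl[OF x] Bv(1)[OF u] by (rule cl_add)
  have vX: "v \<in> Xd" using v by (rule cl_Xd)
  have y: "y \<in> Y" using x u by (simp add: y_def)
  let ?p = "TA v + q 0 y" and ?r = "TB v + Sa 0 y"
  have pr: "?p \<in> X" "?r \<in> U" using vX y by auto
  define N where "N = (Xd.nrm v)\<^sup>2 + (Y.nrm y)\<^sup>2"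
  have N: "(X.nrm ?p)\<^sup>2 + (U.nrm ?r)\<^sup>2 = N" unfolding N_def by (rule coisometry[OF v y])
  have "ipd v v + ipY y y = ipX x ?p + ipU u ?r"
  proof -
    have "ipd v v = ipX x (TA v) + ipU u (TB v)"
      using x u vX by (simp add: ip_TA ip_TB Xd.ip_add_left[symmetric]) (simp add: v_def)
    moreover have "ipY y y = ipX x (q 0 y) + ipU u (Sa 0 y)"
      using x u y by (simp add: Ca_eq[symmetric] P.C.adj_ip Sa_ip Y.ip_add_left[symmetric]) (simp add: y_def)
    ultimately show ?thesis using x u vX y by (simp add: X.ip_add_right U.ip_add_right)
  qed
  then have "N = Re (ipX x ?p) + Re (ipU u ?r)"
    using vX y by (simp add: N_def Xd.nrm_sq Y.nrm_sq flip: plus_complex.sel)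
  also have "\<dots> \<le> X.nrm x * X.nrm ?p + U.nrm u * U.nrm ?r"
    using x u pr by (intro add_mono X.re_cauchy_schwarz U.re_cauchy_schwarz)
  \<comment> \<open>With 2ab \<le> a^2 + b^2 the right side becomes |x|^2 + |u|^2 + N, which avoids
    square roots.\<close>
  finally have "2 * N \<le> 2 * (X.nrm x * X.nrm ?p) + 2 * (U.nrm u * U.nrm ?r)" by simp
  also have "\<dots> \<le> ((X.nrm x)\<^sup>2 + (X.nrm ?p)\<^sup>2) + ((U.nrm u)\<^sup>2 + (U.nrm ?r)\<^sup>2)"
    using sum_squares_bound[of "X.nrm x" "X.nrm ?p"] sum_squares_bound[of "U.nrm u" "U.nrm ?r"]
    by (simp add: mult.assoc)
  finally have "N \<le> (X.nrm x)\<^sup>2 + (U.nrm u)\<^sup>2" using N by simp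
  moreover have "(Xd.nrm v)\<^sup>2 = (\<Sum>j\<in>UNIV. (X.nrm (A j x + B j u))\<^sup>2)"
    unfolding X.ltwo_nrm_sq[OF vX] by (simp add: v_def B_def)
  ultimately show ?thesis by (simp add: N_def y_def)
qed

text \<open>Tested against y, the resolvent term is <B u, a(l, y)>, and \<open>Bv\<close> was built
  so that this equals <u, S(l)^* y - S(0)^* y>.\<close>

lemma realization:
  assumes l: "l \<in> ball_d" and u: "u \<in> U"
  shows "S l u = S 0 u + C (P.R l (\<Sum>j\<in>UNIV. (l $ j) *\<^sub>C B j u))"
proof (rule Y.eq_if_ip_eq)
  have b: "(\<Sum>j\<in>UNIV. (l $ j) *\<^sub>C B j u) \<in> X" using u by (intro X.sum_mem) simp
  show "S l u \<in> Y" "S 0 u + C (P.R l (\<Sum>j\<in>UNIV. (l $ j) *\<^sub>C B j u)) \<in> Y" using l u b by auto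
  fix y assume y: "y \<in> Y"
  have i: "(l, y) \<in> idx" using l y by (simp add: idx_def)
  have ai: "a (l, y) \<in> Xd" "ts (l, y) \<in> U" using a_mem ts_mem i by auto
  have "ipY (C (P.R l (\<Sum>j\<in>UNIV. (l $ j) *\<^sub>C B j u))) y = ipX (\<Sum>j\<in>UNIV. (l $ j) *\<^sub>C B j u) (q l y)"
    using P.CR_ip[OF l b y] l y by (simp add: xi_eq_q)
  also have "\<dots> = ipd (Bv u) (a (l, y))"
    using l u y by (simp add: X.ip_sum_left X.ip_scale_left ipd_eq a_def)
      (simp add: B_def X.ip_scale_right Bv_Xd[OF u, unfolded Xd_iff])
  also have "\<dots> = ipU u (ts (l, y))"
    using Bv(2)[OF u i] Xd.ip_sym[OF ai(1) Bv_Xd[OF u]] U.ip_sym[OF ai(2) u] by simp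
  also have "\<dots> = ipY (S l u) y - ipY (S 0 u) y"
    using l u y by (simp add: ts_def U.ip_diff_right Sa_ip)
  finally show "ipY (S l u) y = ipY (S 0 u + C (P.R l (\<Sum>j\<in>UNIV. (l $ j) *\<^sub>C B j u))) y"
    using l u y b by (simp add: Y.ip_add_left)
qed

section \<open>Commutativity and stability of the shift tuple\<close>

lemma A_commute: "commutative_tuple X A"
  unfolding commutative_tuple_def
proof (intro allI ballI)
  fix i j x assume x: "x \<in> X"
  have "shift i (shift j (Y.coeffs x)) = shift j (shift i (Y.coeffs x))"
    using Y.fock_symmetric[of "Y.coeffs x"] x
    by (auto simp: shift_def fun_eq_iff add_mset_commute)
  then show "A i (A j x) = A j (A i x)"
    using x by (simp add: A_def[of i "A j x"] A_def[of j "A i x"] coeffs_A)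
qed

lemma C_fold_A: "x \<in> X \<Longrightarrow> C (fold A w x) = Y.coeffs x w"
  by (induction w arbitrary: x) (auto simp: C_def coeffs_A shift_def)

text \<open>By \<open>energy\<close> and \<open>C_fold_A\<close>, the state term after N steps is
  the tail of the convergent sum of squared coefficients of \<open>x\<close>.\<close>

lemma A_stable:
  assumes x: "x \<in> X"
  shows "(\<lambda>N. \<Sum>w | length w = N. (X.nrm (fold A w x))\<^sup>2) \<longlonglongrightarrow> 0"
proof -
  have "(\<lambda>N. (X.nrm x)\<^sup>2 - (\<Sum>w | length w < N. (Y.nrm (Y.coeffs x w))\<^sup>2)) \<longlonglongrightarrow>
      (X.nrm x)\<^sup>2 - (Y.F.nrm (Y.coeffs x))\<^sup>2"
    using x by (intro tendsto_intros Y.fock_nrm_lim) simp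
  moreover have "(X.nrm x)\<^sup>2 - (\<Sum>w | length w < N. (Y.nrm (Y.coeffs x w))\<^sup>2) =
      (\<Sum>w | length w = N. (X.nrm (fold A w x))\<^sup>2)" for N
    using P.energy[OF x, of N] x by (simp add: C_fold_A)
  ultimately show ?thesis by (simp add: X_nrm)
qed

end

text \<open>Testing the operator identity on x gives the norm identity. The way back polarizes each
  norm, summing the four values of \<open>k\<close> outside the coordinates.\<close>

lemma isometric_output_pair_iff:
  assumes "hilbert_space X ipX" "hilbert_space Y ipY" "\<forall>j. bounded_op X ipX X ipX (A j)"
    "bounded_op X ipX Y ipY C"
  shows "isometric_output_pair X ipX Y ipY A C \<longleftrightarrow>
    (\<forall>x\<in>X. (\<Sum>j\<in>UNIV. (hnorm ipX (A j x))\<^sup>2) + (hnorm ipY (C x))\<^sup>2 = (hnorm ipX x)\<^sup>2)"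
proof -
  interpret X: hilb X ipX by unfold_locales fact
  interpret Y: hilb Y ipY by unfold_locales fact
  interpret A: hop X ipX X ipX "A j" for j using assms by (intro hopI) auto
  interpret C: hop X ipX Y ipY C using assms by (intro hopI) auto
  define G where "G x = (\<Sum>j\<in>UNIV. A.adj j (A j x)) + C.adj (C x)" for x
  have G_mem: "G x \<in> X" if "x \<in> X" for x
    unfolding G_def using that by (intro X.add_mem X.sum_mem) auto
  have G_ip: "ipX y (G x) = (\<Sum>j\<in>UNIV. ipX (A j y) (A j x)) + ipY (C y) (C x)" if "x \<in> X" "y \<in> X" for x y
  proof -
    have "(\<Sum>j\<in>UNIV. A.adj j (A j x)) \<in> X" using that by (intro X.sum_mem) auto
    then show ?thesis
      unfolding G_def using that by (simp add: X.ip_add_right X.ip_sum_right A.adj_ip C.adj_ip)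
  qed
  have nrm: "Re (ipX x (G x)) = (\<Sum>j\<in>UNIV. (X.nrm (A j x))\<^sup>2) + (Y.nrm (C x))\<^sup>2" if "x \<in> X" for x
    using that by (simp add: G_ip X.nrm_sq Y.nrm_sq)
  have "G x = x" if x: "x \<in> X"
    and iso: "\<forall>x\<in>X. (\<Sum>j\<in>UNIV. (X.nrm (A j x))\<^sup>2) + (Y.nrm (C x))\<^sup>2 = (X.nrm x)\<^sup>2" for x
  proof (rule X.eq_if_ip_eq_left)
    fix y assume y: "y \<in> X"
    define v where "v k = y + (\<i> ^ k) *\<^sub>C x" for k :: nat
    have v: "v k \<in> X" for k using x y by (simp add: v_def)
    have "ipX (A j y) (A j x) = (1/4) * (\<Sum>k<(4::nat). \<i> ^ k * of_real ((X.nrm (A j (v k)))\<^sup>2))" for j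
      using x y X.polarization[of "A j y" "A j x"] by (simp add: v_def A.add A.scale)
    moreover have "ipY (C y) (C x) = (1/4) * (\<Sum>k<(4::nat). \<i> ^ k * of_real ((Y.nrm (C (v k)))\<^sup>2))"
      using x y Y.polarization[of "C y" "C x"] by (simp add: v_def C.add C.scale)
    ultimately have "ipX y (G x) = (1/4) * ((\<Sum>j\<in>UNIV. \<Sum>k<(4::nat). \<i> ^ k * of_real ((X.nrm (A j (v k)))\<^sup>2)) +
        (\<Sum>k<(4::nat). \<i> ^ k * of_real ((Y.nrm (C (v k)))\<^sup>2)))"
      unfolding G_ip[OF x y] by (simp add: sum_distrib_left distrib_left)
    also have "\<dots> = (1/4) * (\<Sum>k<(4::nat). \<i> ^ k *
        of_real ((\<Sum>j\<in>UNIV. (X.nrm (A j (v k)))\<^sup>2) + (Y.nrm (C (v k)))\<^sup>2))"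
      by (subst sum.swap) (simp only: sum.distrib of_real_add of_real_sum distrib_left sum_distrib_left)
    also have "\<dots> = ipX y x"
      using iso v X.polarization[OF y x] by (simp add: v_def)
    finally show "ipX y (G x) = ipX y x" .
  qed (use x G_mem in auto)
  moreover have "(\<Sum>j\<in>UNIV. (X.nrm (A j x))\<^sup>2) + (Y.nrm (C x))\<^sup>2 = (X.nrm x)\<^sup>2" if "x \<in> X" "G x = x" for x
    using nrm[OF that(1)] that by (simp add: X.nrm_sq)
  ultimately show ?thesis
    unfolding isometric_output_pair_def G_def[symmetric] by blast
qed

lemma strongly_stable_iff:
  fixes A :: "'d::{finite,enum} \<Rightarrow> 'x \<Rightarrow> 'x"
  assumes "\<And>j x. x \<in> X \<Longrightarrow> A j x \<in> X" "commutative_tuple X A"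
  shows "strongly_stable X ipX A \<longleftrightarrow>
    (\<forall>x\<in>X. (\<lambda>N. \<Sum>w | length w = N. (hnorm ipX (fold A w x))\<^sup>2) \<longlonglongrightarrow> 0)"
  unfolding strongly_stable_def
  using sum_multinomial_eq_sum_words[of X A _ _ "\<lambda>v. (hnorm ipX v)\<^sup>2"] assms by simp

lemma good_realization_imp_inner:
  fixes S :: "complex^'d::{finite,enum} \<Rightarrow> 'u::cvector \<Rightarrow> 'y::cvector" and X :: "'x::cvector set"
  assumes U: "hilbert_space U ipU" and Y: "hilbert_space Y ipY"
    and S: "\<forall>l\<in>ball_d. bounded_op U ipU Y ipY (S l)"
    and G: "good_realization X ipX U ipU Y ipY A B C D S"
  shows "inner_multiplier U ipU Y ipY S"
proof -
  note G = G[unfolded good_realization_def]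
  have X: "hilbert_space X ipX" and A: "\<forall>j. bounded_op X ipX X ipX (A j)"
    and B: "\<forall>j. bounded_op U ipU X ipX (B j)" and C: "bounded_op X ipX Y ipY C"
    and D: "bounded_op U ipU Y ipY D" and wc: "weakly_coisometric X ipX U ipU Y ipY A B C D"
    and re: "realizes X U A B C D S" and co: "commutative_tuple X A"
    and st: "strongly_stable X ipX A" and io: "isometric_output_pair X ipX Y ipY A C"
    using G by blast+
  have AX: "A j x \<in> X" if "x \<in> X" for j x
    using A that unfolding bounded_op_def by blast
  interpret isopair X ipX Y ipY "TYPE('d)" A C
    by unfold_locales
      (use X Y A C io isometric_output_pair_iff[OF X Y A C] in auto)
  interpret stable_isopair X ipX Y ipY "TYPE('d)" A C
    by unfold_locales (use co st strongly_stable_iff[OF AX co] in auto)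
  interpret multiplier U ipU Y ipY "TYPE('d)" S
    by unfold_locales (use U S in auto)
  interpret weak_realization X ipX Y ipY "TYPE('d)" A C U ipU S B D
  proof
    show "S l u = D u + C (R l (\<Sum>j\<in>UNIV. (l $ j) *\<^sub>C B j u))" if "l \<in> ball_d" "u \<in> U" for l u
      using re that unfolding realizes_def R_def Z_def[abs_def] by blast
    show "(X.nrm ((\<Sum>j\<in>UNIV. Aa j (w j)) + Ca y))\<^sup>2
        + (U.nrm ((\<Sum>j\<in>UNIV. hadj U ipU X ipX (B j) (w j)) + hadj U ipU Y ipY D y))\<^sup>2
        = (hnorm_d ipX w)\<^sup>2 + (Y.nrm y)\<^sup>2" if "w \<in> D_space X ipX Y ipY A C" "y \<in> Y" for w y
      using wc that unfolding weakly_coisometric_def by blast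
  qed (use B D in auto)
  show ?thesis by (rule inner)
qed

lemma inner_imp_good_realization:
  fixes S :: "complex^'d::{finite,enum} \<Rightarrow> 'u::cvector \<Rightarrow> 'y::cvector"
  assumes U: "hilbert_space U ipU" and Y: "hilbert_space Y ipY"
    and S: "\<forall>l\<in>ball_d. bounded_op U ipU Y ipY (S l)"
    and inner: "inner_multiplier U ipU Y ipY S"
  shows "\<exists>(X :: (complex^'d::_ \<Rightarrow> 'y) set) ipX A B C D. good_realization X ipX U ipU Y ipY A B C D S"
proof -
  have schur: "schur_class U ipU Y ipY S" using inner by (simp add: inner_multiplier_def)
  interpret contractive_multiplier U ipU Y ipY "TYPE('d)" S
    by unfold_locales (use U Y S schur in \<open>auto simp: schur_class_def\<close>)
  interpret inner_mult U ipU Y ipY "TYPE('d)" S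
    by unfold_locales
      (use inner inner_multiplier_iff schur in \<open>auto simp: schur_class_def\<close>)
  have "weakly_coisometric X ipX U ipU Y ipY A B C (S 0)"
    unfolding weakly_coisometric_def
  proof (intro conjI ballI)
    fix w y assume w: "w \<in> D_space X ipX Y ipY A C" and y: "y \<in> Y"
    have cl: "w \<in> clspan Xd ipd a idx" using w by (simp add: D_space_eq)
    show "(X.nrm ((\<Sum>j\<in>UNIV. P.Aa j (w j)) + P.Ca y))\<^sup>2 +
        (U.nrm ((\<Sum>j\<in>UNIV. Ba j (w j)) + Sa 0 y))\<^sup>2 = (hnorm_d ipX w)\<^sup>2 + (Y.nrm y)\<^sup>2"
      using coisometry[OF cl y] y by (simp add: TA_def TB_def Ca_eq Xd_nrm[OF cl_Xd[OF cl]])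
  qed (rule contraction)
  moreover have "realizes X U A B C (S 0) S"
    unfolding realizes_def using realization[unfolded P.R_def P.Z_def[abs_def]] by (intro ballI)
  moreover have "strongly_stable X ipX A"
    using strongly_stable_iff[OF _ A_commute] A_stable by simp
  moreover have "isometric_output_pair X ipX Y ipY A C"
    using isometric_output_pair_iff[OF X_hilbert Y, of A C] P.A_bounded P.C_bounded P.isometric by simp
  ultimately have "good_realization X ipX U ipU Y ipY A B C (S 0) S"
    unfolding good_realization_def
    using X_hilbert P.A_bounded P.C_bounded B_bounded S_bounded[OF zero_ball] A_commute by simp
  then show ?thesis by blast
qed

text \<open>The type of the state space has to be named. Existence is stated for the constructed
  space of functions on the ball, the converse for state spaces of an arbitrary type
  \<open>'x\<close>.\<close>

theorem theorem4p3:
  fixes U :: "'u::cvector set" and ipU :: "'u \<Rightarrow> 'u \<Rightarrow> complex"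
    and Y :: "'y::cvector set" and ipY :: "'y \<Rightarrow> 'y \<Rightarrow> complex"
    and S :: "complex^'d::{finite,enum} \<Rightarrow> 'u \<Rightarrow> 'y"
  assumes "hilbert_space U ipU" and "hilbert_space Y ipY"
    and "\<forall>l\<in>ball_d. bounded_op U ipU Y ipY (S l)"
  shows "(inner_multiplier U ipU Y ipY S \<longrightarrow>
            (\<exists>(X :: (complex^'d::_ \<Rightarrow> 'y) set) ipX A B C D.
               good_realization X ipX U ipU Y ipY A B C D S))
       \<and> (\<forall>(X :: 'x::cvector set) ipX A B C D.
            good_realization X ipX U ipU Y ipY A B C D S \<longrightarrow> inner_multiplier U ipU Y ipY S)"
  using inner_imp_good_realization[OF assms] good_realization_imp_inner[OF assms] by blast

end
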